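(* Let $\mathcal K$ be a differential field of characteristic $0$ and let $A,B\in M_n(\mathcal K[\partial])$ with $\det B\neq0$ satisfy $$A^*B+B^*A=0.$$ If $AB^{-1}$ is a minimal fractional decomposition, then $\mathcal L_{A,B}=\{BP\oplus AP\mid P\in\mathcal K^n\}\subset\mathcal K^n\oplus\mathcal K^n$ is a maximal isotropic subspace. Namely, if $\ker\bar A\cap\ker\bar B=0$ (kernels in $\bar{\mathcal K}^n$, with $\bar{\mathcal K}$ the linear closure of $\mathcal K$), then: whenever $G,H\in\mathcal K^n$ are such that $A^*H+B^*G=0$, there exists $F\in\mathcal K^n$ such that $G=AF$ and $H=BF$.
   Context: Let $\mathcal K$ be a differential field (a field with a derivation $\partial$), of characteristic $0$, with subfield of constants $\mathcal C=\ker\partial$. $\mathcal K[\partial]$ is the algebra of differential operators; $\mathcal K(\partial)$ is its skewfield of fractions (inside the pseudodifferential operators $\mathcal K((\partial^{-1}))$). Matrices in $M_n(\mathcal K[\partial])$ act on $\mathcal F^n$ for any differential field extension $\mathcal F$ of $\mathcal K$. The adjoint is the anti-involution of $\mathcal K[\partial]$ with $f^*=f$ ($f\in\mathcal K$), $\partial^*=-\partial$; for matrices $(A^* )_{ij}=(A_{ji})^*$. $\det$ is the Dieudonné determinant: $\det(A)$ is $0$ or $\det_1(A)\lambda^{d(A)}$ with $0\neq\det_1(A)\in\mathcal K$, $d(A)\in\mathbb Z$; it is multiplicative, and for upper triangular $A$ with non-zero diagonal entries, $\det_1(A)$ is the product of the leading coefficients and $d(A)$ the sum of the orders of the diagonal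 entries ($\det A=0$ if some diagonal entry is $0$). $A$ is non-degenerate if $\det(A)\ne0$ (equivalently, invertible over $\mathcal K(\partial)$). Maximal isotropicity: consider the form $(P_1\oplus Q_1|P_2\oplus Q_2)=\int(P_1\cdot Q_2+P_2\cdot Q_1)$ on $\mathcal K^n\oplus\mathcal K^n$ with values in $\mathcal K/\partial\mathcal K$, where $\int:\mathcal K\to\mathcal K/\partial\mathcal K$ is the quotient map. Isotropicity of $\mathcal L_{A,B}$ is identified with the condition $A^*B+B^*A=0$, and "$\mathcal L_{A,B}$ is maximal isotropic" is to be understood as: $A^*B+B^*A=0$, and whenever $G,H\in\mathcal K^n$ satisfy $A^*H+B^*G=0$ there is $F\in\mathcal K^n$ with $G=AF$, $H=BF$. Minimal fractional decomposition: $AB^{-1}$ (with $B$ non-degenerate) is minimal if it satisfies any one of the following equivalent conditions: (i) $d(B)\leq d(B')$ for all $A',B'\in M_n(\mathcal K[\partial])$, $B'$ non-degenerate, with $A'B'^{-1}=AB^{-1}$; (ii) if $A=A_1D$, $B=B_1D$ with $A_1,B_1,D\in M_n(\mathcal K[\partial])$, then $D$ is invertible in $M_n(\mathcal K[\partial])$; (iii) $\ker\bar A\cap\ker\bar B=0$, where $\bar A,\bar B$ are $A,B$ acting on $\bar{\mathcal K}^n$. Linear closure $\bar{\mathcal K}$: if $\mathcal C$ is algebraically closed, a Picard-Vessiot extension of $\mathcal K$ with respect to $L\in\mathcal K[\partial]$ of order $m$ is a differential field extension $\mathcal L\supset\mathcal K$ with no new constants and $\mathcal L=\mathcal K(y_1,\dots,y_m)$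 (generated as a differential field), with $y_1,\dots,y_m$ solutions of $Ly=0$ linearly independent over $\mathcal C$. The Picard-Vessiot compositum of $\mathcal K$ is the (unique up to isomorphism) minimal extension that is the union of its Picard-Vessiot subextensions of $\mathcal K$ and contains an isomorphic copy of every Picard-Vessiot extension of $\mathcal K$. With $\mathcal K_0=\mathcal K$ and $\mathcal K_{i+1}$ the Picard-Vessiot compositum of $\mathcal K_i$, the linear closure is $\bigcup_i\mathcal K_i$. For general $\mathcal K$, the linear closure is that of the differential field $\bar{\mathcal C}\otimes_{\mathcal C}\mathcal K$ (whose field of constants is the algebraic closure $\bar{\mathcal C}$). The linear closure is linearly closed: every homogeneous linear differential equation of order $\ge1$ over it has a non-zero solution in it. *)

theory Defs
  imports
    "HOL-Algebra.Generated_Fields"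
    "HOL-Algebra.Algebraic_Closure_Type"
    "HOL-Analysis.Cartesian_Space"
begin

hide_const (open) Polynomials.degree Polynomials.lead_coeff

section \<open>Differential fields and scalar differential operators\<close>

class diff_field = field_char_0 +
  fixes der :: "'a \<Rightarrow> 'a"
  assumes der_add: "der (x + y) = der x + der y"
    and der_mult: "der (x * y) = der x * y + x * der y"
begin

lemma der_0 [simp]: "der 0 = 0"
  using der_add[of 0 0] by simp

lemma der_1 [simp]: "der 1 = 0"
  using der_mult[of 1 1] by simp

end

text \<open>
  The operator $\sum_i a_i \partial^i$ (coefficients on the left) is represented by the polynomial
  with coefficients $a_i$.  It is a formal object, not a map on the field: for instance the
  derivation may vanish identically.
\<close>

typedef (overloaded) 'a diffop = "UNIV :: 'a::zero poly set"
  morphisms symb Diffop ..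

lemma symb_Diffop [simp]: "symb (Diffop p) = p"
  by (simp add: Diffop_inverse)

lemma diffop_eq_iff: "P = Q \<longleftrightarrow> symb P = symb Q"
  by (simp add: symb_inject)

text \<open>Left multiplication by $\partial$, from $\partial a = a \partial + a'$.\<close>

definition der_lmult :: "'a::diff_field poly \<Rightarrow> 'a poly" where
  "der_lmult q = pCons 0 q + map_poly der q"

definition skew_mult :: "'a::diff_field poly \<Rightarrow> 'a poly \<Rightarrow> 'a poly" where
  "skew_mult p q = (\<Sum>i\<le>degree p. smult (coeff p i) ((der_lmult ^^ i) q))"

lemma der_lmult_add: "der_lmult (p + q) = der_lmult p + der_lmult q"
  by (rule poly_eqI) (simp add: der_lmult_def coeff_map_poly der_add coeff_pCons split: nat.split)

lemma der_lmult_0 [simp]: "der_lmult 0 = 0"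
  by (simp add: der_lmult_def)

lemma der_lmult_smult: "der_lmult (smult a q) = smult a (der_lmult q) + smult (der a) q"
  by (rule poly_eqI)
    (simp add: der_lmult_def coeff_map_poly der_mult coeff_pCons algebra_simps split: nat.split)

lemma der_lmult_sum: "der_lmult (sum f A) = (\<Sum>x\<in>A. der_lmult (f x))"
  by (induction A rule: infinite_finite_induct) (simp_all add: der_lmult_add)

lemma der_lmult_pow_add: "(der_lmult ^^ i) (p + q) = (der_lmult ^^ i) p + (der_lmult ^^ i) q"
  by (induction i) (simp_all add: der_lmult_add)

lemma der_lmult_pow_one: "(der_lmult ^^ i) 1 = monom 1 i"
proof (induction i)
  case (Suc i)
  have "map_poly der (monom (1::'a) i) = 0"
    by (rule poly_eqI) (simp add: coeff_map_poly)
  then show ?case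
    using Suc by (simp add: der_lmult_def monom_Suc)
qed simp

lemma skew_mult_ge:
  assumes "degree p \<le> n"
  shows "skew_mult p q = (\<Sum>i\<le>n. smult (coeff p i) ((der_lmult ^^ i) q))"
  unfolding skew_mult_def
  by (rule sum.mono_neutral_left) (use assms in \<open>auto simp: coeff_eq_0\<close>)

lemma skew_mult_0_left [simp]: "skew_mult 0 q = 0"
  by (simp add: skew_mult_def)

lemma skew_mult_add_left: "skew_mult (p + p') q = skew_mult p q + skew_mult p' q"
proof -
  let ?n = "max (degree p) (degree p')"
  have "degree (p + p') \<le> ?n"
    by (rule degree_add_le_max)
  then show ?thesis
    by (simp add: skew_mult_ge[of _ ?n] smult_add_left sum.distrib)
qed

lemma skew_mult_add_right: "skew_mult p (q + q') = skew_mult p q + skew_mult p q'"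
  by (simp add: skew_mult_def der_lmult_pow_add smult_add_right sum.distrib)

lemma skew_mult_smult_left: "skew_mult (smult a p) q = smult a (skew_mult p q)"
proof -
  have "degree (smult a p) \<le> degree p"
    by (rule degree_smult_le)
  then show ?thesis
    by (intro poly_eqI) (simp add: skew_mult_ge[of _ "degree p"] coeff_sum sum_distrib_left mult.assoc)
qed

lemma skew_mult_sum_left: "skew_mult (sum f A) q = (\<Sum>x\<in>A. skew_mult (f x) q)"
  by (induction A rule: infinite_finite_induct) (simp_all add: skew_mult_add_left)

lemma skew_mult_pCons_0: "skew_mult (pCons 0 p) q = (\<Sum>i\<le>degree p. smult (coeff p i) ((der_lmult ^^ Suc i) q))"
proof -
  have "degree (pCons 0 p) \<le> Suc (degree p)"
    by (rule degree_pCons_le)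
  then show ?thesis
    by (simp add: skew_mult_ge[of _ "Suc (degree p)"] sum.atMost_Suc_shift del: sum.atMost_Suc)
qed

lemma der_lmult_skew: "der_lmult (skew_mult p q) = skew_mult (der_lmult p) q"
proof -
  have "degree (map_poly der p) \<le> degree p"
    by (rule degree_le) (simp add: coeff_map_poly coeff_eq_0)
  then have "skew_mult (map_poly der p) q = (\<Sum>i\<le>degree p. smult (der (coeff p i)) ((der_lmult ^^ i) q))"
    by (simp add: skew_mult_ge[of _ "degree p"] coeff_map_poly)
  then show ?thesis
    by (simp add: der_lmult_def[of p] skew_mult_add_left skew_mult_pCons_0)
      (simp add: skew_mult_def der_lmult_sum der_lmult_smult sum.distrib)
qed

lemma der_lmult_pow_skew: "(der_lmult ^^ i) (skew_mult p q) = skew_mult ((der_lmult ^^ i) p) q"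
  by (induction i) (simp_all add: der_lmult_skew)

lemma skew_mult_assoc: "skew_mult (skew_mult p q) r = skew_mult p (skew_mult q r)"
  by (simp add: skew_mult_def[of p] skew_mult_sum_left skew_mult_smult_left der_lmult_pow_skew)

lemma skew_mult_1_left: "skew_mult 1 q = q"
  by (simp add: skew_mult_def)

lemma skew_mult_1_right: "skew_mult p 1 = p"
  by (simp add: skew_mult_def der_lmult_pow_one smult_monom poly_as_sum_of_monoms)

instantiation diffop :: (diff_field) ring_1
begin

definition "0 = Diffop 0"
definition "1 = Diffop 1"
definition "P + Q = Diffop (symb P + symb Q)"
definition "P - Q = Diffop (symb P - symb Q)"
definition "- P = Diffop (- symb P)"
definition "P * Q = Diffop (skew_mult (symb P) (symb Q))"

instance
  by standard
    (simp_all add: diffop_eq_iff zero_diffop_def one_diffop_def plus_diffop_def minus_diffop_def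
      uminus_diffop_def times_diffop_def skew_mult_assoc skew_mult_1_left skew_mult_1_right
      skew_mult_add_left skew_mult_add_right)

end

definition const_op :: "'a::diff_field \<Rightarrow> 'a diffop" where
  "const_op f = Diffop [:f:]"

definition der_op :: "'a::diff_field diffop" where
  "der_op = Diffop [:0, 1:]"

lemma der_op_const_op: "der_op * const_op f = const_op f * der_op + const_op (der f)"
  by (simp add: diffop_eq_iff der_op_def const_op_def times_diffop_def plus_diffop_def
      skew_mult_def der_lmult_def map_poly_pCons)

text \<open>On the zero operator these two have the conventional values $0$.\<close>

definition op_order :: "'a::diff_field diffop \<Rightarrow> nat" where
  "op_order P = degree (symb P)"

definition op_lead :: "'a::diff_field diffop \<Rightarrow> 'a" where
  "op_lead P = lead_coeff (symb P)"

definition adj :: "'a::diff_field diffop \<Rightarrow> 'a diffop" where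
  "adj P = (\<Sum>i\<le>op_order P. (- der_op) ^ i * const_op (coeff (symb P) i))"

text \<open>
  The action of an operator over \<open>'k\<close> on a differential extension field \<open>'l\<close>
  with structure map \<open>\<iota>\<close>.
\<close>

definition op_apply :: "('k \<Rightarrow> 'l) \<Rightarrow> 'k::diff_field diffop \<Rightarrow> 'l::diff_field \<Rightarrow> 'l" where
  "op_apply \<iota> P y = (\<Sum>i\<le>op_order P. \<iota> (coeff (symb P) i) * (der ^^ i) y)"

section \<open>Matrix differential operators\<close>

definition mat_adj :: "'k::diff_field diffop^'n^'m \<Rightarrow> 'k diffop^'m^'n" where
  "mat_adj A = (\<chi> i j. adj (A $ j $ i))"

definition mat_apply :: "('k \<Rightarrow> 'l) \<Rightarrow> 'k::diff_field diffop^'n^'m \<Rightarrow> 'l::diff_field^'n \<Rightarrow> 'l^'m" where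
  "mat_apply \<iota> A v = (\<chi> i. \<Sum>j\<in>UNIV. op_apply \<iota> (A $ i $ j) (v $ j))"

text \<open>
  The value $\det_1(A) \lambda^{d(A)}$ of the Dieudonne determinant is encoded as a monomial in
  $\lambda$, a polynomial over the field.  The three conditions determine the function uniquely:
  transvections and permutation matrices have determinant $\pm 1$ by multiplicativity, and Euclidean
  division brings every matrix of differential operators to upper triangular form using
  transvections.  Existence is Dieudonne's theorem for the skewfield of fractions; on matrices of
  differential operators (rather than of fractions) the exponent is nonnegative.
\<close>

definition upper_triangular :: "'a::zero^'n::{finite,linorder}^'n::{finite,linorder} \<Rightarrow> bool" where
  "upper_triangular A \<longleftrightarrow> (\<forall>i j. j < i \<longrightarrow> A $ i $ j = 0)"

definition dieudonne_det :: "'k::diff_field diffop^'n::{finite,linorder}^'n::{finite,linorder} \<Rightarrow> 'k poly" where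
  "dieudonne_det = (THE f.
     (\<forall>A. \<exists>c d. f A = monom c d) \<and>
     (\<forall>A B. f (A ** B) = f A * f B) \<and>
     (\<forall>A. upper_triangular A \<longrightarrow>
        f A = (\<Prod>i\<in>UNIV. monom (op_lead (A $ i $ i)) (op_order (A $ i $ i)))))"

definition frac_subspace :: "'k::diff_field diffop^'n^'n \<Rightarrow> 'k diffop^'n^'n \<Rightarrow> (('k^'n) \<times> ('k^'n)) set" where
  "frac_subspace A B = {(mat_apply id B P, mat_apply id A P) | P. True}"

definition maximal_isotropic :: "'k::diff_field diffop^'n^'n \<Rightarrow> 'k diffop^'n^'n \<Rightarrow> bool" where
  "maximal_isotropic A B \<longleftrightarrow>
     mat_adj A ** B + mat_adj B ** A = 0 \<and>
     (\<forall>G H. mat_apply id (mat_adj A) H + mat_apply id (mat_adj B) G = 0 \<longrightarrow>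
        (H, G) \<in> frac_subspace A B)"

section \<open>Picard-Vessiot extensions and the linear closure\<close>

definition diff_field_on :: "'a ring \<Rightarrow> ('a \<Rightarrow> 'a) \<Rightarrow> bool" where
  "diff_field_on R \<delta> \<longleftrightarrow> field R \<and> \<delta> \<in> carrier R \<rightarrow> carrier R \<and>
     (\<forall>x\<in>carrier R. \<forall>y\<in>carrier R.
        \<delta> (x \<oplus>\<^bsub>R\<^esub> y) = \<delta> x \<oplus>\<^bsub>R\<^esub> \<delta> y \<and>
        \<delta> (x \<otimes>\<^bsub>R\<^esub> y) = (\<delta> x \<otimes>\<^bsub>R\<^esub> y) \<oplus>\<^bsub>R\<^esub> (x \<otimes>\<^bsub>R\<^esub> \<delta> y))"

definition diff_hom :: "'a ring \<Rightarrow> ('a \<Rightarrow> 'a) \<Rightarrow> 'b ring \<Rightarrow> ('b \<Rightarrow> 'b) \<Rightarrow> ('a \<Rightarrow> 'b) set" where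
  "diff_hom R \<delta> S \<epsilon> = {h \<in> ring_hom R S. \<forall>x\<in>carrier R. h (\<delta> x) = \<epsilon> (h x)}"

definition constants_on :: "'a ring \<Rightarrow> ('a \<Rightarrow> 'a) \<Rightarrow> 'a set" where
  "constants_on R \<delta> = {x \<in> carrier R. \<delta> x = \<zero>\<^bsub>R\<^esub>}"

text \<open>
  \<open>(R, \<delta>)\<close>, with the embedding \<open>j\<close> of \<open>(E, d)\<close>, is a Picard-Vessiot extension of \<open>(E, d)\<close> with
  respect to the operator $\sum_{i \le m} a_i \partial^i$.
\<close>

definition picard_vessiot_wrt ::
  "'a ring \<Rightarrow> ('a \<Rightarrow> 'a) \<Rightarrow> ('a \<Rightarrow> 'b) \<Rightarrow> 'b ring \<Rightarrow> ('b \<Rightarrow> 'b) \<Rightarrow> nat \<Rightarrow> (nat \<Rightarrow> 'a) \<Rightarrow> bool" where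
  "picard_vessiot_wrt E d j R \<delta> m a \<longleftrightarrow>
     diff_field_on E d \<and> diff_field_on R \<delta> \<and> j \<in> diff_hom E d R \<delta> \<and>
     constants_on R \<delta> = j ` constants_on E d \<and>
     (\<forall>i\<le>m. a i \<in> carrier E) \<and> a m \<noteq> \<zero>\<^bsub>E\<^esub> \<and>
     (\<exists>ys. length ys = m \<and> set ys \<subseteq> carrier R \<and>
        (\<forall>y\<in>set ys. (\<Oplus>\<^bsub>R\<^esub>i\<in>{..m}. j (a i) \<otimes>\<^bsub>R\<^esub> (\<delta> ^^ i) y) = \<zero>\<^bsub>R\<^esub>) \<and>
        ring.independent R (j ` constants_on E d) ys \<and>
        carrier R = generate_field R (j ` carrier E \<union> {(\<delta> ^^ k) y | k y. y \<in> set ys}))"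

definition picard_vessiot ::
  "'a ring \<Rightarrow> ('a \<Rightarrow> 'a) \<Rightarrow> ('a \<Rightarrow> 'b) \<Rightarrow> 'b ring \<Rightarrow> ('b \<Rightarrow> 'b) \<Rightarrow> bool" where
  "picard_vessiot E d j R \<delta> \<longleftrightarrow> (\<exists>m a. picard_vessiot_wrt E d j R \<delta> m a)"

definition restrict_field :: "'l::field set \<Rightarrow> 'l ring" where
  "restrict_field S = ring_of_type_algebra\<lparr>carrier := S\<rparr>"

text \<open>
  \<open>M\<close> is the union of its Picard-Vessiot subextensions of \<open>E\<close> and contains, up to isomorphism
  over \<open>E\<close>, every Picard-Vessiot extension of \<open>E\<close>.  The abstract extensions \<open>R\<close> range over all
  field structures on subsets of the type \<open>'l\<close>.  This is no restriction: a Picard-Vessiot extension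
  of the infinite field \<open>E\<close> has the cardinality of \<open>E \<subseteq> UNIV\<close>, so it is isomorphic to one of these.
\<close>

definition pv_complete :: "'l::diff_field set \<Rightarrow> 'l set \<Rightarrow> bool" where
  "pv_complete E M \<longleftrightarrow>
     diff_field_on (restrict_field M) der \<and> E \<subseteq> M \<and>
     (\<forall>x\<in>M. \<exists>F\<subseteq>M. x \<in> F \<and> picard_vessiot (restrict_field E) der id (restrict_field F) der) \<and>
     (\<forall>(R :: 'l ring) \<delta> j. picard_vessiot (restrict_field E) der j R \<delta> \<longrightarrow>
        (\<exists>\<phi>\<in>diff_hom R \<delta> (restrict_field M) der. \<forall>x\<in>E. \<phi> (j x) = x))"

definition pv_compositum :: "'l::diff_field set \<Rightarrow> 'l set \<Rightarrow> bool" where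
  "pv_compositum E M \<longleftrightarrow> pv_complete E M \<and> (\<forall>N. pv_complete E N \<and> N \<subseteq> M \<longrightarrow> N = M)"

definition diff_embedding :: "('k::diff_field \<Rightarrow> 'l::diff_field) \<Rightarrow> bool" where
  "diff_embedding \<iota> \<longleftrightarrow> \<iota> 1 = 1 \<and>
     (\<forall>x y. \<iota> (x + y) = \<iota> x + \<iota> y) \<and> (\<forall>x y. \<iota> (x * y) = \<iota> x * \<iota> y) \<and> (\<forall>x. \<iota> (der x) = der (\<iota> x))"

text \<open>
  With \<open>C\<close> the constants of \<open>'k\<close> and \<open>Cb \<supseteq> \<iota> ` C\<close>: the canonical map
  $Cb \otimes_C {'k} \to {'l}$, $c \otimes f \mapsto c\,\iota(f)$, is injective with image \<open>T\<close>.
  If moreover \<open>Cb\<close> consists of constants, \<open>der\<close> on \<open>T\<close> is the derivation of the tensor product.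
\<close>

definition internal_tensor :: "('k::diff_field \<Rightarrow> 'l::diff_field) \<Rightarrow> 'l set \<Rightarrow> 'l set \<Rightarrow> bool" where
  "internal_tensor \<iota> Cb T \<longleftrightarrow>
     T = {\<Sum>i<n. c i * \<iota> (f i) | (n::nat) c f. \<forall>i<n. c i \<in> Cb} \<and>
     (\<forall>(n::nat) c f.
        (\<forall>a. (\<forall>i<n. der (a i) = 0) \<and> (\<Sum>i<n. a i * f i) = 0 \<longrightarrow> (\<forall>i<n. a i = 0)) \<and>
        (\<forall>i<n. c i \<in> Cb) \<and> (\<Sum>i<n. c i * \<iota> (f i)) = 0 \<longrightarrow> (\<forall>i<n. c i = 0))"

text \<open>
  \<open>'l\<close>, with the embedding \<open>\<iota>\<close>, is a linear closure of \<open>'k\<close>.  If the constants of \<open>'k\<close> are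
  algebraically closed then \<open>Cb = \<iota> ` C\<close> and \<open>Ks 0 = range \<iota>\<close>.
\<close>

definition linear_closure :: "('k::diff_field \<Rightarrow> 'l::diff_field) \<Rightarrow> bool" where
  "linear_closure \<iota> \<longleftrightarrow> diff_embedding \<iota> \<and>
     (\<exists>Cb Ks. Cb \<subseteq> {c. der c = 0} \<and>
        algebraic_closure (restrict_field Cb) (\<iota> ` {c. der c = 0}) \<and>
        internal_tensor \<iota> Cb (Ks 0) \<and>
        (\<forall>i::nat. pv_compositum (Ks i) (Ks (Suc i))) \<and>
        (\<Union>i. Ks i) = UNIV)"

text \<open>
  Minimality of the fractional decomposition $AB^{-1}$, in the form: the kernels over the linear
  closure intersect trivially.
\<close>

definition minimal_fraction ::
  "('k::diff_field \<Rightarrow> 'l::diff_field) \<Rightarrow> 'k diffop^'n^'n \<Rightarrow> 'k diffop^'n^'n \<Rightarrow> bool" where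
  "minimal_fraction \<iota> A B \<longleftrightarrow> {v. mat_apply \<iota> A v = 0} \<inter> {v. mat_apply \<iota> B v = 0} = {0}"

end

theory Submission
  imports Defs "Jordan_Normal_Form.Determinant"
begin

text \<open>
  Throughout, \<open>R\<close> stands for the ring \<open>\<K>[\<partial>]\<close> of differential operators.  The proof has an algebraic
  half, which replaces the condition on kernels by a Bezout identity, and a differential half, which
  provides solutions of linear differential equations in the linear closure.

  Algebraic half.  Suppose that \<open>C A + D B = 1\<close>.  Then the column \<open>(B; A)\<close> has the left inverse
  \<open>(D C)\<close>, and taking adjoints, the row \<open>(A\<^sup>* B\<^sup>*)\<close> has the right inverse \<open>(C\<^sup>*; D\<^sup>*)\<close>.  Isotropicity says
  that the row annihilates the column.  Hence, after subtracting from \<open>(D C)\<close> a multiple of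
  \<open>(A\<^sup>* B\<^sup>*)\<close>, the rows and the columns form matrices \<open>U\<close> and \<open>V\<close> of size \<open>2n\<close> with \<open>U V = 1\<close>.  As \<open>R\<close> is
  a Euclidean, hence an Ore domain, \<open>V U = 1\<close> follows, and this identity applied to \<open>(H; G)\<close> with
  \<open>A\<^sup>* H + B\<^sup>* G = 0\<close> reads \<open>H = B F\<close>, \<open>G = A F\<close> for \<open>F = D H + C G\<close> (\<open>isotropic_coprime_solution\<close>).
  The Bezout identity says that the rows of \<open>A\<close> and \<open>B\<close> generate the left module \<open>R\<^sup>n\<close>.  If they did
  not, the quotient by them would have a cyclic quotient \<open>R / R P\<close> with \<open>P\<close> not a unit, and a
  non-zero solution of \<open>P y = 0\<close> would define a non-zero vector in both kernels
  (\<open>submodule_eq_UNIV\<close>, \<open>bezout_of_minimal_fraction\<close>).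

  Differential half.  It remains to solve \<open>P y = 0\<close> in the linear closure when \<open>P\<close> has positive
  order.  The closure contains a copy of every Picard-Vessiot extension of its base field \<open>E\<close>, whose
  constants are algebraically closed (\<open>linear_closure_base\<close>), so a Picard-Vessiot extension of \<open>E\<close>
  for \<open>P\<close> has to be constructed.  Let \<open>\<Omega>\<close> be an algebraically closed field containing \<open>E\<close>.  The
  Taylor map \<open>x \<mapsto> \<Sum> x\<^sup>(\<^sup>k\<^sup>) t\<^sup>k / k!\<close> embeds \<open>E\<close> into \<open>\<Omega>((t))\<close>, where \<open>P\<close> has fundamental systems \<open>Y\<close> of
  solutions.  The field \<open>E\<langle>Y\<rangle>\<close> may have new constants, but not if \<open>Y\<close> is chosen with
  the transcendence degree of \<open>E\<langle>Y\<rangle>\<close> over \<open>E\<close> minimal.  Indeed, a new constant \<open>c\<close> would be transcendental over \<open>E\<close>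
  (\<open>algebraic_constant\<close>).  Sending \<open>c\<close> to a suitable natural number \<open>k\<close> then defines a homomorphism
  on \<open>E[c]\<close> that extends to \<open>\<psi>: E[c, Y, Y', \<dots>] \<rightarrow> \<Omega>\<close> without killing the Wronskian of \<open>Y\<close>
  (\<open>hom_extension_adjoins\<close>).  The Taylor map of \<open>\<psi>\<close> commutes with derivations, so it sends \<open>Y\<close> to
  another fundamental system, and as it kills \<open>c - k\<close>, the new system has smaller transcendence
  degree (\<open>specialization\<close>, \<open>ex_fundamental_without_new_constants\<close>).  Finally, the field \<open>E\<langle>Y\<rangle>\<close> is not
  larger than the linear closure as a set, so a copy of it lives on a subset of the linear closure
  (\<open>transport\<close>), and the closure property applies to that copy (\<open>solution_of_pv_complete\<close>).
\<close>

(* Matrices of variable size occur only in Wronskians, always with qualified names; otherwise mat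
   refers to matrices indexed by finite types. *)
hide_const (open) Matrix.mat
no_notation vec_index (infixl \<open>$\<close> 100)

lemmas cart_eq_iff = Finite_Cartesian_Product.vec_eq_iff
lemmas cart_mat_def = Finite_Cartesian_Product.mat_def

section \<open>The ring of differential operators\<close>

lemma symb_0 [simp]: "symb 0 = 0" and symb_1 [simp]: "symb 1 = 1"
  and symb_add [simp]: "symb (P + Q) = symb P + symb Q"
  and symb_diff [simp]: "symb (P - Q) = symb P - symb Q"
  and symb_uminus [simp]: "symb (- P) = - symb P"
  and symb_const_op [simp]: "symb (const_op f) = [:f:]"
  by (simp_all add: zero_diffop_def one_diffop_def plus_diffop_def minus_diffop_def uminus_diffop_def const_op_def)

lemma symb_eq_0_iff [simp]: "symb P = 0 \<longleftrightarrow> P = 0"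
  by (simp add: diffop_eq_iff)

lemma symb_mult: "symb (P * Q) = skew_mult (symb P) (symb Q)"
  by (simp add: times_diffop_def)

lemma symb_sum [simp]: "symb (sum f A) = (\<Sum>x\<in>A. symb (f x))"
  by (induction A rule: infinite_finite_induct) simp_all

lemma symb_der_op_mult: "symb (der_op * P) = der_lmult (symb P)"
proof -
  have "skew_mult [:0, 1:] q = der_lmult q" for q :: "'a poly"
    by (simp add: skew_mult_def)
  then show ?thesis by (simp add: symb_mult der_op_def)
qed

lemma symb_const_op_mult: "symb (const_op f * P) = smult f (symb P)"
  by (simp add: symb_mult skew_mult_def)

lemma const_op_add: "const_op (f + g) = const_op f + const_op g"
  and const_op_mult: "const_op (f * g) = const_op f * const_op g"
  and const_op_0 [simp]: "const_op 0 = 0" and const_op_1 [simp]: "const_op 1 = 1"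
  by (simp_all add: diffop_eq_iff symb_const_op_mult one_pCons)

lemma symb_der_op_power: "symb (der_op ^ i) = monom 1 i"
proof (induction i)
  case (Suc i)
  have "map_poly der (monom (1::'a) i) = 0"
    by (rule poly_eqI) (simp add: coeff_map_poly)
  with Suc show ?case
    by (simp add: symb_der_op_mult der_lmult_def monom_Suc)
qed simp

lemma symb_monomial: "symb (const_op a * der_op ^ i) = monom a i"
  by (simp add: symb_const_op_mult symb_der_op_power smult_monom)

lemma diffop_expand: "P = (\<Sum>i\<le>op_order P. const_op (coeff (symb P) i) * der_op ^ i)"
  by (simp add: diffop_eq_iff symb_monomial op_order_def poly_as_sum_of_monoms)

text \<open>
  An operator is a sum of monomials \<open>a \<partial>\<^sup>i\<close>, so properties that are preserved by addition need only be
  checked on monomials.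
\<close>

lemma diffop_induct [case_names zero monomial add]:
  assumes "Q 0" and "\<And>a i. Q (const_op a * der_op ^ i)" and "\<And>P P'. Q P \<Longrightarrow> Q P' \<Longrightarrow> Q (P + P')"
  shows "Q P"
proof -
  have "Q (\<Sum>i\<in>I. const_op (coeff (symb P) i) * der_op ^ i)" for I
    by (induction I rule: infinite_finite_induct) (use assms in auto)
  then show ?thesis using diffop_expand[of P] by metis
qed

subsection \<open>Orders and division with remainder\<close>

lemma degree_map_poly_der: "degree (map_poly der p) \<le> degree p"
  by (rule degree_le) (simp add: coeff_map_poly coeff_eq_0)

text \<open>
  Multiplying by \<open>\<partial>\<close> on the left shifts the coefficients by one and adds their derivatives in the old
  positions; the latter do not reach the top degree.
\<close>

lemma coeff_der_lmult_pow_top: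
  "degree q \<le> n \<Longrightarrow> degree ((der_lmult ^^ i) q) \<le> n + i \<and> coeff ((der_lmult ^^ i) q) (n + i) = coeff q n"
proof (induction i)
  case (Suc i)
  let ?r = "(der_lmult ^^ i) q"
  have IH: "degree ?r \<le> n + i" "coeff ?r (n + i) = coeff q n" using Suc by auto
  have "degree (pCons 0 ?r) \<le> n + Suc i" using IH(1) by (intro le_trans[OF degree_pCons_le]) simp
  moreover have "degree (map_poly der ?r) \<le> n + Suc i"
    using degree_map_poly_der[of ?r] IH(1) by linarith
  moreover have "coeff ?r (Suc (n + i)) = 0" using IH(1) by (simp add: coeff_eq_0)
  moreover have "(der_lmult ^^ Suc i) q = pCons 0 ?r + map_poly der ?r" by (simp add: der_lmult_def)
  ultimately show ?case using IH by (auto intro!: degree_add_le simp: coeff_map_poly simp del: funpow.simps)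
qed simp

lemma
  fixes p q :: "'a::diff_field poly"
  shows degree_skew_mult_le: "degree (skew_mult p q) \<le> degree p + degree q"
    and coeff_skew_mult_top: "coeff (skew_mult p q) (degree p + degree q) = lead_coeff p * lead_coeff q"
proof -
  have d: "degree ((der_lmult ^^ i) q) \<le> degree q + i" "coeff ((der_lmult ^^ i) q) (degree q + i) = lead_coeff q" for i
    using coeff_der_lmult_pow_top[of q "degree q" i] by auto
  show "degree (skew_mult p q) \<le> degree p + degree q"
    unfolding skew_mult_def
    by (rule degree_sum_le) (use d(1) le_trans[OF degree_smult_le] in \<open>auto intro!: le_trans[OF degree_smult_le] le_trans[OF d(1)]\<close>)
  have "coeff (skew_mult p q) (degree p + degree q) = (\<Sum>i\<le>degree p. coeff p i * coeff ((der_lmult ^^ i) q) (degree p + degree q))"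
    by (simp add: skew_mult_def coeff_sum)
  also have "\<dots> = (\<Sum>i\<in>{degree p}. coeff p i * coeff ((der_lmult ^^ i) q) (degree p + degree q))"
  proof (rule sum.mono_neutral_right; clarsimp)
    fix i assume "i \<le> degree p" "i \<noteq> degree p" "coeff ((der_lmult ^^ i) q) (degree p + degree q) \<noteq> 0"
    moreover from this have "degree p + degree q \<le> degree ((der_lmult ^^ i) q)" by (meson le_degree)
    ultimately show "coeff p i = 0" using d(1)[of i] by linarith
  qed
  finally show "coeff (skew_mult p q) (degree p + degree q) = lead_coeff p * lead_coeff q"
    using d(2)[of "degree p"] by (simp add: add.commute)
qed

instance diffop :: (diff_field) ring_1_no_zero_divisors
proof
  fix P Q :: "'a diffop"
  assume "P \<noteq> 0" "Q \<noteq> 0"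
  then have "coeff (symb (P * Q)) (degree (symb P) + degree (symb Q)) \<noteq> 0"
    by (simp add: symb_mult coeff_skew_mult_top)
  then show "P * Q \<noteq> 0" by (metis coeff_0 symb_0)
qed

text \<open>
  As in the commutative case, a monomial multiple of \<open>Q\<close> cancels the leading term of \<open>P\<close>, because
  leading coefficients multiply.
\<close>

lemma op_division:
  fixes P Q :: "'a::diff_field diffop"
  assumes "Q \<noteq> 0"
  shows "\<exists>S r. P = S * Q + r \<and> (r = 0 \<or> op_order r < op_order Q)"
proof -
  have "P = 0 \<or> op_order P < n \<Longrightarrow> \<exists>S r. P = S * Q + r \<and> (r = 0 \<or> op_order r < op_order Q)" for n
  proof (induction n arbitrary: P)
    case 0
    then show ?case by (metis add_0 mult_zero_left not_less0)
  next
    case (Suc n)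
    show ?case
    proof (cases "P = 0 \<or> op_order P < op_order Q")
      case True
      then show ?thesis by (metis add_0 mult_zero_left)
    next
      case False
      define M where "M = const_op (op_lead P / op_lead Q) * der_op ^ (op_order P - op_order Q)"
      have lead: "op_lead P \<noteq> 0" "op_lead Q \<noteq> 0" using False assms by (auto simp: op_lead_def)
      have sM: "symb M = monom (op_lead P / op_lead Q) (op_order P - op_order Q)"
        by (simp add: M_def symb_monomial)
      have degM: "degree (symb M) + degree (symb Q) = op_order P"
        using False lead by (simp add: sM degree_monom_eq op_order_def)
      have "degree (symb (M * Q)) \<le> op_order P"
        using degree_skew_mult_le[of "symb M" "symb Q"] degM by (simp add: symb_mult)
      moreover have "coeff (symb (M * Q)) (op_order P) = op_lead P"
        using coeff_skew_mult_top[of "symb M" "symb Q"] lead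
        unfolding symb_mult degM[symmetric] by (simp add: sM degree_monom_eq op_lead_def)
      ultimately have "degree (symb (P - M * Q)) \<le> op_order P" "coeff (symb (P - M * Q)) (op_order P) = 0"
        by (auto simp: degree_diff_le op_order_def op_lead_def)
      then have "P - M * Q = 0 \<or> op_order (P - M * Q) < op_order P"
        by (metis le_neq_implies_less leading_coeff_0_iff op_order_def symb_eq_0_iff)
      then have "P - M * Q = 0 \<or> op_order (P - M * Q) < n" using Suc.prems False by auto
      from Suc.IH[OF this] obtain S r where r: "P - M * Q = S * Q + r" "r = 0 \<or> op_order r < op_order Q"
        by blast
      then have "P = (M + S) * Q + r" by (simp add: algebra_simps)
      with r(2) show ?thesis by blast
    qed
  qed
  then show ?thesis by blast
qed

definition left_submodule :: "('j \<Rightarrow> 'a::ring_1) set \<Rightarrow> bool" where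
  "left_submodule N \<longleftrightarrow> (\<lambda>j. 0) \<in> N \<and> (\<forall>r\<in>N. \<forall>s\<in>N. (\<lambda>j. r j + s j) \<in> N) \<and> (\<forall>a. \<forall>r\<in>N. (\<lambda>j. a * r j) \<in> N)"

definition left_ideal :: "'a::ring_1 set \<Rightarrow> bool" where
  "left_ideal I \<longleftrightarrow> 0 \<in> I \<and> (\<forall>a\<in>I. \<forall>b\<in>I. a + b \<in> I) \<and> (\<forall>a. \<forall>b\<in>I. a * b \<in> I)"

text \<open>
  By division with remainder, an element of least order generates.
\<close>

lemma left_ideal_principal:
  fixes I :: "'a::diff_field diffop set"
  assumes I: "left_ideal I"
  obtains P where "P \<in> I" "\<And>Q. Q \<in> I \<Longrightarrow> \<exists>S. Q = S * P"
proof (cases "I \<subseteq> {0}")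
  case True
  then show ?thesis using I that[of 0] by (auto simp: left_ideal_def)
next
  case False
  then obtain P where P: "P \<in> I" "P \<noteq> 0" and min: "\<And>Q. Q \<in> I \<Longrightarrow> Q \<noteq> 0 \<Longrightarrow> op_order P \<le> op_order Q"
    using ex_has_least_nat[of "\<lambda>P. P \<in> I \<and> P \<noteq> 0" _ op_order] by blast
  have "\<exists>S. Q = S * P" if "Q \<in> I" for Q
  proof -
    obtain S r where r: "Q = S * P + r" "r = 0 \<or> op_order r < op_order P"
      using op_division[OF P(2)] by blast
    have "- S * P \<in> I" using I P(1) unfolding left_ideal_def by blast
    then have "Q + - S * P \<in> I" using I that unfolding left_ideal_def by blast
    moreover have "Q + - S * P = r" using r(1) by simp
    ultimately have "r \<in> I" by simp
    then have "r = 0" using r(2) min by force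
    then show ?thesis using r(1) by auto
  qed
  then show ?thesis using that P by blast
qed

text \<open>
  The Euclidean algorithm: if \<open>P = S Q + r\<close>, then a relation between \<open>Q\<close> and \<open>r\<close> gives one between
  \<open>P\<close> and \<open>Q\<close>.
\<close>

lemma ore_condition:
  fixes P Q :: "'a::diff_field diffop"
  assumes "Q \<noteq> 0"
  shows "\<exists>s t. s \<noteq> 0 \<and> s * P + t * Q = 0"
  using assms
proof (induction "op_order Q" arbitrary: P Q rule: less_induct)
  case less
  obtain S r where r: "P = S * Q + r" "r = 0 \<or> op_order r < op_order Q"
    using op_division[OF less.prems] by blast
  show ?case
  proof (cases "r = 0")
    case True
    then have "1 * P + (- S) * Q = 0" using r by simp
    then show ?thesis by (metis one_neq_zero)
  next
    case False
    then obtain s t where st: "s \<noteq> 0" "s * Q + t * r = 0" using less r by metis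
    then have "t \<noteq> 0" using less.prems by auto
    moreover have "t * P + (s - t * S) * Q = 0" using st r by (simp add: algebra_simps)
    ultimately show ?thesis by blast
  qed
qed

subsection \<open>Linear dependence and one-sided inverses of matrices\<close>

text \<open>
  Gaussian elimination: the Ore condition clears a column with the help of a pivot, so that one vector
  and one coordinate can be dropped together.
\<close>

lemma left_dependent_of_card_less:
  fixes v :: "'i \<Rightarrow> 'j \<Rightarrow> 'a::diff_field diffop"
  assumes "finite J" "finite I" "card J < card I"
  shows "\<exists>r. (\<exists>i\<in>I. r i \<noteq> 0) \<and> (\<forall>j\<in>J. (\<Sum>i\<in>I. r i * v i j) = 0)"
  using assms
proof (induction J arbitrary: I v rule: finite_induct)
  case empty
  then obtain i where "i \<in> I" by fastforce
  then show ?case by (intro exI[of _ "\<lambda>_. 1"]) auto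
next
  case (insert k J)
  show ?case
  proof (cases "\<forall>i\<in>I. v i k = 0")
    case True
    obtain r where "\<exists>i\<in>I. r i \<noteq> 0" "\<forall>j\<in>J. (\<Sum>i\<in>I. r i * v i j) = 0"
      using insert.IH[of I v] insert.prems insert.hyps by auto
    then show ?thesis using True by (intro exI[of _ r]) auto
  next
    case False
    then obtain l where l: "l \<in> I" "v l k \<noteq> 0" by blast
    have "\<forall>i. \<exists>s t. s \<noteq> 0 \<and> s * v i k + t * v l k = 0" using ore_condition[OF l(2)] by blast
    then obtain s t where st: "\<And>i. s i \<noteq> 0" "\<And>i. s i * v i k + t i * v l k = 0" by metis
    have "card J < card (I - {l})" "finite (I - {l})" using insert l by auto
    from insert.IH[OF this(2,1), of "\<lambda>i j. s i * v i j + t i * v l j"]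
    obtain r where r: "\<exists>i\<in>I - {l}. r i \<noteq> 0"
      "\<forall>j\<in>J. (\<Sum>i\<in>I - {l}. r i * (s i * v i j + t i * v l j)) = 0" by blast
    define r' where "r' i = (if i = l then (\<Sum>i\<in>I - {l}. r i * t i) else r i * s i)" for i
    have eq: "(\<Sum>i\<in>I. r' i * v i j) = (\<Sum>i\<in>I - {l}. r i * (s i * v i j + t i * v l j))" for j
    proof -
      have "(\<Sum>i\<in>I. r' i * v i j) = r' l * v l j + (\<Sum>i\<in>I - {l}. r' i * v i j)"
        using insert.prems l by (simp add: sum.remove)
      also have "(\<Sum>i\<in>I - {l}. r' i * v i j) = (\<Sum>i\<in>I - {l}. r i * s i * v i j)"
        by (rule sum.cong) (auto simp: r'_def)
      also have "r' l * v l j = (\<Sum>i\<in>I - {l}. r i * t i * v l j)"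
        by (simp add: r'_def sum_distrib_right)
      finally show ?thesis
        by (simp add: distrib_left sum.distrib mult.assoc add.commute)
    qed
    have "(\<Sum>i\<in>I. r' i * v i k) = 0" by (simp add: eq st)
    moreover have "\<exists>i\<in>I. r' i \<noteq> 0" using r(1) st(1) by (auto simp: r'_def)
    ultimately show ?thesis using r(2) eq by (intro exI[of _ r']) auto
  qed
qed

lemma matrix_diff_rdistrib: "(A - B) ** C = A ** C - B ** C"
  for A B :: "'a::ring_1^'n::finite^'m" and C :: "'a^'p^'n"
  by (simp add: matrix_matrix_mult_def cart_eq_iff left_diff_distrib sum_subtractf)

text \<open>
  If \<open>1 - V U\<close> has a non-zero row \<open>w\<close>, then \<open>w\<close> and the rows of \<open>U\<close> are too many vectors to be
  independent.  Multiplication by \<open>V\<close> sends \<open>w\<close> to \<open>0\<close> and the rows of \<open>U\<close> to unit vectors, so in a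
  relation between them only \<open>w\<close> can occur, which is impossible in a domain.
\<close>

lemma matrix_left_inverse_imp_right_inverse:
  fixes U V :: "'a::diff_field diffop^'m::finite^'m"
  assumes UV: "U ** V = mat 1"
  shows "V ** U = mat 1"
proof (rule ccontr)
  assume "V ** U \<noteq> mat 1"
  then obtain k j0 where w0: "(V ** U) $ k $ j0 \<noteq> mat 1 $ k $ j0"
    by (auto simp: cart_eq_iff)
  define w where "w = (\<lambda>j. (mat 1 - V ** U) $ k $ j)"
  define v :: "'m option \<Rightarrow> 'm \<Rightarrow> 'a diffop" where
    "v i = (case i of None \<Rightarrow> w | Some i \<Rightarrow> (\<lambda>j. U $ i $ j))" for i
  have "card (UNIV :: 'm set) < card (UNIV :: 'm option set)" by (simp add: card_UNIV_option)
  from left_dependent_of_card_less[OF _ _ this, of v]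
  obtain r where r: "\<exists>i. r i \<noteq> 0" "\<And>j. (\<Sum>i\<in>UNIV. r i * v i j) = 0" by auto
  have split: "(\<Sum>i\<in>(UNIV::'m option set). f i) = f None + (\<Sum>i\<in>UNIV. f (Some i))" for f :: "_ \<Rightarrow> 'a diffop"
    by (simp add: UNIV_option_conv sum.reindex)
  have rel: "r None * w j + (\<Sum>i\<in>UNIV. r (Some i) * U $ i $ j) = 0" for j
    using r(2)[of j] by (simp add: split v_def)
  have "(mat 1 - V ** U) ** V = 0" by (simp add: matrix_diff_rdistrib matrix_mul_assoc[symmetric] UV)
  then have wV: "(\<Sum>j\<in>UNIV. w j * V $ j $ l) = 0" for l
    by (simp add: w_def cart_eq_iff matrix_matrix_mult_def)
  have UVe: "(\<Sum>j\<in>UNIV. U $ i $ j * V $ j $ l) = (if i = l then 1 else 0)" for i l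
    using UV by (simp add: cart_eq_iff matrix_matrix_mult_def cart_mat_def)
  have "r (Some l) = 0" for l
  proof -
    have "0 = (\<Sum>j\<in>UNIV. (r None * w j + (\<Sum>i\<in>UNIV. r (Some i) * U $ i $ j)) * V $ j $ l)"
      by (simp add: rel)
    also have "\<dots> = r None * (\<Sum>j\<in>UNIV. w j * V $ j $ l)
        + (\<Sum>j\<in>UNIV. \<Sum>i\<in>UNIV. r (Some i) * (U $ i $ j * V $ j $ l))"
      by (simp add: algebra_simps sum.distrib sum_distrib_left sum_distrib_right mult.assoc)
    also have "\<dots> = (\<Sum>i\<in>UNIV. \<Sum>j\<in>UNIV. r (Some i) * (U $ i $ j * V $ j $ l))"
      by (subst sum.swap) (simp add: wV)
    also have "\<dots> = r (Some l)"
      by (simp add: sum_distrib_left[symmetric] UVe if_distrib[of "(*) _"] cong: if_cong)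
    finally show ?thesis by simp
  qed
  then have "r None \<noteq> 0" using r(1) by (metis option.exhaust)
  moreover have "r None * w j0 = 0" using rel[of j0] \<open>\<And>l. r (Some l) = 0\<close> by simp
  ultimately show False using w0 by (simp add: w_def)
qed

section \<open>Adjoints and the action of operators\<close>

lemma adj_ge: "op_order P \<le> n \<Longrightarrow> adj P = (\<Sum>i\<le>n. (- der_op) ^ i * const_op (coeff (symb P) i))"
  unfolding adj_def
  by (rule sum.mono_neutral_left) (auto simp: op_order_def coeff_eq_0)

lemma adj_add: "adj (P + Q) = adj P + adj Q"
proof -
  let ?n = "max (op_order P) (op_order Q)"
  have "op_order (P + Q) \<le> ?n" by (simp add: op_order_def degree_add_le_max)
  then show ?thesis
    by (simp add: adj_ge[of _ ?n] const_op_add distrib_left sum.distrib)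
qed

lemma adj_0 [simp]: "adj 0 = 0"
  by (simp add: adj_def op_order_def)

lemma adj_sum: "adj (sum f A) = (\<Sum>x\<in>A. adj (f x))"
  by (induction A rule: infinite_finite_induct) (simp_all add: adj_add)

lemma adj_monomial: "adj (const_op a * der_op ^ i) = (- der_op) ^ i * const_op a"
proof -
  have "op_order (const_op a * der_op ^ i) \<le> i"
    by (simp add: op_order_def symb_monomial degree_monom_le)
  then have "adj (const_op a * der_op ^ i)
      = (\<Sum>j\<le>i. (- der_op) ^ j * const_op (coeff (monom a i) j))"
    by (simp add: adj_ge symb_monomial)
  also have "\<dots> = (\<Sum>j\<in>{i}. (- der_op) ^ j * const_op (coeff (monom a i) j))"
    by (rule sum.mono_neutral_right) auto
  finally show ?thesis by simp
qed

lemma adj_1 [simp]: "adj 1 = 1"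
  using adj_monomial[of 1 0] by simp

lemma adj_const_op_mult: "adj (const_op f * P) = adj P * const_op f"
proof (induction P rule: diffop_induct)
  case (monomial a i)
  have eq: "const_op f * (const_op a * der_op ^ i) = const_op (a * f) * der_op ^ i"
    unfolding mult.commute[of a f] by (simp add: const_op_mult mult.assoc)
  show ?case unfolding eq adj_monomial by (simp only: const_op_mult mult.assoc)
qed (simp_all add: adj_add distrib_left distrib_right)

lemma adj_der_op_mult: "adj (der_op * P) = adj P * - der_op"
proof (induction P rule: diffop_induct)
  case (monomial a i)
  have eq: "der_op * (const_op a * der_op ^ i) = const_op a * der_op ^ Suc i + const_op (der a) * der_op ^ i"
    by (simp only: mult.assoc[symmetric] der_op_const_op distrib_right power_Suc)
  have "adj (der_op * (const_op a * der_op ^ i))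
      = (- der_op) ^ i * (- der_op * const_op a + const_op (der a))"
    unfolding eq adj_add adj_monomial by (simp only: power_Suc2 distrib_left mult.assoc)
  also have "- der_op * const_op a + const_op (der a) = const_op a * - der_op"
    by (simp add: der_op_const_op)
  finally show ?case by (simp only: adj_monomial mult.assoc)
qed (simp_all add: adj_add distrib_left distrib_right)

text \<open>
  Both sides are additive in \<open>P\<close>, so it is enough to take for \<open>P\<close> a function or \<open>\<partial>\<close>, and then the
  claim is the commutation rule of \<open>\<partial>\<close> with functions.
\<close>

lemma adj_mult: "adj (P * Q) = adj Q * adj P"
proof (induction P rule: diffop_induct)
  case (monomial a i)
  have eq: "adj (der_op ^ i * Q) = adj Q * (- der_op) ^ i"
  proof (induction i)
    case (Suc i)
    have "adj (der_op ^ Suc i * Q) = adj (der_op ^ i * Q) * - der_op"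
      by (simp only: power_Suc mult.assoc adj_der_op_mult)
    also have "\<dots> = adj Q * (- der_op) ^ Suc i"
      by (simp only: Suc power_Suc2 mult.assoc)
    finally show ?case .
  qed simp
  show ?case unfolding adj_monomial unfolding mult.assoc adj_const_op_mult eq ..
qed (simp_all add: adj_add distrib_left distrib_right)

lemma mat_adj_mult: "mat_adj (A ** B) = mat_adj B ** mat_adj A"
  by (simp add: mat_adj_def matrix_matrix_mult_def cart_eq_iff adj_sum adj_mult)

lemma mat_adj_add: "mat_adj (A + B) = mat_adj A + mat_adj B"
  by (simp add: mat_adj_def cart_eq_iff adj_add)

lemma mat_adj_mat_1: "mat_adj (mat 1) = mat 1"
  by (simp add: mat_adj_def cart_mat_def cart_eq_iff)

subsection \<open>The action on differential extension fields\<close>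

lemma op_apply_ge:
  assumes "\<iota> 0 = 0" "op_order P \<le> n"
  shows "op_apply \<iota> P y = (\<Sum>i\<le>n. \<iota> (coeff (symb P) i) * (der ^^ i) y)"
  unfolding op_apply_def
  by (rule sum.mono_neutral_left) (use assms in \<open>auto simp: op_order_def coeff_eq_0\<close>)

lemma der_pow_add: "(der ^^ i) (x + y) = (der ^^ i) x + (der ^^ i) (y :: 'a::diff_field)"
  by (induction i) (simp_all add: der_add)

lemma der_pow_0 [simp]: "(der ^^ i) (0 :: 'a::diff_field) = 0"
  by (induction i) simp_all

lemma der_sum: "der (sum f A) = (\<Sum>x\<in>A. der (f x :: 'a::diff_field))"
  by (induction A rule: infinite_finite_induct) (simp_all add: der_add)

lemma der_minus: "der (- x) = - der (x :: 'a::diff_field)"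
  using der_add[of x "- x"] by (simp add: eq_neg_iff_add_eq_0 add.commute)

lemma der_diff: "der (x - y) = der x - der (y :: 'a::diff_field)"
  using der_add[of x "- y"] by (simp add: der_minus)

locale diff_extension =
  fixes \<iota> :: "'k::diff_field \<Rightarrow> 'l::diff_field"
  assumes embedding: "diff_embedding \<iota>"
begin

lemma \<iota>_1 [simp]: "\<iota> 1 = 1" and \<iota>_add: "\<iota> (x + y) = \<iota> x + \<iota> y" and \<iota>_mult: "\<iota> (x * y) = \<iota> x * \<iota> y"
  and \<iota>_der: "\<iota> (der x) = der (\<iota> x)"
  using embedding by (auto simp: diff_embedding_def)

lemma \<iota>_0 [simp]: "\<iota> 0 = 0"
  using \<iota>_add[of 0 0] by simp

lemma \<iota>_minus: "\<iota> (- x) = - \<iota> x"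
  using \<iota>_add[of x "- x"] by (simp add: eq_neg_iff_add_eq_0 add.commute)

lemma \<iota>_eq_0_iff: "\<iota> x = 0 \<longleftrightarrow> x = 0"
proof
  assume "\<iota> x = 0"
  then have "x \<noteq> 0 \<Longrightarrow> \<iota> 1 = 0" by (metis \<iota>_mult mult_zero_left right_inverse)
  then show "x = 0" by auto
qed simp

lemma op_apply_add: "op_apply \<iota> (P + Q) y = op_apply \<iota> P y + op_apply \<iota> Q y"
proof -
  let ?n = "max (op_order P) (op_order Q)"
  have "op_order (P + Q) \<le> ?n" by (simp add: op_order_def degree_add_le_max)
  then show ?thesis
    by (simp add: op_apply_ge[of _ _ ?n] \<iota>_add distrib_right sum.distrib)
qed

lemma op_apply_0 [simp]: "op_apply \<iota> 0 y = 0"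
  by (simp add: op_apply_def op_order_def)

lemma op_apply_1 [simp]: "op_apply \<iota> 1 y = y"
  by (simp add: op_apply_def op_order_def)

lemma op_apply_sum: "op_apply \<iota> (sum f A) y = (\<Sum>x\<in>A. op_apply \<iota> (f x) y)"
  by (induction A rule: infinite_finite_induct) (simp_all add: op_apply_add)

lemma op_apply_arg_add: "op_apply \<iota> P (y + z) = op_apply \<iota> P y + op_apply \<iota> P z"
  by (simp add: op_apply_def der_pow_add distrib_left sum.distrib)

lemma op_apply_arg_0 [simp]: "op_apply \<iota> P 0 = 0"
  by (simp add: op_apply_def)

lemma op_apply_arg_sum: "op_apply \<iota> P (sum f A) = (\<Sum>x\<in>A. op_apply \<iota> P (f x))"
  by (induction A rule: infinite_finite_induct) (simp_all add: op_apply_arg_add)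

lemma op_apply_const_op_mult: "op_apply \<iota> (const_op a * P) y = \<iota> a * op_apply \<iota> P y"
proof -
  have "op_order (const_op a * P) \<le> op_order P"
    by (simp add: op_order_def symb_const_op_mult degree_smult_le)
  then show ?thesis
    by (simp add: op_apply_ge[of _ _ "op_order P"] symb_const_op_mult \<iota>_mult sum_distrib_left mult.assoc)
qed

lemma op_apply_der_op_power: "op_apply \<iota> (der_op ^ i) y = (der ^^ i) y"
proof -
  have "op_apply \<iota> (der_op ^ i) y = (\<Sum>j\<le>i. \<iota> (coeff (monom 1 i) j) * (der ^^ j) y)"
    by (simp add: op_apply_def op_order_def symb_der_op_power degree_monom_eq)
  also have "\<dots> = (\<Sum>j\<in>{i}. \<iota> (coeff (monom 1 i) j) * (der ^^ j) y)"
    by (rule sum.mono_neutral_right) auto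
  finally show ?thesis by simp
qed

lemma op_apply_der_op_mult: "op_apply \<iota> (der_op * P) y = der (op_apply \<iota> P y)"
proof (induction P rule: diffop_induct)
  case (monomial a i)
  have "der_op * (const_op a * der_op ^ i) = const_op a * der_op ^ Suc i + const_op (der a) * der_op ^ i"
    by (simp add: mult.assoc[symmetric] der_op_const_op distrib_right)
  then show ?case
    by (simp add: op_apply_add op_apply_const_op_mult op_apply_der_op_power der_mult \<iota>_der del: power_Suc)
qed (simp_all add: op_apply_add distrib_left der_add)

lemma op_apply_mult: "op_apply \<iota> (P * Q) y = op_apply \<iota> P (op_apply \<iota> Q y)"
proof (induction P rule: diffop_induct)
  case (monomial a i)
  have "op_apply \<iota> (der_op ^ i * Q) y = (der ^^ i) (op_apply \<iota> Q y)"
    by (induction i) (simp_all add: op_apply_der_op_mult mult.assoc)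
  then show ?case
    by (simp add: op_apply_const_op_mult op_apply_der_op_power mult.assoc)
qed (simp_all add: op_apply_add distrib_right)

lemma mat_apply_mult: "mat_apply \<iota> (A ** B) v = mat_apply \<iota> A (mat_apply \<iota> B v)"
  by (simp add: mat_apply_def matrix_matrix_mult_def cart_eq_iff op_apply_sum op_apply_arg_sum op_apply_mult)
    (intro allI, rule sum.swap)

lemma mat_apply_add: "mat_apply \<iota> (A + B) v = mat_apply \<iota> A v + mat_apply \<iota> B v"
  by (simp add: mat_apply_def cart_eq_iff op_apply_add sum.distrib)

lemma mat_apply_arg_add: "mat_apply \<iota> A (v + w) = mat_apply \<iota> A v + mat_apply \<iota> A w"
  by (simp add: mat_apply_def cart_eq_iff op_apply_arg_add sum.distrib)

lemma mat_apply_0 [simp]: "mat_apply \<iota> A 0 = 0"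
  by (simp add: mat_apply_def cart_eq_iff)

lemma mat_apply_mat_1: "mat_apply \<iota> (mat 1) v = v"
  by (simp add: mat_apply_def cart_mat_def cart_eq_iff if_distrib[of "\<lambda>P. op_apply \<iota> P _"] cong: if_cong)

end

lemma diff_extension_id: "diff_extension id"
  by unfold_locales (simp add: diff_embedding_def)

section \<open>Trivial common kernels and Bezout identities\<close>

text \<open>
  Linear closedness, but only for operators over the base field \<open>'k\<close>: the vectors in the kernels are
  constructed from solutions of such operators.
\<close>

definition solvable_in :: "('k::diff_field \<Rightarrow> 'l::diff_field) \<Rightarrow> bool" where
  "solvable_in \<iota> \<longleftrightarrow> (\<forall>P. op_order P \<ge> 1 \<longrightarrow> (\<exists>y. y \<noteq> 0 \<and> op_apply \<iota> P y = 0))"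

text \<open>
  Solutions \<open>v\<close> of the system \<open>N\<close> are the homomorphisms \<open>R\<^sup>n / N \<rightarrow> 'l\<close>.  If the quotient is not \<open>0\<close>, dividing
  by as many of the standard generators as possible without reaching \<open>0\<close> leaves a module that is
  generated by any one of the remaining generators \<open>e\<^sub>i\<close>.  It is \<open>R / R P\<close> with \<open>P\<close> not a unit, and
  sending the class of \<open>1\<close> to a solution \<open>y\<close> of \<open>P\<close> is a non-zero homomorphism.
\<close>

lemma (in diff_extension) submodule_eq_UNIV:
  fixes N :: "('j::finite \<Rightarrow> 'k diffop) set"
  assumes sol: "solvable_in \<iota>" and N: "left_submodule N"
    and triv: "\<And>v. (\<And>r. r \<in> N \<Longrightarrow> (\<Sum>j\<in>UNIV. op_apply \<iota> (r j) (v j)) = 0) \<Longrightarrow> v = (\<lambda>j. 0)"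
  shows "N = UNIV"
proof (rule ccontr)
  assume "N \<noteq> UNIV"
  have N0: "(\<lambda>j. 0) \<in> N" and Nadd: "\<And>r s. r \<in> N \<Longrightarrow> s \<in> N \<Longrightarrow> (\<lambda>j. r j + s j) \<in> N"
    and Nmult: "\<And>a r. r \<in> N \<Longrightarrow> (\<lambda>j. a * r j) \<in> N"
    using N by (auto simp: left_submodule_def)
  have Nsum: "(\<lambda>j. \<Sum>x\<in>S. f x j) \<in> N" if "\<And>x. x \<in> S \<Longrightarrow> f x \<in> N" for f and S :: "'j set"
    using finite[of S] that by (induction S) (auto intro: N0 Nadd)
  \<comment> \<open>\<open>M J\<close> is the sum of \<open>N\<close> and the span of the standard generators with index in \<open>J\<close>.\<close>
  define M where "M J = {r. \<exists>n\<in>N. \<forall>j. j \<notin> J \<longrightarrow> r j = n j}" for J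
  have "M {} \<subseteq> N"
  proof
    fix r assume "r \<in> M {}"
    then obtain n where "n \<in> N" "\<And>j. r j = n j" by (auto simp: M_def)
    then show "r \<in> N" by (metis ext)
  qed
  then have "M {} \<noteq> UNIV" using \<open>N \<noteq> UNIV\<close> by blast
  moreover have "\<forall>J. M J \<noteq> UNIV \<longrightarrow> card J < Suc CARD('j)" by (simp add: card_mono less_Suc_eq_le)
  ultimately obtain J where J: "M J \<noteq> UNIV" and maxJ: "\<And>J'. M J' \<noteq> UNIV \<Longrightarrow> card J' \<le> card J"
    using ex_has_greatest_nat[of "\<lambda>J. M J \<noteq> UNIV" "{}" card "Suc CARD('j)"] by blast
  have "M UNIV = UNIV" using N0 by (auto simp: M_def)
  then have "J \<noteq> UNIV" using J by auto
  then obtain i where i: "i \<notin> J" by blast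
  have "card (insert i J) > card J" using i by simp
  then have Mi: "M (insert i J) = UNIV" using maxJ[of "insert i J"] by linarith
  have "\<forall>j. \<exists>n\<in>N. \<forall>k. k \<notin> insert i J \<longrightarrow> (if k = j then 1 else 0) = n k"
    using Mi by (auto simp: M_def set_eq_iff)
  then obtain n where n: "\<And>j. n j \<in> N" "\<And>j k. k \<notin> insert i J \<Longrightarrow> n j k = (if k = j then 1 else 0)"
    by metis
  \<comment> \<open>The annihilator of \<open>e\<^sub>i\<close> modulo \<open>M J\<close>; for \<open>j\<close> outside \<open>insert i J\<close>, the element \<open>n j\<close> of \<open>N\<close> shows
     that \<open>e\<^sub>j\<close> is congruent to \<open>- n j i\<close> times \<open>e\<^sub>i\<close>.\<close>
  define I where "I = {m i | m. m \<in> N \<and> (\<forall>k. k \<notin> insert i J \<longrightarrow> m k = 0)}"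
  have "left_ideal I"
    unfolding left_ideal_def
  proof (intro conjI ballI allI)
    show "0 \<in> I" using N0 by (force simp: I_def)
  next
    fix a b assume "a \<in> I" "b \<in> I"
    then obtain r s where "r \<in> N" "s \<in> N" "a = r i" "b = s i"
      "\<forall>k. k \<notin> insert i J \<longrightarrow> r k = 0" "\<forall>k. k \<notin> insert i J \<longrightarrow> s k = 0" by (auto simp: I_def)
    then show "a + b \<in> I" using Nadd[of r s] by (auto simp: I_def intro!: exI[of _ "\<lambda>j. r j + s j"])
  next
    fix a b assume "b \<in> I"
    then obtain s where "s \<in> N" "b = s i" "\<forall>k. k \<notin> insert i J \<longrightarrow> s k = 0" by (auto simp: I_def)
    then show "a * b \<in> I" using Nmult[of s a] by (auto simp: I_def intro!: exI[of _ "\<lambda>j. a * s j"])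
  qed
  then obtain P where P: "P \<in> I" "\<And>Q. Q \<in> I \<Longrightarrow> \<exists>S. Q = S * P" using left_ideal_principal by blast
  have "1 \<notin> I"
  proof
    assume "1 \<in> I"
    then obtain m where m: "m \<in> N" "m i = 1" "\<forall>k. k \<notin> insert i J \<longrightarrow> m k = 0" by (auto simp: I_def)
    have "r \<in> M J" for r
    proof -
      obtain s where s: "s \<in> N" "\<forall>k. k \<notin> insert i J \<longrightarrow> r k = s k" using Mi by (auto simp: M_def set_eq_iff)
      have "(\<lambda>k. s k + (r i - s i) * m k) \<in> N" using Nadd[OF s(1) Nmult[OF m(1)]] .
      moreover have "r k = s k + (r i - s i) * m k" if "k \<notin> J" for k
        using that m s by (cases "k = i") auto
      ultimately show ?thesis unfolding M_def by (intro CollectI bexI) auto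
    qed
    then show False using J by auto
  qed
  have "\<exists>y. y \<noteq> 0 \<and> op_apply \<iota> P y = 0"
  proof (cases "op_order P \<ge> 1")
    case True
    then show ?thesis using sol by (auto simp: solvable_in_def)
  next
    case False
    have "P = 0"
    proof (rule ccontr)
      assume "P \<noteq> 0"
      obtain a where a: "symb P = [:a:]"
        using False degree_eq_zeroE[of "symb P"] by (auto simp: op_order_def)
      then have "P = const_op a" by (simp add: diffop_eq_iff)
      moreover from this have "a \<noteq> 0" using \<open>P \<noteq> 0\<close> by auto
      ultimately have "const_op (inverse a) * P = 1" by (simp add: const_op_mult[symmetric])
      moreover have "const_op (inverse a) * P \<in> I" using \<open>left_ideal I\<close> P(1) by (simp add: left_ideal_def)
      ultimately show False using \<open>1 \<notin> I\<close> by simp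
    qed
    then show ?thesis by (intro exI[of _ 1]) simp
  qed
  then obtain y where y: "y \<noteq> 0" "op_apply \<iota> P y = 0" by blast
  define v where "v j = (if j = i then y else if j \<in> J then 0 else op_apply \<iota> (- n j i) y)" for j
  have "(\<Sum>j\<in>UNIV. op_apply \<iota> (r j) (v j)) = 0" if "r \<in> N" for r
  proof -
    let ?C = "- insert i J"
    \<comment> \<open>Modulo \<open>M J\<close>, the row \<open>r\<close> is congruent to \<open>s i\<close> times \<open>e\<^sub>i\<close>.\<close>
    define s where "s k = r k + (\<Sum>j\<in>?C. - r j * n j k)" for k
    have "s \<in> N" unfolding s_def by (intro Nadd Nsum Nmult n that)
    moreover have "s k = 0" if "k \<notin> insert i J" for k
    proof -
      have "(\<Sum>j\<in>?C. - r j * n j k) = (\<Sum>j\<in>?C. if k = j then - r j else 0)"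
        by (rule sum.cong) (use that n(2) in auto)
      also have "\<dots> = - r k" using that by simp
      finally show ?thesis by (simp add: s_def)
    qed
    ultimately have "s i \<in> I" by (auto simp: I_def)
    then obtain S where "s i = S * P" using P(2) by blast
    then have "op_apply \<iota> (s i) y = 0" by (simp add: op_apply_mult y)
    have "(\<Sum>j\<in>UNIV. op_apply \<iota> (r j) (v j)) = (\<Sum>j\<in>insert i ?C. op_apply \<iota> (r j) (v j))"
      by (rule sum.mono_neutral_right) (auto simp: v_def)
    also have "\<dots> = op_apply \<iota> (r i) (v i) + (\<Sum>j\<in>?C. op_apply \<iota> (r j) (v j))"
      by (rule sum.insert) auto
    also have "(\<Sum>j\<in>?C. op_apply \<iota> (r j) (v j)) = (\<Sum>j\<in>?C. op_apply \<iota> (- r j * n j i) y)"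
      by (rule sum.cong) (auto simp: v_def op_apply_mult[symmetric])
    also have "op_apply \<iota> (r i) (v i) + \<dots> = op_apply \<iota> (s i) y"
      by (simp add: v_def s_def op_apply_add op_apply_sum)
    finally show ?thesis using \<open>op_apply \<iota> (s i) y = 0\<close> by simp
  qed
  then have "v = (\<lambda>j. 0)" by (rule triv)
  then have "v i = 0" by simp
  then show False using y by (simp add: v_def)
qed

lemma (in diff_extension) bezout_of_minimal_fraction:
  fixes A B :: "'k diffop^'n::finite^'n"
  assumes sol: "solvable_in \<iota>" and min: "minimal_fraction \<iota> A B"
  obtains C D where "C ** A + D ** B = mat 1"
proof -
  define N where "N = {r. \<exists>c d. r = (\<lambda>j. (\<Sum>i\<in>UNIV. c i * A $ i $ j) + (\<Sum>i\<in>UNIV. d i * B $ i $ j))}"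
  have "left_submodule N"
    unfolding left_submodule_def
  proof (intro conjI ballI allI)
    show "(\<lambda>j. 0) \<in> N" unfolding N_def by (intro CollectI exI[of _ "\<lambda>_. 0"]) simp
  next
    fix r s assume "r \<in> N" "s \<in> N"
    then obtain c d c' d' where
      "r = (\<lambda>j. (\<Sum>i\<in>UNIV. c i * A $ i $ j) + (\<Sum>i\<in>UNIV. d i * B $ i $ j))"
      "s = (\<lambda>j. (\<Sum>i\<in>UNIV. c' i * A $ i $ j) + (\<Sum>i\<in>UNIV. d' i * B $ i $ j))"
      unfolding N_def by blast
    then show "(\<lambda>j. r j + s j) \<in> N" unfolding N_def
      by (intro CollectI exI[of _ "\<lambda>i. c i + c' i"] exI[of _ "\<lambda>i. d i + d' i"])
        (simp add: distrib_right sum.distrib add_ac)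
  next
    fix a r assume "r \<in> N"
    then obtain c d where
      "r = (\<lambda>j. (\<Sum>i\<in>UNIV. c i * A $ i $ j) + (\<Sum>i\<in>UNIV. d i * B $ i $ j))"
      unfolding N_def by blast
    then show "(\<lambda>j. a * r j) \<in> N" unfolding N_def
      by (intro CollectI exI[of _ "\<lambda>i. a * c i"] exI[of _ "\<lambda>i. a * d i"])
        (simp add: distrib_left sum_distrib_left mult.assoc)
  qed
  have rowA: "(\<lambda>j. A $ i $ j) \<in> N" for i
    unfolding N_def
    by (intro CollectI exI[of _ "\<lambda>k. if k = i then 1 else 0"] exI[of _ "\<lambda>_. 0"])
      (simp add: mult_delta_left)
  have rowB: "(\<lambda>j. B $ i $ j) \<in> N" for i
    unfolding N_def
    by (intro CollectI exI[of _ "\<lambda>_. 0"] exI[of _ "\<lambda>k. if k = i then 1 else 0"])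
      (simp add: mult_delta_left)
  have "N = UNIV"
  proof (rule submodule_eq_UNIV[OF sol \<open>left_submodule N\<close>])
    fix v :: "'n \<Rightarrow> 'l"
    assume v: "\<And>r. r \<in> N \<Longrightarrow> (\<Sum>j\<in>UNIV. op_apply \<iota> (r j) (v j)) = 0"
    have "mat_apply \<iota> A (\<chi> j. v j) = 0" "mat_apply \<iota> B (\<chi> j. v j) = 0"
      using v[OF rowA] v[OF rowB] by (simp_all add: mat_apply_def cart_eq_iff)
    then have "(\<chi> j. v j) = 0" using min by (auto simp: minimal_fraction_def)
    then show "v = (\<lambda>j. 0)" by (simp add: cart_eq_iff fun_eq_iff)
  qed
  have "\<forall>k. \<exists>c d. (\<lambda>j. if k = j then 1 else 0) = (\<lambda>j. (\<Sum>i\<in>UNIV. c i * A $ i $ j) + (\<Sum>i\<in>UNIV. d i * B $ i $ j))"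
  proof
    fix k :: 'n
    have "(\<lambda>j. if k = j then 1 else 0) \<in> N" using \<open>N = UNIV\<close> by simp
    then show "\<exists>c d. (\<lambda>j. if k = j then 1 else 0) = (\<lambda>j. (\<Sum>i\<in>UNIV. c i * A $ i $ j) + (\<Sum>i\<in>UNIV. d i * B $ i $ j))"
      unfolding N_def by (rule CollectD)
  qed
  from choice[OF this] obtain c where
    "\<forall>k. \<exists>d. (\<lambda>j. if k = j then 1 else 0) = (\<lambda>j. (\<Sum>i\<in>UNIV. c k i * A $ i $ j) + (\<Sum>i\<in>UNIV. d i * B $ i $ j))" ..
  from choice[OF this] obtain d where
    cd: "\<forall>k. (\<lambda>j. if k = j then 1 else 0) = (\<lambda>j. (\<Sum>i\<in>UNIV. c k i * A $ i $ j) + (\<Sum>i\<in>UNIV. d k i * B $ i $ j))" ..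
  have "(\<chi> k i. c k i) ** A + (\<chi> k i. d k i) ** B = mat 1"
    using cd by (simp add: cart_eq_iff matrix_matrix_mult_def cart_mat_def fun_eq_iff)
  then show ?thesis by (rule that)
qed

section \<open>Coprime pairs are maximal isotropic\<close>

lemma sum_UNIV_Plus: "(\<Sum>x\<in>(UNIV :: ('a::finite + 'b::finite) set). f x) = (\<Sum>x\<in>UNIV. f (Inl x)) + (\<Sum>x\<in>UNIV. f (Inr x))"
  by (subst UNIV_Plus_UNIV[symmetric], subst sum.Plus) auto

definition block :: "'a^'n^'m \<Rightarrow> 'a^'p^'m \<Rightarrow> 'a^'n^'q \<Rightarrow> 'a^'p^'q \<Rightarrow> 'a^('n+'p)^('m+'q)" where
  "block A B C D = (\<chi> i j. case i of
     Inl i \<Rightarrow> (case j of Inl j \<Rightarrow> A $ i $ j | Inr j \<Rightarrow> B $ i $ j)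
   | Inr i \<Rightarrow> (case j of Inl j \<Rightarrow> C $ i $ j | Inr j \<Rightarrow> D $ i $ j))"

lemma block_mult:
  fixes A :: "'a::semiring_1^'n::finite^'m::finite" and B :: "'a^'p::finite^'m" and C :: "'a^'n^'q::finite"
    and A' :: "'a^'s::finite^'n" and B' :: "'a^'t::finite^'n"
  shows "block A B C D ** block A' B' C' D' =
    block (A ** A' + B ** C') (A ** B' + B ** D') (C ** A' + D ** C') (C ** B' + D ** D')"
  by (auto simp: cart_eq_iff block_def matrix_matrix_mult_def sum_UNIV_Plus split: sum.splits)

lemma block_mat_1: "block (mat 1) 0 0 (mat 1) = mat 1"
  by (auto simp: cart_eq_iff block_def cart_mat_def split: sum.splits)

lemma block_eq_iff: "block A B C D = block A' B' C' D' \<longleftrightarrow> A = A' \<and> B = B' \<and> C = C' \<and> D = D'"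
proof
  assume eq: "block A B C D = block A' B' C' D'"
  have *: "block A B C D $ i $ j = block A' B' C' D' $ i $ j" for i j by (simp add: eq)
  show "A = A' \<and> B = B' \<and> C = C' \<and> D = D'"
    using *[of "Inl _" "Inl _"] *[of "Inl _" "Inr _"] *[of "Inr _" "Inl _"] *[of "Inr _" "Inr _"]
    by (simp add: block_def cart_eq_iff)
qed simp

text \<open>
  The product of the block matrices \<open>(D C; A\<^sup>* B\<^sup>*)\<close> and \<open>(B C\<^sup>*; A D\<^sup>*)\<close> has the diagonal blocks \<open>1\<close>
  and the lower left block \<open>0\<close>.  Subtracting \<open>E\<close> times the second block row from the first, where \<open>E\<close>
  is the upper right block, makes the product \<open>1\<close>.  The product in the other order is then \<open>1\<close> as well,
  and its rows express \<open>H\<close> and \<open>G\<close> through \<open>F\<close> and \<open>A\<^sup>* H + B\<^sup>* G\<close>.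
\<close>

lemma isotropic_coprime_solution:
  fixes A B C D :: "'k::diff_field diffop^'n::finite^'n"
  assumes iso: "mat_adj A ** B + mat_adj B ** A = 0"
    and bezout: "C ** A + D ** B = mat 1"
    and GH: "mat_apply id (mat_adj A) H + mat_apply id (mat_adj B) G = 0"
  shows "\<exists>F. G = mat_apply id A F \<and> H = mat_apply id B F"
proof -
  interpret diff_extension "id :: 'k \<Rightarrow> 'k" by (rule diff_extension_id)
  define E where "E = D ** mat_adj C + C ** mat_adj D"
  have "mat_adj (C ** A + D ** B) = mat 1" by (simp add: bezout mat_adj_mat_1)
  then have bezout': "mat_adj A ** mat_adj C + mat_adj B ** mat_adj D = mat 1"
    by (simp add: mat_adj_add mat_adj_mult)
  let ?U = "block (D - E ** mat_adj A) (C - E ** mat_adj B) (mat_adj A) (mat_adj B)"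
  let ?V = "block B (mat_adj C) A (mat_adj D)"
  have "?U ** ?V = block (mat 1) 0 0 (mat 1)"
  proof -
    have "(D - E ** mat_adj A) ** B + (C - E ** mat_adj B) ** A
        = (C ** A + D ** B) - E ** (mat_adj A ** B + mat_adj B ** A)"
      by (simp add: matrix_diff_rdistrib matrix_add_ldistrib matrix_mul_assoc)
    moreover have "(D - E ** mat_adj A) ** mat_adj C + (C - E ** mat_adj B) ** mat_adj D
        = E - E ** (mat_adj A ** mat_adj C + mat_adj B ** mat_adj D)"
      by (simp add: matrix_diff_rdistrib matrix_add_ldistrib matrix_mul_assoc E_def)
    ultimately show ?thesis
      by (simp add: block_mult bezout bezout' iso)
  qed
  then have "?V ** ?U = block (mat 1) 0 0 (mat 1)"
    using matrix_left_inverse_imp_right_inverse unfolding block_mat_1 by blast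
  then have eqs: "B ** (D - E ** mat_adj A) + mat_adj C ** mat_adj A = mat 1"
    "B ** (C - E ** mat_adj B) + mat_adj C ** mat_adj B = 0"
    "A ** (D - E ** mat_adj A) + mat_adj D ** mat_adj A = 0"
    "A ** (C - E ** mat_adj B) + mat_adj D ** mat_adj B = mat 1"
    by (simp_all add: block_mult block_eq_iff)
  define F where "F = mat_apply id (D - E ** mat_adj A) H + mat_apply id (C - E ** mat_adj B) G"
  have H: "H = mat_apply id B F + mat_apply id (mat_adj C) (mat_apply id (mat_adj A) H + mat_apply id (mat_adj B) G)"
  proof -
    have "H = mat_apply id (B ** (D - E ** mat_adj A) + mat_adj C ** mat_adj A) H
        + mat_apply id (B ** (C - E ** mat_adj B) + mat_adj C ** mat_adj B) G"
      unfolding eqs by (simp add: mat_apply_mat_1) (simp add: mat_apply_def cart_eq_iff)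
    then show ?thesis
      by (simp add: F_def mat_apply_add mat_apply_mult mat_apply_arg_add add_ac)
  qed
  have G: "G = mat_apply id A F + mat_apply id (mat_adj D) (mat_apply id (mat_adj A) H + mat_apply id (mat_adj B) G)"
  proof -
    have "G = mat_apply id (A ** (D - E ** mat_adj A) + mat_adj D ** mat_adj A) H
        + mat_apply id (A ** (C - E ** mat_adj B) + mat_adj D ** mat_adj B) G"
      unfolding eqs by (simp add: mat_apply_mat_1) (simp add: mat_apply_def cart_eq_iff)
    then show ?thesis
      by (simp add: F_def mat_apply_add mat_apply_mult mat_apply_arg_add add_ac)
  qed
  have "G = mat_apply id A F" using G unfolding GH by simp
  moreover have "H = mat_apply id B F" using H unfolding GH by simp
  ultimately show ?thesis by blast
qed

section \<open>Subrings and polynomials over them\<close>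

text \<open>
  Base fields, coefficient rings and solution fields all occur as subsets of a field type, together
  with homomorphisms defined only on such subsets.
\<close>

definition sring :: "'f::comm_ring_1 set \<Rightarrow> bool" where
  "sring A \<longleftrightarrow> 1 \<in> A \<and> (\<forall>x\<in>A. \<forall>y\<in>A. x - y \<in> A \<and> x * y \<in> A)"

lemma
  assumes "sring A"
  shows sring_1: "1 \<in> A" and sring_diff: "x \<in> A \<Longrightarrow> y \<in> A \<Longrightarrow> x - y \<in> A"
    and sring_mult: "x \<in> A \<Longrightarrow> y \<in> A \<Longrightarrow> x * y \<in> A"
    and sring_0: "0 \<in> A" and sring_minus: "x \<in> A \<Longrightarrow> - x \<in> A" and sring_add: "x \<in> A \<Longrightarrow> y \<in> A \<Longrightarrow> x + y \<in> A"
proof -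
  show 1: "1 \<in> A" and d: "x \<in> A \<Longrightarrow> y \<in> A \<Longrightarrow> x - y \<in> A" and "x \<in> A \<Longrightarrow> y \<in> A \<Longrightarrow> x * y \<in> A" for x y
    using assms by (auto simp: sring_def)
  show 0: "0 \<in> A" using d[OF 1 1] by simp
  show m: "x \<in> A \<Longrightarrow> - x \<in> A" for x using d[OF 0, of x] by simp
  show "x \<in> A \<Longrightarrow> y \<in> A \<Longrightarrow> x + y \<in> A" using d[of x "- y"] m[of y] by simp
qed

lemma sring_sum: "sring A \<Longrightarrow> (\<And>x. x \<in> S \<Longrightarrow> f x \<in> A) \<Longrightarrow> sum f S \<in> A"
  by (induction S rule: infinite_finite_induct) (auto intro: sring_0 sring_add)

lemma sring_prod: "sring A \<Longrightarrow> (\<And>x. x \<in> S \<Longrightarrow> f x \<in> A) \<Longrightarrow> prod f S \<in> A"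
  by (induction S rule: infinite_finite_induct) (auto intro: sring_1 sring_mult)

lemma sring_power: "sring A \<Longrightarrow> x \<in> A \<Longrightarrow> x ^ n \<in> A"
  by (induction n) (auto intro: sring_1 sring_mult)

lemma sring_of_nat: "sring A \<Longrightarrow> of_nat n \<in> A"
  by (induction n) (auto intro: sring_0 sring_1 sring_add)

definition polys :: "'f::comm_ring_1 set \<Rightarrow> 'f poly set" where
  "polys A = {p. \<forall>i. coeff p i \<in> A}"

lemma coeff_in: "p \<in> polys A \<Longrightarrow> coeff p i \<in> A"
  by (simp add: polys_def)

lemma polys_pCons: "a \<in> A \<Longrightarrow> p \<in> polys A \<Longrightarrow> pCons a p \<in> polys A"
  by (auto simp: polys_def coeff_pCons split: nat.splits)

context
  fixes A :: "'f::comm_ring_1 set"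
  assumes A: "sring A"
begin

lemma polys_0 [simp]: "0 \<in> polys A"
  by (simp add: polys_def sring_0[OF A])

lemma polys_const: "a \<in> A \<Longrightarrow> [:a:] \<in> polys A"
  by (simp add: polys_pCons)

lemma polys_diff: "p \<in> polys A \<Longrightarrow> q \<in> polys A \<Longrightarrow> p - q \<in> polys A"
  by (simp add: polys_def sring_diff[OF A])

lemma polys_add: "p \<in> polys A \<Longrightarrow> q \<in> polys A \<Longrightarrow> p + q \<in> polys A"
  by (simp add: polys_def sring_add[OF A])

lemma polys_mult: "p \<in> polys A \<Longrightarrow> q \<in> polys A \<Longrightarrow> p * q \<in> polys A"
  by (auto simp: polys_def coeff_mult intro!: sring_sum[OF A] sring_mult[OF A])

lemma polys_smult: "a \<in> A \<Longrightarrow> p \<in> polys A \<Longrightarrow> smult a p \<in> polys A"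
  by (simp add: polys_def sring_mult[OF A])

lemma polys_monom: "a \<in> A \<Longrightarrow> monom a n \<in> polys A"
  by (simp add: polys_def sring_0[OF A])

lemma poly_in: "p \<in> polys A \<Longrightarrow> x \<in> A \<Longrightarrow> poly p x \<in> A"
  by (auto simp: poly_altdef intro!: sring_sum[OF A] sring_mult[OF A] sring_power[OF A] coeff_in)

end

lemma polys_mono: "A \<subseteq> B \<Longrightarrow> polys A \<subseteq> polys B"
  by (auto simp: polys_def)

definition adjoin :: "'f::comm_ring_1 set \<Rightarrow> 'f \<Rightarrow> 'f set" where
  "adjoin A b = (\<lambda>p. poly p b) ` polys A"

primrec adjoins :: "'f::comm_ring_1 set \<Rightarrow> 'f list \<Rightarrow> 'f set" where
  "adjoins A [] = A"
| "adjoins A (b # bs) = adjoins (adjoin A b) bs"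

lemma sring_adjoin:
  assumes A: "sring A" shows "sring (adjoin A b)"
proof -
  have "1 \<in> polys A" using polys_const[OF A sring_1[OF A]] by (simp add: one_pCons)
  then have "1 \<in> adjoin A b" by (force simp: adjoin_def)
  then show ?thesis
    by (auto simp: sring_def adjoin_def simp flip: poly_diff poly_mult intro!: imageI polys_diff polys_mult A)
qed

lemma subset_adjoin: "sring A \<Longrightarrow> A \<subseteq> adjoin A b"
proof
  fix a assume "sring A" "a \<in> A"
  then have "poly [:a:] b \<in> adjoin A b" unfolding adjoin_def by (intro imageI polys_const)
  then show "a \<in> adjoin A b" by simp
qed

lemma in_adjoin: "sring A \<Longrightarrow> b \<in> adjoin A b"
proof -
  assume A: "sring A"
  have "poly [:0, 1:] b \<in> adjoin A b" unfolding adjoin_def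
    by (intro imageI polys_pCons polys_0 sring_0 sring_1 A)
  then show ?thesis by simp
qed

lemma adjoin_least: "sring T \<Longrightarrow> A \<subseteq> T \<Longrightarrow> b \<in> T \<Longrightarrow> adjoin A b \<subseteq> T"
  using polys_mono[of A T] by (auto simp: adjoin_def intro: poly_in)

lemma sring_adjoins: "sring A \<Longrightarrow> sring (adjoins A bs)"
  by (induction bs arbitrary: A) (simp_all add: sring_adjoin)

lemma subset_adjoins: "sring A \<Longrightarrow> A \<subseteq> adjoins A bs"
  by (induction bs arbitrary: A) (auto dest: subset_adjoin sring_adjoin)

lemma set_subset_adjoins: "sring A \<Longrightarrow> set bs \<subseteq> adjoins A bs"
proof (induction bs arbitrary: A)
  case (Cons b bs)
  then show ?case
    using subset_adjoins[OF sring_adjoin, of A b bs] in_adjoin[of A b] sring_adjoin[of A b] by auto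
qed simp

lemma adjoins_least: "sring T \<Longrightarrow> A \<subseteq> T \<Longrightarrow> set bs \<subseteq> T \<Longrightarrow> adjoins A bs \<subseteq> T"
  by (induction bs arbitrary: A) (simp_all add: adjoin_least)

subsection \<open>Homomorphisms on subrings\<close>

definition hom_on :: "'f::comm_ring_1 set \<Rightarrow> ('f \<Rightarrow> 'g::comm_ring_1) \<Rightarrow> bool" where
  "hom_on A \<phi> \<longleftrightarrow> \<phi> 1 = 1 \<and> (\<forall>x\<in>A. \<forall>y\<in>A. \<phi> (x + y) = \<phi> x + \<phi> y \<and> \<phi> (x * y) = \<phi> x * \<phi> y)"

lemma hom_on_subset: "hom_on B \<phi> \<Longrightarrow> A \<subseteq> B \<Longrightarrow> hom_on A \<phi>"
  by (auto simp: hom_on_def)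

context
  fixes A :: "'f::comm_ring_1 set" and \<phi> :: "'f \<Rightarrow> 'g::comm_ring_1"
  assumes A: "sring A" and \<phi>: "hom_on A \<phi>"
begin

lemma hom_on_1: "\<phi> 1 = 1" and hom_on_add: "x \<in> A \<Longrightarrow> y \<in> A \<Longrightarrow> \<phi> (x + y) = \<phi> x + \<phi> y"
  and hom_on_mult: "x \<in> A \<Longrightarrow> y \<in> A \<Longrightarrow> \<phi> (x * y) = \<phi> x * \<phi> y"
  using \<phi> by (auto simp: hom_on_def)

lemma hom_on_0: "\<phi> 0 = 0"
  using hom_on_add[OF sring_0[OF A] sring_0[OF A]] by simp

lemma hom_on_minus: "x \<in> A \<Longrightarrow> \<phi> (- x) = - \<phi> x"
  using hom_on_add[of x "- x"] sring_minus[OF A] hom_on_0 by (simp add: eq_neg_iff_add_eq_0 add.commute)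

lemma hom_on_diff: "x \<in> A \<Longrightarrow> y \<in> A \<Longrightarrow> \<phi> (x - y) = \<phi> x - \<phi> y"
  using hom_on_add[of x "- y"] sring_minus[OF A] hom_on_minus by simp

lemma hom_on_sum: "(\<And>x. x \<in> S \<Longrightarrow> f x \<in> A) \<Longrightarrow> \<phi> (sum f S) = (\<Sum>x\<in>S. \<phi> (f x))"
  by (induction S rule: infinite_finite_induct) (auto simp: hom_on_0 hom_on_add sring_sum[OF A])

lemma hom_on_prod: "(\<And>x. x \<in> S \<Longrightarrow> f x \<in> A) \<Longrightarrow> \<phi> (prod f S) = (\<Prod>x\<in>S. \<phi> (f x))"
  by (induction S rule: infinite_finite_induct) (auto simp: hom_on_1 hom_on_mult sring_prod[OF A])

lemma hom_on_power: "x \<in> A \<Longrightarrow> \<phi> (x ^ n) = \<phi> x ^ n"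
  by (induction n) (auto simp: hom_on_1 hom_on_mult sring_power[OF A])

lemma hom_on_of_nat: "\<phi> (of_nat n) = of_nat n"
  by (induction n) (auto simp: hom_on_0 hom_on_1 hom_on_add sring_1[OF A] sring_of_nat[OF A])

lemma coeff_map_hom: "coeff (map_poly \<phi> p) i = \<phi> (coeff p i)"
  by (simp add: coeff_map_poly hom_on_0)

lemma map_hom_add: "p \<in> polys A \<Longrightarrow> q \<in> polys A \<Longrightarrow> map_poly \<phi> (p + q) = map_poly \<phi> p + map_poly \<phi> q"
  by (rule poly_eqI) (simp add: coeff_map_hom hom_on_add coeff_in)

lemma map_hom_diff: "p \<in> polys A \<Longrightarrow> q \<in> polys A \<Longrightarrow> map_poly \<phi> (p - q) = map_poly \<phi> p - map_poly \<phi> q"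
  by (rule poly_eqI) (simp add: coeff_map_hom hom_on_diff coeff_in)

lemma map_hom_mult: "p \<in> polys A \<Longrightarrow> q \<in> polys A \<Longrightarrow> map_poly \<phi> (p * q) = map_poly \<phi> p * map_poly \<phi> q"
  by (rule poly_eqI) (simp add: coeff_map_hom coeff_mult hom_on_sum hom_on_mult coeff_in sring_mult[OF A])

lemma map_hom_smult: "a \<in> A \<Longrightarrow> p \<in> polys A \<Longrightarrow> map_poly \<phi> (smult a p) = smult (\<phi> a) (map_poly \<phi> p)"
  by (rule poly_eqI) (simp add: coeff_map_hom hom_on_mult coeff_in)

lemma map_hom_const: "map_poly \<phi> [:a:] = [:\<phi> a:]"
  by (rule poly_eqI) (simp add: coeff_map_hom hom_on_0 coeff_pCons split: nat.splits)

lemma map_hom_in: "p \<in> polys A \<Longrightarrow> map_poly \<phi> p \<in> polys (\<phi> ` A)"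
  by (simp add: polys_def coeff_map_hom)

lemma degree_map_hom_le: "degree (map_poly \<phi> p) \<le> degree p"
  by (rule degree_le) (simp add: coeff_map_hom coeff_eq_0 hom_on_0)

lemma poly_map_hom: "p \<in> polys A \<Longrightarrow> x \<in> A \<Longrightarrow> poly (map_poly \<phi> p) (\<phi> x) = \<phi> (poly p x)"
proof (induction p)
  case (pCons a p)
  have "a \<in> A" "p \<in> polys A" using pCons.prems(1)
    by (auto simp: polys_def coeff_pCons split: nat.splits dest: spec[of _ "Suc _"] spec[of _ 0])
  moreover have "map_poly \<phi> (pCons a p) = pCons (\<phi> a) (map_poly \<phi> p)"
    by (rule poly_eqI) (simp add: coeff_map_hom coeff_pCons split: nat.splits)
  ultimately show ?case using pCons by (simp add: hom_on_add hom_on_mult poly_in[OF A] sring_mult[OF A])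
qed (simp add: hom_on_0)

end

lemma sring_image: "sring A \<Longrightarrow> hom_on A \<phi> \<Longrightarrow> sring (\<phi> ` A)"
proof -
  assume A: "sring A" "hom_on A \<phi>"
  have "1 \<in> \<phi> ` A" using hom_on_1[OF A] sring_1[OF A(1)] by (metis imageI)
  moreover have "\<phi> x - \<phi> y \<in> \<phi> ` A" "\<phi> x * \<phi> y \<in> \<phi> ` A" if "x \<in> A" "y \<in> A" for x y
    using that imageI[OF sring_diff[OF A(1) that], of \<phi>] imageI[OF sring_mult[OF A(1) that], of \<phi>]
    by (simp_all add: hom_on_diff[OF A] hom_on_mult[OF A])
  ultimately show ?thesis by (auto simp: sring_def)
qed

lemma polys_image:
  assumes A: "sring A" "hom_on A \<phi>" and p: "p \<in> polys (\<phi> ` A)"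
  obtains q where "q \<in> polys A" "p = map_poly \<phi> q"
proof -
  have "\<exists>q\<in>polys A. p = map_poly \<phi> q"
    using p
  proof (induction p)
    case 0
    then show ?case using A by (intro bexI[of _ 0]) auto
  next
    case (pCons a p)
    then have "a \<in> \<phi> ` A" "p \<in> polys (\<phi> ` A)"
      by (auto simp: polys_def coeff_pCons split: nat.splits dest: spec[of _ "Suc _"] spec[of _ 0])
    with pCons obtain b q where "b \<in> A" "a = \<phi> b" "q \<in> polys A" "p = map_poly \<phi> q" by blast
    moreover have "map_poly \<phi> (pCons b q) = pCons (\<phi> b) (map_poly \<phi> q)"
      by (rule poly_eqI) (simp add: coeff_map_hom[OF A] coeff_pCons split: nat.splits)
    ultimately show ?case by (metis polys_pCons)
  qed
  then show ?thesis using that by blast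
qed

text \<open>
  The ring \<open>S\<close> containing \<open>A\<close> and \<open>b\<close> is there because \<open>\<theta>\<close> has to be multiplicative on \<open>A[b]\<close>.
\<close>

lemma image_adjoin:
  assumes S: "sring S" "hom_on S \<theta>" and A: "sring A" "A \<subseteq> S" "b \<in> S"
  shows "\<theta> ` adjoin A b = adjoin (\<theta> ` A) (\<theta> b)"
proof -
  have A': "hom_on A \<theta>" using S A hom_on_subset by blast
  have eq: "\<theta> (poly p b) = poly (map_poly \<theta> p) (\<theta> b)" if "p \<in> polys A" for p
    using poly_map_hom[OF S, of p b] that polys_mono[OF A(2)] A(3) by auto
  show ?thesis
  proof
    show "\<theta> ` adjoin A b \<subseteq> adjoin (\<theta> ` A) (\<theta> b)"
      by (auto simp: adjoin_def eq intro: map_hom_in[OF A(1) A'])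
    show "adjoin (\<theta> ` A) (\<theta> b) \<subseteq> \<theta> ` adjoin A b"
    proof
      fix x assume "x \<in> adjoin (\<theta> ` A) (\<theta> b)"
      then obtain p where p: "p \<in> polys (\<theta> ` A)" "x = poly p (\<theta> b)" by (auto simp: adjoin_def)
      obtain q where q: "q \<in> polys A" "p = map_poly \<theta> q" using polys_image[OF A(1) A' p(1)] .
      then have "x = \<theta> (poly q b)" using p eq by simp
      then show "x \<in> \<theta> ` adjoin A b" using q(1) unfolding adjoin_def by blast
    qed
  qed
qed

section \<open>Algebraic elements over subrings of fields\<close>

definition alg_over :: "'f::field set \<Rightarrow> 'f \<Rightarrow> bool" where
  "alg_over A x \<longleftrightarrow> (\<exists>p\<in>polys A. p \<noteq> 0 \<and> poly p x = 0)"

lemma alg_over_mono: "A \<subseteq> B \<Longrightarrow> alg_over A x \<Longrightarrow> alg_over B x"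
  using polys_mono unfolding alg_over_def by blast

lemma minimal_poly:
  assumes "alg_over A x"
  shows "\<exists>q. q \<in> polys A \<and> q \<noteq> 0 \<and> poly q x = 0 \<and>
    (\<forall>p. p \<in> polys A \<longrightarrow> p \<noteq> 0 \<longrightarrow> poly p x = 0 \<longrightarrow> degree q \<le> degree p)"
proof -
  obtain p where "p \<in> polys A \<and> p \<noteq> 0 \<and> poly p x = 0" using assms by (auto simp: alg_over_def)
  from ex_has_least_nat[of "\<lambda>p. p \<in> polys A \<and> p \<noteq> 0 \<and> poly p x = 0", OF this, of degree]
  show ?thesis by blast
qed

lemma alg_over_self: "sring A \<Longrightarrow> x \<in> A \<Longrightarrow> alg_over A x"
  unfolding alg_over_def
  by (intro bexI[of _ "[:- x, 1:]"]) (auto intro!: polys_pCons sring_minus sring_1)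

definition sfield :: "'f::field set \<Rightarrow> bool" where
  "sfield K \<longleftrightarrow> sring K \<and> (\<forall>x\<in>K. inverse x \<in> K)"

abbreviation type_ring :: "'f::field ring" where
  "type_ring \<equiv> ring_of_type_algebra"

lemma type_ring_simps [simp]:
  "carrier type_ring = UNIV" "x \<otimes>\<^bsub>type_ring\<^esub> y = x * y" "x \<oplus>\<^bsub>type_ring\<^esub> y = x + y"
  "\<one>\<^bsub>type_ring\<^esub> = 1" "\<zero>\<^bsub>type_ring\<^esub> = 0"
  by (simp_all add: ring_of_type_algebra_def)

lemma type_ring_a_inv [simp]: "\<ominus>\<^bsub>type_ring\<^esub> x = - x"
proof -
  interpret R: field "type_ring :: 'a ring" by (rule field_from_type_algebra)
  show ?thesis by (rule R.minus_equality) auto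
qed

lemma type_ring_m_inv [simp]: "x \<noteq> 0 \<Longrightarrow> inv\<^bsub>type_ring\<^esub> x = inverse x"
proof -
  interpret R: field "type_ring :: 'a ring" by (rule field_from_type_algebra)
  show "x \<noteq> 0 \<Longrightarrow> inv\<^bsub>type_ring\<^esub> x = inverse x" by (rule R.comm_inv_char) auto
qed

lemma type_ring_power [simp]: "x [^]\<^bsub>type_ring\<^esub> (n::nat) = x ^ n"
  by (induction n) (auto simp: nat_pow_def mult.commute)

lemma sfield_iff_subfield: "sfield K \<longleftrightarrow> subfield K type_ring"
proof -
  interpret R: field "type_ring :: 'a ring" by (rule field_from_type_algebra)
  show ?thesis
  proof
    assume K: "sfield K"
    show "subfield K type_ring"
    proof (rule R.subfieldI')
      show "subring K type_ring"
        by (rule R.subringI) (use K in \<open>auto simp: sfield_def intro: sring_1 sring_minus sring_mult sring_add\<close>)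
    qed (use K in \<open>auto simp: sfield_def\<close>)
  next
    assume K: "subfield K type_ring"
    have 0: "0 \<in> K" "1 \<in> K" using subringE(2,3)[OF subfieldE(1)[OF K]] by auto
    have "x - y \<in> K" if "x \<in> K" "y \<in> K" for x y
      using subringE(7)[OF subfieldE(1)[OF K] that(1) subringE(5)[OF subfieldE(1)[OF K] that(2)]] by simp
    moreover have "x * y \<in> K" if "x \<in> K" "y \<in> K" for x y
      using subringE(6)[OF subfieldE(1)[OF K] that] by simp
    moreover have "inverse x \<in> K" if "x \<in> K" for x
      using R.subfield_m_inv(1)[OF K, of x] that 0 by (cases "x = 0") auto
    ultimately show "sfield K" using 0 by (auto simp: sfield_def sring_def)
  qed
qed

lemma eval_type_ring: "ring.eval type_ring xs x = poly (Poly (rev xs)) x"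
proof -
  interpret R: field "type_ring :: 'a ring" by (rule field_from_type_algebra)
  show ?thesis by (induction xs) (auto simp: Poly_append poly_monom mult.commute add.commute)
qed

lemma alg_over_iff_algebraic:
  assumes K: "sfield K"
  shows "alg_over K x \<longleftrightarrow> (ring.algebraic type_ring over K) x"
proof -
  interpret R: field "type_ring :: 'a ring" by (rule field_from_type_algebra)
  have sf: "subfield K type_ring" using K sfield_iff_subfield by blast
  show ?thesis
  proof
    assume "alg_over K x"
    then obtain p where p: "p \<in> polys K" "p \<noteq> 0" "poly p x = 0" by (auto simp: alg_over_def)
    have "rev (coeffs p) \<in> carrier (K[X]\<^bsub>type_ring\<^esub>)"
      using p by (auto simp: univ_poly_def polynomial_def hd_rev last_coeffs_eq_coeff_degree
          coeffs_def polys_def)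
    moreover have "rev (coeffs p) \<noteq> []" using p by simp
    moreover have "R.eval (rev (coeffs p)) x = \<zero>\<^bsub>type_ring\<^esub>" by (simp add: eval_type_ring p)
    ultimately show "(R.algebraic over K) x" by (rule R.algebraicI)
  next
    assume "(R.algebraic over K) x"
    then obtain p where p: "p \<in> carrier (K[X]\<^bsub>type_ring\<^esub>)" "p \<noteq> []" "R.eval p x = \<zero>\<^bsub>type_ring\<^esub>"
      using R.algebraicE[OF subfieldE(1)[OF sf]] by auto
    have set: "set p \<subseteq> K" and hd: "hd p \<noteq> 0" using p by (auto simp: univ_poly_def polynomial_def)
    have "0 \<in> K" using K sring_0 by (auto simp: sfield_def)
    then have "Poly (rev p) \<in> polys K"
      using set nth_mem[of _ "rev p"] by (auto simp: polys_def nth_default_def simp del: nth_mem)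
    moreover have "coeff (Poly (rev p)) (length p - 1) = hd p"
      using p(2) by (simp add: nth_default_def rev_nth hd_conv_nth)
    then have "Poly (rev p) \<noteq> 0" using hd by (metis coeff_0)
    moreover have "poly (Poly (rev p)) x = 0" using p(3) by (simp add: eval_type_ring)
    ultimately show "alg_over K x" unfolding alg_over_def by blast
  qed
qed

definition fracs :: "'f::field set \<Rightarrow> 'f set" where
  "fracs A = {x / y | x y. x \<in> A \<and> y \<in> A \<and> y \<noteq> 0}"

lemma fracsI: "x \<in> A \<Longrightarrow> y \<in> A \<Longrightarrow> y \<noteq> 0 \<Longrightarrow> x / y \<in> fracs A"
  by (auto simp: fracs_def)

lemma subset_fracs: "sring A \<Longrightarrow> A \<subseteq> fracs A"
  using fracsI[of _ A 1] sring_1[of A] by force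

lemma sfield_fracs:
  assumes A: "sring A" shows "sfield (fracs A)"
proof -
  have "1 \<in> fracs A" using subset_fracs[OF A] sring_1[OF A] by blast
  moreover have "u - v \<in> fracs A \<and> u * v \<in> fracs A" if uv: "u \<in> fracs A" "v \<in> fracs A" for u v
  proof -
    obtain x y x' y' where eq: "u = x / y" "v = x' / y'" and *: "x \<in> A" "y \<in> A" "y \<noteq> 0" "x' \<in> A" "y' \<in> A" "y' \<noteq> 0"
      using uv unfolding fracs_def by blast
    have "u - v = (x * y' - x' * y) / (y * y')" "u * v = (x * x') / (y * y')"
      unfolding eq using * by (simp_all add: diff_frac_eq)
    then show ?thesis
      using * by (auto intro!: fracsI sring_diff[OF A] sring_mult[OF A])
  qed
  moreover have "inverse u \<in> fracs A" if u: "u \<in> fracs A" for u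
  proof -
    obtain x y where "u = x / y" "x \<in> A" "y \<in> A" "y \<noteq> 0" using u unfolding fracs_def by blast
    then show ?thesis
      using fracsI[of y A x] subset_fracs[OF A] sring_0[OF A] by (cases "x = 0") auto
  qed
  ultimately show ?thesis by (simp add: sfield_def sring_def)
qed

text \<open>
  Multiply the coefficients by a common denominator.
\<close>

lemma alg_over_fracs:
  assumes A: "sring A" and x: "alg_over (fracs A) x"
  shows "alg_over A x"
proof -
  have "\<exists>d\<in>A. d \<noteq> 0 \<and> smult d p \<in> polys A" if "p \<in> polys (fracs A)" for p
    using that
  proof (induction p)
    case 0
    then show ?case using A by (intro bexI[of _ 1]) (auto intro: sring_1)
  next
    case (pCons a p)
    then have "a \<in> fracs A" "p \<in> polys (fracs A)"
      by (auto simp: polys_def coeff_pCons split: nat.splits dest: spec[of _ "Suc _"] spec[of _ 0])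
    with pCons obtain d x y where d: "d \<in> A" "d \<noteq> 0" "smult d p \<in> polys A"
      and xy: "a = x / y" "x \<in> A" "y \<in> A" "y \<noteq> 0" unfolding fracs_def by blast
    have "smult (d * y) (pCons a p) = pCons (d * x) (smult y (smult d p))"
      using xy by (simp add: mult.commute)
    moreover have "\<dots> \<in> polys A"
      by (rule polys_pCons[OF sring_mult[OF A d(1) xy(2)] polys_smult[OF A xy(3) d(3)]])
    ultimately show ?case using d xy by (intro bexI[of _ "d * y"]) (auto intro: sring_mult[OF A])
  qed
  moreover obtain p where "p \<in> polys (fracs A)" "p \<noteq> 0" "poly p x = 0" using x by (auto simp: alg_over_def)
  ultimately obtain d where "d \<noteq> 0" "smult d p \<in> polys A" by blast
  with \<open>p \<noteq> 0\<close> \<open>poly p x = 0\<close> show ?thesis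
    unfolding alg_over_def by (intro bexI[of _ "smult d p"]) auto
qed

text \<open>
  For the field of fractions of \<open>A\<close> this is the theorem that the algebraic elements over a subfield
  form a subfield.
\<close>

lemma sfield_alg_over:
  assumes A: "sring A" shows "sfield {x. alg_over A x}"
proof -
  interpret R: field "type_ring :: 'a ring" by (rule field_from_type_algebra)
  have "alg_over A x \<longleftrightarrow> alg_over (fracs A) x" for x
    using alg_over_fracs[OF A] alg_over_mono[OF subset_fracs[OF A]] by blast
  then have "{x. alg_over A x} = {x. (R.algebraic over fracs A) x}"
    using alg_over_iff_algebraic[OF sfield_fracs[OF A]] by simp
  then show ?thesis
    using R.subfield_of_algebraics[of "fracs A"] sfield_fracs[OF A] by (simp add: sfield_iff_subfield)
qed

text \<open>
  Divide an equation of \<open>x\<close> by the highest power of the variable that divides it.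
\<close>

lemma alg_over_coeff_0:
  assumes "alg_over A x" "x \<noteq> 0"
  shows "\<exists>p\<in>polys A. poly p x = 0 \<and> coeff p 0 \<noteq> 0"
proof -
  have "p \<in> polys A \<Longrightarrow> p \<noteq> 0 \<Longrightarrow> poly p x = 0 \<Longrightarrow> ?thesis" for p
  proof (induction p)
    case (pCons a p)
    show ?case
    proof (cases "a = 0")
      case True
      then have "p \<in> polys A" using pCons.prems(1)
        by (auto simp: polys_def coeff_pCons split: nat.splits dest: spec[of _ "Suc _"])
      then show ?thesis using True pCons assms(2) by auto
    next
      case False
      then show ?thesis using pCons.prems by (intro bexI[of _ "pCons a p"]) auto
    qed
  qed simp
  then show ?thesis using assms(1) by (auto simp: alg_over_def)
qed

lemma poly_pseudo_division:
  fixes p q :: "'f::field poly"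
  assumes A: "sring A" and q: "q \<in> polys A" "q \<noteq> 0" and p: "p \<in> polys A"
  shows "\<exists>N. \<exists>s\<in>polys A. \<exists>r\<in>polys A. smult (lead_coeff q ^ N) p = q * s + r \<and> (r = 0 \<or> degree r < degree q)"
proof -
  have "p \<in> polys A \<Longrightarrow> p = 0 \<or> degree p < n \<Longrightarrow>
    \<exists>N. \<exists>s\<in>polys A. \<exists>r\<in>polys A. smult (lead_coeff q ^ N) p = q * s + r \<and> (r = 0 \<or> degree r < degree q)" for n p
  proof (induction n arbitrary: p)
    case 0
    then show ?case using polys_0[OF A] by (intro exI[of _ 0] bexI[of _ 0] bexI[of _ p]) auto
  next
    case (Suc n)
    show ?case
    proof (cases "p = 0 \<or> degree p < degree q")
      case True
      then show ?thesis using Suc polys_0[OF A] by (intro exI[of _ 0] bexI[of _ 0] bexI[of _ p]) auto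
    next
      case False
      define t where "t = monom (lead_coeff p) (degree p - degree q)"
      have t: "t \<in> polys A" unfolding t_def by (intro polys_monom A coeff_in Suc.prems)
      define p' where "p' = smult (lead_coeff q) p - q * t"
      have p': "p' \<in> polys A" unfolding p'_def
        by (intro polys_diff polys_smult polys_mult A coeff_in q t Suc.prems)
      have "degree (q * t) = degree p"
        using False q by (simp add: t_def degree_mult_eq degree_monom_eq)
      moreover have "coeff (q * t) (degree p) = lead_coeff q * lead_coeff p"
        using False coeff_mult_degree_sum[of q t] by (simp add: t_def degree_monom_eq)
      ultimately have "degree p' \<le> degree p" "coeff p' (degree p) = 0"
        by (auto simp: p'_def intro!: degree_diff_le)
      then have "p' = 0 \<or> degree p' < degree p"
        by (metis le_neq_implies_less leading_coeff_0_iff)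
      then have "p' = 0 \<or> degree p' < n" using Suc.prems False by auto
      from Suc.IH[OF p' this] obtain N s r where
        r: "s \<in> polys A" "r \<in> polys A" "smult (lead_coeff q ^ N) p' = q * s + r" "r = 0 \<or> degree r < degree q" by blast
      have "smult (lead_coeff q ^ Suc N) p = smult (lead_coeff q ^ N) p' + q * smult (lead_coeff q ^ N) t"
        by (simp add: p'_def smult_diff_right mult.commute)
      also have "\<dots> = q * (s + smult (lead_coeff q ^ N) t) + r"
        using r(3) by (simp add: algebra_simps)
      finally have "smult (lead_coeff q ^ Suc N) p = q * (s + smult (lead_coeff q ^ N) t) + r" .
      moreover have "s + smult (lead_coeff q ^ N) t \<in> polys A"
        by (intro polys_add polys_smult A sring_power coeff_in q t r)
      ultimately show ?thesis using r by blast
    qed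
  qed
  then show ?thesis using p by (metis lessI)
qed

section \<open>Extending homomorphisms to an algebraically closed field\<close>

text \<open>
  A homomorphism extends to \<open>A[b]\<close> with \<open>b \<mapsto> \<beta>\<close> if \<open>\<beta>\<close> satisfies the image of every relation of \<open>b\<close>
  over \<open>A\<close>.
\<close>

lemma hom_on_adjoin:
  fixes \<phi> :: "'f::field \<Rightarrow> 'o::field"
  assumes A: "sring A" "hom_on A \<phi>"
    and rel: "\<And>p. p \<in> polys A \<Longrightarrow> poly p b = 0 \<Longrightarrow> poly (map_poly \<phi> p) \<beta> = 0"
  shows "\<exists>\<psi>. hom_on (adjoin A b) \<psi> \<and> (\<forall>x\<in>A. \<psi> x = \<phi> x) \<and> (\<forall>p\<in>polys A. \<psi> (poly p b) = poly (map_poly \<phi> p) \<beta>)"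
proof -
  define \<psi> where "\<psi> x = poly (map_poly \<phi> (SOME p. p \<in> polys A \<and> poly p b = x)) \<beta>" for x
  have \<psi>: "\<psi> (poly p b) = poly (map_poly \<phi> p) \<beta>" if p: "p \<in> polys A" for p
  proof -
    define q where "q = (SOME q. q \<in> polys A \<and> poly q b = poly p b)"
    have q: "q \<in> polys A \<and> poly q b = poly p b"
      unfolding q_def by (rule someI[of _ p]) (use p in simp)
    then have "poly (map_poly \<phi> (q - p)) \<beta> = 0" using p by (intro rel polys_diff A) auto
    then show ?thesis using p q by (simp add: \<psi>_def q_def[symmetric] map_hom_diff[OF A])
  qed
  have "\<psi> x = \<phi> x" if "x \<in> A" for x
    using \<psi>[OF polys_const[OF A(1) that]] by (simp add: map_hom_const[OF A])
  moreover have "hom_on (adjoin A b) \<psi>"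
    unfolding hom_on_def adjoin_def
  proof (intro conjI ballI)
    show "\<psi> 1 = 1" using \<open>\<And>x. x \<in> A \<Longrightarrow> \<psi> x = \<phi> x\<close>[of 1] A by (simp add: sring_1 hom_on_1)
  next
    fix x y assume "x \<in> (\<lambda>p. poly p b) ` polys A" "y \<in> (\<lambda>p. poly p b) ` polys A"
    then obtain p q where pq: "p \<in> polys A" "q \<in> polys A" "x = poly p b" "y = poly q b" by auto
    show "\<psi> (x + y) = \<psi> x + \<psi> y"
      using \<psi>[OF polys_add[OF A(1) pq(1,2)]] pq by (simp add: \<psi> map_hom_add[OF A])
    show "\<psi> (x * y) = \<psi> x * \<psi> y"
      using \<psi>[OF polys_mult[OF A(1) pq(1,2)]] pq by (simp add: \<psi> map_hom_mult[OF A])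
  qed
  ultimately show ?thesis using \<psi> by blast
qed

text \<open>
  If \<open>b\<close> is transcendental over \<open>A\<close>, there are no relations, and \<open>\<beta>\<close> only has to avoid the zeros of the
  image of the polynomial that represents \<open>u\<close>; this image is non-zero if the leading coefficient
  survives.  If \<open>b\<close> is algebraic, \<open>\<beta>\<close> is chosen as a zero of the image of a polynomial \<open>q\<close> of minimal
  degree.  When the leading coefficient of \<open>q\<close> survives, pseudo-division by \<open>q\<close> shows that \<open>\<beta>\<close>
  satisfies all relations.  An equation of \<open>u\<close> whose constant term survives then excludes \<open>\<psi> u = 0\<close>.
\<close>

lemma hom_extension_adjoin:
  fixes A :: "'f::field set"
  assumes A: "sring A" and u: "u \<in> adjoin A b" "u \<noteq> 0"
  shows "\<exists>f\<in>A. f \<noteq> 0 \<and> (\<forall>\<phi> :: 'f \<Rightarrow> 'o::{alg_closed_field,field_char_0}.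
    hom_on A \<phi> \<and> \<phi> f \<noteq> 0 \<longrightarrow> (\<exists>\<psi>. hom_on (adjoin A b) \<psi> \<and> (\<forall>x\<in>A. \<psi> x = \<phi> x) \<and> \<psi> u \<noteq> 0))"
proof (cases "alg_over A b")
  case False
  obtain U where U: "U \<in> polys A" "u = poly U b" using u by (auto simp: adjoin_def)
  then have "U \<noteq> 0" using u by auto
  show ?thesis
  proof (intro bexI[of _ "lead_coeff U"] conjI allI impI)
    fix \<phi> :: "'f \<Rightarrow> 'o" assume \<phi>: "hom_on A \<phi> \<and> \<phi> (lead_coeff U) \<noteq> 0"
    then have "map_poly \<phi> U \<noteq> 0" using coeff_map_hom[OF A, of \<phi> U "degree U"] by auto
    then have "finite {\<beta>. poly (map_poly \<phi> U) \<beta> = 0}" by (rule poly_roots_finite)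
    then obtain \<beta> where \<beta>: "poly (map_poly \<phi> U) \<beta> \<noteq> 0"
      using ex_new_if_finite[OF infinite_UNIV_char_0] by blast
    have "poly (map_poly \<phi> p) \<beta> = 0" if "p \<in> polys A" "poly p b = 0" for p
      using False that by (auto simp: alg_over_def)
    from hom_on_adjoin[OF A conjunct1[OF \<phi>] this] obtain \<psi> where
      "hom_on (adjoin A b) \<psi>" "\<forall>x\<in>A. \<psi> x = \<phi> x" "\<forall>p\<in>polys A. \<psi> (poly p b) = poly (map_poly \<phi> p) \<beta>" by blast
    then show "\<exists>\<psi>. hom_on (adjoin A b) \<psi> \<and> (\<forall>x\<in>A. \<psi> x = \<phi> x) \<and> \<psi> u \<noteq> 0" using \<beta> U by auto
  qed (use \<open>U \<noteq> 0\<close> U in \<open>auto intro: coeff_in\<close>)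
next
  case True
  then obtain q where "q \<in> polys A \<and> q \<noteq> 0 \<and> poly q b = 0 \<and>
    (\<forall>p. p \<in> polys A \<longrightarrow> p \<noteq> 0 \<longrightarrow> poly p b = 0 \<longrightarrow> degree q \<le> degree p)"
    by (rule exE[OF minimal_poly])
  then have q: "q \<in> polys A" "q \<noteq> 0" "poly q b = 0"
    and min: "\<And>p. p \<in> polys A \<Longrightarrow> p \<noteq> 0 \<Longrightarrow> poly p b = 0 \<Longrightarrow> degree q \<le> degree p"
    by simp_all
  have "adjoin A b \<subseteq> {x. alg_over A x}"
    using sfield_alg_over[OF A] True alg_over_self[OF A] by (intro adjoin_least) (auto simp: sfield_def)
  then obtain w where w: "w \<in> polys A" "poly w u = 0" "coeff w 0 \<noteq> 0"
    using alg_over_coeff_0[of A u] u by blast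
  show ?thesis
  proof (intro bexI[of _ "lead_coeff q * coeff w 0"] conjI allI impI)
    fix \<phi> :: "'f \<Rightarrow> 'o" assume "hom_on A \<phi> \<and> \<phi> (lead_coeff q * coeff w 0) \<noteq> 0"
    then have \<phi>: "hom_on A \<phi>" and nz: "\<phi> (lead_coeff q) \<noteq> 0" "\<phi> (coeff w 0) \<noteq> 0"
      using hom_on_mult[OF A, of \<phi> "lead_coeff q" "coeff w 0"] q w by (auto simp: coeff_in)
    have "degree q \<noteq> 0"
    proof
      assume "degree q = 0"
      then obtain a where "q = [:a:]" by (rule degree_eq_zeroE)
      with q show False by simp
    qed
    moreover have "degree q \<le> degree (map_poly \<phi> q)"
      using nz(1) by (intro le_degree) (simp add: coeff_map_hom[OF A \<phi>])
    ultimately obtain \<beta> where \<beta>: "poly (map_poly \<phi> q) \<beta> = 0"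
      using alg_closed_imp_poly_has_root[of "map_poly \<phi> q"] by auto
    have rel: "poly (map_poly \<phi> p) \<beta> = 0" if p: "p \<in> polys A" "poly p b = 0" for p
    proof -
      obtain N s r where r: "s \<in> polys A" "r \<in> polys A" "smult (lead_coeff q ^ N) p = q * s + r" "r = 0 \<or> degree r < degree q"
        using poly_pseudo_division[OF A q(1,2) p(1)] by blast
      have "poly r b = 0" using arg_cong[OF r(3), of "\<lambda>p. poly p b"] p q by simp
      then have "r = 0" using r min[of r] by force
      then have eq: "smult (lead_coeff q ^ N) p = q * s" using r(3) by simp
      have lc: "lead_coeff q \<in> A" by (rule coeff_in[OF q(1)])
      have "smult (\<phi> (lead_coeff q) ^ N) (map_poly \<phi> p) = map_poly \<phi> (smult (lead_coeff q ^ N) p)"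
        by (simp only: map_hom_smult[OF A \<phi> sring_power[OF A lc] p(1)] hom_on_power[OF A \<phi> lc])
      also have "\<dots> = map_poly \<phi> q * map_poly \<phi> s"
        unfolding eq by (rule map_hom_mult[OF A \<phi> q(1) r(1)])
      finally have "\<phi> (lead_coeff q) ^ N * poly (map_poly \<phi> p) \<beta> = poly (map_poly \<phi> q) \<beta> * poly (map_poly \<phi> s) \<beta>"
        by (metis poly_smult poly_mult)
      then show ?thesis using \<beta> nz(1) by simp
    qed
    obtain \<psi> where \<psi>: "hom_on (adjoin A b) \<psi>" "\<forall>x\<in>A. \<psi> x = \<phi> x"
      using hom_on_adjoin[OF A \<phi> rel] by metis
    have "\<psi> u \<noteq> 0"
    proof
      assume "\<psi> u = 0"
      have "w \<in> polys (adjoin A b)" using w polys_mono[OF subset_adjoin[OF A]] by blast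
      from poly_map_hom[OF sring_adjoin[OF A] \<psi>(1) this u(1)]
      have "poly (map_poly \<psi> w) 0 = \<psi> 0" using w \<open>\<psi> u = 0\<close> by simp
      then have "\<psi> (coeff w 0) = 0"
        by (simp add: poly_0_coeff_0 coeff_map_hom[OF sring_adjoin[OF A] \<psi>(1)] hom_on_0[OF sring_adjoin[OF A] \<psi>(1)])
      then show False using \<psi>(2) nz(2) w(1) by (simp add: coeff_in)
    qed
    then show "\<exists>\<psi>. hom_on (adjoin A b) \<psi> \<and> (\<forall>x\<in>A. \<psi> x = \<phi> x) \<and> \<psi> u \<noteq> 0" using \<psi> by blast
  qed (use q w in \<open>auto intro!: sring_mult[OF A] coeff_in\<close>)
qed

text \<open>
  For a finitely generated ring extension, almost every homomorphism to an algebraically closed field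
  extends without killing a given element: the non-vanishing of one \<open>f\<close> in the base ring suffices.
\<close>

lemma hom_extension_adjoins:
  fixes A :: "'f::field set"
  assumes "sring A" "u \<in> adjoins A bs" "u \<noteq> 0"
  shows "\<exists>f\<in>A. f \<noteq> 0 \<and> (\<forall>\<phi> :: 'f \<Rightarrow> 'o::{alg_closed_field,field_char_0}.
    hom_on A \<phi> \<and> \<phi> f \<noteq> 0 \<longrightarrow> (\<exists>\<psi>. hom_on (adjoins A bs) \<psi> \<and> (\<forall>x\<in>A. \<psi> x = \<phi> x) \<and> \<psi> u \<noteq> 0))"
  using assms
proof (induction bs arbitrary: A)
  case Nil
  then show ?case by auto
next
  case (Cons b bs)
  have A': "sring (adjoin A b)" by (rule sring_adjoin[OF Cons.prems(1)])
  obtain g where g: "g \<in> adjoin A b" "g \<noteq> 0" and ext1: "\<And>\<phi> :: 'f \<Rightarrow> 'o. hom_on (adjoin A b) \<phi> \<Longrightarrow> \<phi> g \<noteq> 0 \<Longrightarrow>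
      \<exists>\<psi>. hom_on (adjoins (adjoin A b) bs) \<psi> \<and> (\<forall>x\<in>adjoin A b. \<psi> x = \<phi> x) \<and> \<psi> u \<noteq> 0"
    using Cons.IH[OF A'] Cons.prems by auto
  obtain f where f: "f \<in> A" "f \<noteq> 0" and ext2: "\<And>\<phi> :: 'f \<Rightarrow> 'o. hom_on A \<phi> \<Longrightarrow> \<phi> f \<noteq> 0 \<Longrightarrow>
      \<exists>\<psi>. hom_on (adjoin A b) \<psi> \<and> (\<forall>x\<in>A. \<psi> x = \<phi> x) \<and> \<psi> g \<noteq> 0"
    using hom_extension_adjoin[OF Cons.prems(1) g] by blast
  show ?case
  proof (intro bexI[of _ f] conjI allI impI)
    fix \<phi> :: "'f \<Rightarrow> 'o" assume "hom_on A \<phi> \<and> \<phi> f \<noteq> 0"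
    then obtain \<psi> where "hom_on (adjoin A b) \<psi>" "\<forall>x\<in>A. \<psi> x = \<phi> x" "\<psi> g \<noteq> 0" using ext2 by blast
    moreover from this obtain \<rho> where "hom_on (adjoins (adjoin A b) bs) \<rho>" "\<forall>x\<in>adjoin A b. \<rho> x = \<psi> x" "\<rho> u \<noteq> 0"
      using ext1 by blast
    ultimately show "\<exists>\<psi>. hom_on (adjoins A (b # bs)) \<psi> \<and> (\<forall>x\<in>A. \<psi> x = \<phi> x) \<and> \<psi> u \<noteq> 0"
      using subset_adjoin[OF Cons.prems(1), of b] by (intro exI[of _ \<rho>]) auto
  qed (use f in auto)
qed

section \<open>The base field of the linear closure\<close>

lemma sfield_of_restrict_field: "field (restrict_field K) \<Longrightarrow> sfield K"
proof -
  interpret R: field "type_ring :: 'a ring" by (rule field_from_type_algebra)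
  assume "field (restrict_field K)"
  then have "subfield K type_ring" by (intro R.subfield_iff(1)) (simp_all add: restrict_field_def)
  then show ?thesis by (simp add: sfield_iff_subfield)
qed

text \<open>
  Translates polynomials given as coefficient lists in decreasing order, as used for abstract rings.
\<close>

lemma root_in_algebraic_closure:
  assumes alg: "algebraic_closure (restrict_field K) F" and p: "p \<in> polys K" "degree p > 0"
  shows "\<exists>x\<in>K. poly p x = 0"
proof -
  interpret R: field "type_ring :: 'a ring" by (rule field_from_type_algebra)
  interpret L: algebraic_closure "restrict_field K" F by (rule alg)
  have sf: "subfield K type_ring"
    using sfield_of_restrict_field[OF L.field_axioms] by (simp add: sfield_iff_subfield)
  define P where "P = rev (coeffs p)"
  have P: "P \<in> carrier (poly_ring (restrict_field K))"
    using p by (auto simp: P_def univ_poly_def polynomial_def hd_rev last_coeffs_eq_coeff_degree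
        coeffs_def polys_def restrict_field_def)
  have "Polynomials.degree P = degree p" by (simp add: P_def degree_eq_length_coeffs)
  then have "L.roots P \<noteq> {#}"
    using L.roots_over_carrier[OF P] p(2) by (auto simp: L.splitted_def)
  then obtain x where "x \<in># L.roots P" by blast
  then have "L.is_root P x" using L.roots_mem_iff_is_root[OF P] by simp
  then have "x \<in> carrier (restrict_field K)" "L.eval P x = \<zero>\<^bsub>restrict_field K\<^esub>"
    unfolding L.is_root_def by auto
  then have "x \<in> K" "L.eval P x = 0" by (simp_all add: restrict_field_def)
  moreover have "L.eval = R.eval"
    unfolding restrict_field_def using R.eval_consistent[OF subfieldE(1)[OF sf]] by simp
  ultimately show ?thesis by (auto simp: eval_type_ring P_def)
qed

context diff_extension
begin

lemma \<iota>_diff: "\<iota> (x - y) = \<iota> x - \<iota> y"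
  using \<iota>_add[of x "- y"] by (simp add: \<iota>_minus)

lemma \<iota>_divide: "\<iota> (x / y) = \<iota> x / \<iota> y"
proof (cases "y = 0")
  case False
  have "\<iota> (x / y) * \<iota> y = \<iota> x" using False by (simp flip: \<iota>_mult)
  then show ?thesis using False by (simp add: eq_divide_eq \<iota>_eq_0_iff)
qed simp

text \<open>
  Normalise one coefficient of the relation to \<open>1\<close> and differentiate: this gives a relation with fewer
  non-zero coefficients, unless all coefficients are constants already.
\<close>

lemma constant_relation_of_relation:
  assumes "finite I" and c: "\<And>i. i \<in> I \<Longrightarrow> der (c i) = 0"
    and "(\<Sum>i\<in>I. c i * \<iota> (g i)) = 0" and "\<exists>i\<in>I. g i \<noteq> 0"
  shows "\<exists>a. (\<forall>i\<in>I. der (a i) = 0) \<and> (\<exists>i\<in>I. a i \<noteq> 0) \<and> (\<Sum>i\<in>I. c i * \<iota> (a i)) = 0"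
  using assms(3,4)
proof (induction "card {i\<in>I. g i \<noteq> 0}" arbitrary: g rule: less_induct)
  case less
  obtain s where s: "s \<in> I" "g s \<noteq> 0" using less.prems by blast
  define h where "h i = g i / g s" for i
  have h: "(\<Sum>i\<in>I. c i * \<iota> (h i)) = 0"
    using less.prems(1) by (simp add: h_def \<iota>_divide sum_divide_distrib[symmetric])
  have "der (\<Sum>i\<in>I. c i * \<iota> (h i)) = (\<Sum>i\<in>I. c i * \<iota> (der (h i)))"
    unfolding der_sum by (rule sum.cong) (simp_all add: der_mult c \<iota>_der)
  then have dh: "(\<Sum>i\<in>I. c i * \<iota> (der (h i))) = 0" by (simp add: h)
  show ?case
  proof (cases "\<exists>i\<in>I. der (h i) \<noteq> 0")
    case True
    have "{i\<in>I. der (h i) \<noteq> 0} \<subseteq> {i\<in>I. g i \<noteq> 0} - {s}"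
      using s by (auto simp: h_def)
    then have "{i\<in>I. der (h i) \<noteq> 0} \<subset> {i\<in>I. g i \<noteq> 0}" using s by blast
    then have "card {i\<in>I. der (h i) \<noteq> 0} < card {i\<in>I. g i \<noteq> 0}"
      using assms(1) by (intro psubset_card_mono) auto
    then show ?thesis using less.hyps[of "\<lambda>i. der (h i)"] dh True by blast
  next
    case False
    then show ?thesis using h s by (intro exI[of _ h]) (auto simp: h_def)
  qed
qed

text \<open>
  Differentiating the sum gives a relation between the \<open>c i\<close> over \<open>'k\<close>, which is trivial if all \<open>f i\<close> are
  constants and otherwise yields a relation with constant coefficients.  The latter eliminates one of
  the \<open>c i\<close> from the sum.
\<close>

lemma constant_in_span_of_constants:
  assumes Cb: "sring Cb" "\<And>c. c \<in> Cb \<Longrightarrow> der c = 0" "\<And>a. der a = 0 \<Longrightarrow> \<iota> a \<in> Cb"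
    and "finite I" "\<And>i. i \<in> I \<Longrightarrow> c i \<in> Cb" "der (\<Sum>i\<in>I. c i * \<iota> (f i)) = 0"
  shows "(\<Sum>i\<in>I. c i * \<iota> (f i)) \<in> Cb"
  using assms(4-)
proof (induction "card I" arbitrary: I f rule: less_induct)
  case less
  show ?case
  proof (cases "\<forall>i\<in>I. der (f i) = 0")
    case True
    then show ?thesis using less.prems Cb by (intro sring_sum sring_mult) auto
  next
    case False
    have "der (\<Sum>i\<in>I. c i * \<iota> (f i)) = (\<Sum>i\<in>I. c i * \<iota> (der (f i)))"
      unfolding der_sum by (rule sum.cong) (use less.prems Cb in \<open>simp_all add: der_mult \<iota>_der\<close>)
    then have "(\<Sum>i\<in>I. c i * \<iota> (der (f i))) = 0" using less.prems by simp
    then obtain a s where a: "\<forall>i\<in>I. der (a i) = 0" "s \<in> I" "a s \<noteq> 0" "(\<Sum>i\<in>I. c i * \<iota> (a i)) = 0"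
      using constant_relation_of_relation[OF less.prems(1), of c "\<lambda>i. der (f i)"] less.prems Cb False by blast
    have "c s * \<iota> (a s) + (\<Sum>i\<in>I - {s}. c i * \<iota> (a i)) = 0"
      using a less.prems(1) by (simp add: sum.remove[of I s])
    then have cs: "c s = - (\<Sum>i\<in>I - {s}. c i * \<iota> (a i)) / \<iota> (a s)"
      using a(3) by (metis \<iota>_eq_0_iff add_eq_0_iff2 nonzero_mult_div_cancel_right)
    have eq: "(\<Sum>i\<in>I. c i * \<iota> (f i)) = (\<Sum>i\<in>I - {s}. c i * \<iota> (f i - a i / a s * f s))"
    proof -
      have "(\<Sum>i\<in>I. c i * \<iota> (f i)) = c s * \<iota> (f s) + (\<Sum>i\<in>I - {s}. c i * \<iota> (f i))"
        using a less.prems(1) by (simp add: sum.remove[of I s])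
      also have "c s * \<iota> (f s) = - (\<Sum>i\<in>I - {s}. c i * (\<iota> (a i) / \<iota> (a s) * \<iota> (f s)))"
        by (simp add: cs sum_divide_distrib sum_distrib_right mult.assoc)
      finally show ?thesis
        by (simp add: \<iota>_diff \<iota>_mult \<iota>_divide right_diff_distrib sum_subtractf)
    qed
    have "card (I - {s}) < card I" using a less.prems(1) by (meson card_Diff1_less)
    from less.hyps[OF this, of "\<lambda>i. f i - a i / a s * f s"] show ?thesis
      using less.prems eq by simp
  qed
qed

end

text \<open>
  The constants of \<open>\<C>b \<otimes> \<K>\<close>, where \<open>\<C>b\<close> is the algebraic closure of the constants of \<open>\<K>\<close>, are those of
  \<open>\<C>b\<close>.  That the tensor product is a differential field follows from the existence of its Picard-Vessiot
  subextensions.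
\<close>

lemma linear_closure_base:
  fixes \<iota> :: "'k::diff_field \<Rightarrow> 'l::diff_field"
  assumes "linear_closure \<iota>"
  obtains E M where "sfield E" "\<And>x. x \<in> E \<Longrightarrow> der x \<in> E" "range \<iota> \<subseteq> E"
    "\<And>p. p \<in> polys {x \<in> E. der x = 0} \<Longrightarrow> degree p > 0 \<Longrightarrow> \<exists>x\<in>E. der x = 0 \<and> poly p x = 0"
    "pv_complete E M"
proof -
  obtain Cb Ks where emb: "diff_embedding \<iota>" and Cb: "Cb \<subseteq> {c. der c = 0}"
    "algebraic_closure (restrict_field Cb) (\<iota> ` {c. der c = 0})" "internal_tensor \<iota> Cb (Ks 0)"
    and pv: "\<And>i::nat. pv_compositum (Ks i) (Ks (Suc i))"
    using assms unfolding linear_closure_def by blast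
  interpret diff_extension \<iota> by unfold_locales (rule emb)
  define E where "E = Ks 0"
  have pvc: "pv_complete E (Ks (Suc 0))" using pv[of 0] by (simp add: pv_compositum_def E_def)
  then have "field (restrict_field (Ks (Suc 0)))" by (simp add: pv_complete_def diff_field_on_def)
  then have "0 \<in> Ks (Suc 0)" using sfield_of_restrict_field by (auto simp: sfield_def intro: sring_0)
  then obtain F where "picard_vessiot (restrict_field E) der id (restrict_field F) der"
    using pvc unfolding pv_complete_def by blast
  then have dE: "diff_field_on (restrict_field E) der"
    unfolding picard_vessiot_def picard_vessiot_wrt_def by blast
  then have 1: "sfield E" by (simp add: diff_field_on_def sfield_of_restrict_field)
  have 2: "der x \<in> E" if "x \<in> E" for x
    using dE that by (auto simp: diff_field_on_def restrict_field_def)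
  have E_eq: "E = {\<Sum>i<n. c i * \<iota> (f i) | (n::nat) c f. \<forall>i<n. c i \<in> Cb}"
    using Cb(3) by (simp add: internal_tensor_def E_def)
  interpret A: algebraic_closure "restrict_field Cb" "\<iota> ` {c. der c = 0}" by (rule Cb(2))
  have "sfield Cb" by (rule sfield_of_restrict_field[OF A.field_axioms])
  then have sCb: "sring Cb" by (simp add: sfield_def)
  have \<iota>Cb: "\<iota> a \<in> Cb" if "der a = 0" for a
    using A.subset that by (auto simp: restrict_field_def)
  have 3: "range \<iota> \<subseteq> E"
  proof safe
    fix x
    have "\<iota> x = (\<Sum>i<Suc 0. 1 * \<iota> x)" by simp
    then show "\<iota> x \<in> E"
      unfolding E_eq using sring_1[OF sCb] by (intro CollectI exI[of _ "Suc 0"] exI[of _ "\<lambda>_. 1"] exI[of _ "\<lambda>_. x"]) simp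
  qed
  have "Cb \<subseteq> E"
  proof
    fix c assume c: "c \<in> Cb"
    have "c = (\<Sum>i<Suc 0. c * \<iota> 1)" by simp
    then show "c \<in> E"
      unfolding E_eq using c by (intro CollectI exI[of _ "Suc 0"] exI[of _ "\<lambda>_. c"] exI[of _ "\<lambda>_. 1"]) simp
  qed
  moreover have "x \<in> Cb" if x: "x \<in> E" "der x = 0" for x
  proof -
    obtain n :: nat and c f where "x = (\<Sum>i<n. c i * \<iota> (f i))" "\<forall>i<n. c i \<in> Cb" using x unfolding E_eq by blast
    then show ?thesis using constant_in_span_of_constants[OF sCb, of "{..<n}" c f] Cb(1) \<iota>Cb x by auto
  qed
  ultimately have Cb_eq: "{x \<in> E. der x = 0} = Cb" using Cb(1) by auto
  have 4: "\<exists>x\<in>E. der x = 0 \<and> poly p x = 0" if "p \<in> polys {x \<in> E. der x = 0}" "degree p > 0" for p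
    using root_in_algebraic_closure[OF Cb(2), of p] that unfolding Cb_eq using Cb_eq by blast
  show ?thesis by (rule that[OF 1 2 3 4 pvc])
qed

section \<open>Taylor series\<close>

instantiation fls :: (field_char_0) diff_field
begin

definition "der_fls = (fls_deriv :: 'a fls \<Rightarrow> 'a fls)"

instance by standard (simp_all add: der_fls_def)

end

text \<open>
  For \<open>\<psi>\<close> the embedding into the algebraic closure this embeds the whole differential field; for a
  homomorphism \<open>\<psi>\<close> on a subring it is the Taylor expansion at the point \<open>\<psi>\<close>.  Values in Laurent
  series are used because they form a field.
\<close>

definition taylor :: "('f::diff_field \<Rightarrow> 'o::field_char_0) \<Rightarrow> 'f \<Rightarrow> 'o fls" where
  "taylor \<psi> x = fps_to_fls (Abs_fps (\<lambda>n. \<psi> ((der ^^ n) x) / fact n))"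

lemma taylor_nth: "fls_nth (taylor \<psi> x) (int n) = \<psi> ((der ^^ n) x) / fact n"
  by (simp add: taylor_def)

lemma taylor_nth_0: "fls_nth (taylor \<psi> x) 0 = \<psi> x"
  using taylor_nth[of \<psi> x 0] by simp

lemma der_taylor: "der (taylor \<psi> x) = taylor \<psi> (der x)"
proof -
  have "fps_deriv (Abs_fps (\<lambda>n. \<psi> ((der ^^ n) x) / fact n)) = Abs_fps (\<lambda>n. \<psi> ((der ^^ n) (der x)) / fact n)"
    by (rule fps_ext) (simp add: funpow_swap1 field_simps del: of_nat_Suc)
  then show ?thesis by (simp add: taylor_def der_fls_def fls_deriv_fps_to_fls)
qed

lemma der_pow_taylor: "(der ^^ n) (taylor \<psi> x) = taylor \<psi> ((der ^^ n) x)"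
  by (induction n) (simp_all add: der_taylor)

lemma taylor_const: "der c = 0 \<Longrightarrow> \<psi> 0 = 0 \<Longrightarrow> taylor \<psi> c = fls_const (\<psi> c)"
proof -
  assume c: "der c = 0" "\<psi> 0 = 0"
  have "(der ^^ n) c = (if n = 0 then c else 0)" for n
    by (induction n) (auto simp: c)
  then have "Abs_fps (\<lambda>n. \<psi> ((der ^^ n) c) / fact n) = fps_const (\<psi> c)"
    using c by (intro fps_ext) auto
  then show ?thesis by (simp add: taylor_def)
qed

lemma der_pow_in: "(\<And>x. x \<in> S \<Longrightarrow> der x \<in> S) \<Longrightarrow> x \<in> S \<Longrightarrow> (der ^^ n) x \<in> S"
  by (induction n) auto

text \<open>
  Instead of Leibniz' formula for higher derivatives, the coefficients of both sides of
  \<open>T (x * y) = T x * T y\<close> are compared by induction through the derivatives of both sides.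
\<close>

lemma hom_on_taylor:
  assumes S: "sring S" "\<And>x. x \<in> S \<Longrightarrow> der x \<in> S" and \<psi>: "hom_on S \<psi>"
  shows "hom_on S (taylor \<psi>)"
  unfolding hom_on_def
proof (intro conjI ballI)
  show "taylor \<psi> 1 = 1" using taylor_const[of 1 \<psi>] hom_on_0[OF S(1) \<psi>] hom_on_1[OF S(1) \<psi>] by simp
next
  define T where "T x = Abs_fps (\<lambda>n. \<psi> ((der ^^ n) x) / fact n)" for x
  have T: "taylor \<psi> x = fps_to_fls (T x)" for x by (simp add: T_def taylor_def)
  have T_add: "T (x + y) = T x + T y" if "x \<in> S" "y \<in> S" for x y
    by (rule fps_ext) (simp add: T_def der_pow_add hom_on_add[OF S(1) \<psi>] der_pow_in[OF S(2)] that add_divide_distrib)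
  have T_der: "fps_deriv (T x) = T (der x)" for x
    by (rule fps_ext) (simp add: T_def funpow_swap1 field_simps del: of_nat_Suc)
  have "T (x * y) $ n = (T x * T y) $ n" if "x \<in> S" "y \<in> S" for x y n
    using that
  proof (induction n arbitrary: x y)
    case 0
    then show ?case by (simp add: T_def hom_on_mult[OF S(1) \<psi>])
  next
    case (Suc n)
    have "of_nat (Suc n) * T (x * y) $ Suc n = fps_deriv (T (x * y)) $ n" by simp
    also have "\<dots> = T (der x * y) $ n + T (x * der y) $ n"
      using Suc.prems by (simp add: T_der der_mult T_add S sring_mult)
    also have "\<dots> = (T (der x) * T y) $ n + (T x * T (der y)) $ n"
      using Suc.IH[of "der x" y] Suc.IH[of x "der y"] Suc.prems S(2) by simp
    also have "\<dots> = fps_deriv (T x * T y) $ n" by (simp add: T_der add.commute)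
    also have "\<dots> = of_nat (Suc n) * (T x * T y) $ Suc n" by (simp only: fps_deriv_nth Suc_eq_plus1)
    finally show ?case by (rule mult_left_cancel[THEN iffD1, OF of_nat_neq_0])
  qed
  then have T_mult: "T (x * y) = T x * T y" if "x \<in> S" "y \<in> S" for x y
    using that by (intro fps_ext) blast
  fix x y assume "x \<in> S" "y \<in> S"
  then show "taylor \<psi> (x + y) = taylor \<psi> x + taylor \<psi> y" "taylor \<psi> (x * y) = taylor \<psi> x * taylor \<psi> y"
    by (simp_all add: T T_add T_mult fls_times_fps_to_fls)
qed

subsection \<open>Power series solutions of linear differential equations\<close>

text \<open>
  The value at \<open>0\<close> of the \<open>N\<close>-th derivative of the solution of \<open>y\<^sup>(\<^sup>m\<^sup>) = \<Sum> B j * y\<^sup>(\<^sup>j\<^sup>)\<close> with initial values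
  \<open>p\<close>, read off from the equation for the coefficient of degree \<open>N - m\<close>.
\<close>

function ode_coeff :: "nat \<Rightarrow> (nat \<Rightarrow> 'o::field_char_0 fps) \<Rightarrow> (nat \<Rightarrow> 'o) \<Rightarrow> nat \<Rightarrow> 'o" where
  "ode_coeff m B p N = (if N < m then p N else fact (N - m) *
     (\<Sum>j<m. \<Sum>i\<in>{0..N - m}. B j $ i * (ode_coeff m B p (N - m - i + j) / fact (N - m - i))))"
  by pat_completeness auto
termination by (relation "measure (\<lambda>(m, B, p, N). N)") auto

declare ode_coeff.simps [simp del]

lemma ex_fps_ode_solution:
  fixes B :: "nat \<Rightarrow> 'o::field_char_0 fps"
  shows "\<exists>y. (\<forall>j<m. (fps_deriv ^^ j) y $ 0 = p j) \<and> (fps_deriv ^^ m) y = (\<Sum>j<m. B j * (fps_deriv ^^ j) y)"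
proof -
  define w where "w = ode_coeff m B p"
  define y where "y = Abs_fps (\<lambda>n. w n / fact n)"
  have y: "(fps_deriv ^^ j) y $ n = w (n + j) / fact n" for j n
  proof (induction j arbitrary: n)
    case (Suc j)
    have "(fps_deriv ^^ Suc j) y $ n = of_nat (Suc n) * (fps_deriv ^^ j) y $ Suc n" by simp
    also have "\<dots> = w (n + Suc j) / fact n" unfolding Suc by (simp del: of_nat_Suc)
    finally show ?case .
  qed (simp add: y_def)
  have "(fps_deriv ^^ m) y $ n = (\<Sum>j<m. B j * (fps_deriv ^^ j) y) $ n" for n
  proof -
    have "w (n + m) = fact n * (\<Sum>j<m. \<Sum>i\<in>{0..n}. B j $ i * (w (n - i + j) / fact (n - i)))"
      unfolding w_def by (subst ode_coeff.simps) simp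
    then show ?thesis by (simp add: y fps_sum_nth fps_mult_nth)
  qed
  moreover have "(fps_deriv ^^ j) y $ 0 = p j" if "j < m" for j
    using that by (simp add: y) (simp add: w_def ode_coeff.simps)
  ultimately show ?thesis by (intro exI[of _ y]) (auto intro: fps_ext)
qed

section \<open>Wronskians and fundamental systems\<close>

text \<open>
  The determinant is a polynomial with integer coefficients in the entries.
\<close>

lemma det_in_hom:
  assumes S: "sring S" "hom_on S \<theta>" and f: "\<And>i j. i < m \<Longrightarrow> j < m \<Longrightarrow> f i j \<in> S"
  shows "Determinant.det (Matrix.mat m m (\<lambda>(i, j). f i j)) \<in> S"
    and "\<theta> (Determinant.det (Matrix.mat m m (\<lambda>(i, j). f i j))) = Determinant.det (Matrix.mat m m (\<lambda>(i, j). \<theta> (f i j)))"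
proof -
  have det: "Determinant.det (Matrix.mat m m (\<lambda>(i, j). g i j))
      = (\<Sum>p | p permutes {0..<m}. signof p * (\<Prod>i = 0..<m. g i (p i)))" for g :: "_ \<Rightarrow> _ \<Rightarrow> 'x::comm_ring_1"
  proof -
    have "(\<Prod>i = 0..<m. index_mat (Matrix.mat m m (\<lambda>(i, j). g i j)) (i, p i)) = (\<Prod>i = 0..<m. g i (p i))"
      if "p permutes {0..<m}" for p
      by (rule prod.cong) (use that permutes_in_image[of p "{0..<m}"] in auto)
    then show ?thesis by (simp add: Determinant.det_def)
  qed
  have sgn: "signof p \<in> S" "\<theta> (signof p) = signof p" for p :: "nat \<Rightarrow> nat"
    using sring_1[OF S(1)] by (auto simp: sign_def sring_minus[OF S(1)] hom_on_minus[OF S] hom_on_1[OF S])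
  have fp: "f i (p i) \<in> S" if "p permutes {0..<m}" "i \<in> {0..<m}" for p i
    using that permutes_in_image[of p "{0..<m}" i] by (intro f) auto
  have P: "signof p * (\<Prod>i = 0..<m. f i (p i)) \<in> S" if "p permutes {0..<m}" for p
    by (intro sring_mult[OF S(1)] sring_prod[OF S(1)] sgn fp that)
  show "Determinant.det (Matrix.mat m m (\<lambda>(i, j). f i j)) \<in> S"
    unfolding det using P by (intro sring_sum[OF S(1)]) auto
  have "\<theta> (signof p * (\<Prod>i = 0..<m. f i (p i))) = signof p * (\<Prod>i = 0..<m. \<theta> (f i (p i)))" if "p permutes {0..<m}" for p
  proof -
    have "(\<Prod>i = 0..<m. f i (p i)) \<in> S" by (rule sring_prod[OF S(1) fp[OF that]])
    then have "\<theta> (signof p * (\<Prod>i = 0..<m. f i (p i))) = \<theta> (signof p) * \<theta> (\<Prod>i = 0..<m. f i (p i))"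
      by (rule hom_on_mult[OF S sgn(1)])
    also have "\<theta> (\<Prod>i = 0..<m. f i (p i)) = (\<Prod>i = 0..<m. \<theta> (f i (p i)))"
      by (rule hom_on_prod[OF S fp[OF that]])
    finally show ?thesis by (simp only: sgn)
  qed
  then show "\<theta> (Determinant.det (Matrix.mat m m (\<lambda>(i, j). f i j))) = Determinant.det (Matrix.mat m m (\<lambda>(i, j). \<theta> (f i j)))"
    unfolding det using P by (subst hom_on_sum[OF S]) auto
qed

definition wronskian :: "nat \<Rightarrow> (nat \<Rightarrow> 'f::diff_field) \<Rightarrow> 'f" where
  "wronskian m Y = Determinant.det (Matrix.mat m m (\<lambda>(j, i). (der ^^ j) (Y i)))"

lemma der_pow_const_mult: "der c = 0 \<Longrightarrow> (der ^^ j) (c * x) = c * (der ^^ j) (x :: 'a::diff_field)"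
  by (induction j) (simp_all add: der_mult)

lemma der_pow_sum: "(der ^^ j) (sum f A) = (\<Sum>x\<in>A. (der ^^ j) (f x :: 'a::diff_field))"
  by (induction A rule: infinite_finite_induct) (simp_all add: der_pow_add)

text \<open>
  A relation with constant coefficients may be differentiated, so its coefficients form a vector in the
  kernel of the Wronskian matrix.
\<close>

lemma wronskian_independent:
  assumes W: "wronskian m Y \<noteq> 0" and c: "\<And>i. i < m \<Longrightarrow> der (c i) = 0" and rel: "(\<Sum>i<m. c i * Y i) = 0"
    and i: "i < m"
  shows "c i = 0"
proof -
  define M where "M = Matrix.mat m m (\<lambda>(j, i). (der ^^ j) (Y i))"
  have M: "M \<in> carrier_mat m m" by (simp add: M_def)
  define v where "v = Matrix.vec m c"
  have "(\<Sum>i<m. (der ^^ j) (Y i) * c i) = 0" for j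
  proof -
    have "(der ^^ j) (Y i) * c i = (der ^^ j) (c i * Y i)" if "i < m" for i
      unfolding der_pow_const_mult[OF c[OF that]] by (rule mult.commute)
    then have "(\<Sum>i<m. (der ^^ j) (Y i) * c i) = (der ^^ j) (\<Sum>i<m. c i * Y i)"
      unfolding der_pow_sum by (intro sum.cong) simp_all
    then show ?thesis by (simp add: rel)
  qed
  then have "M *\<^sub>v v = 0\<^sub>v m"
    by (intro eq_vecI) (simp_all add: M_def v_def scalar_prod_def lessThan_atLeast0)
  moreover have "Determinant.det M \<noteq> 0" using W by (simp add: wronskian_def M_def)
  moreover have "v \<in> carrier_vec m" by (simp add: v_def)
  ultimately have "v = 0\<^sub>v m" using det_0_iff_vec_prod_zero_field[OF M] by blast
  then have "vec_index v i = vec_index (0\<^sub>v m) i" by simp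
  then show ?thesis using i by (simp add: v_def)
qed

lemma der_pow_fps_to_fls: "(der ^^ j) (fps_to_fls f) = fps_to_fls ((fps_deriv ^^ j) f)"
  by (induction j) (simp_all add: der_fls_def fls_deriv_fps_to_fls)

lemma fps_to_fls_sum: "fps_to_fls (sum f A) = (\<Sum>x\<in>A. fps_to_fls (f x))"
  by (induction A rule: infinite_finite_induct) simp_all

lemma sring_range_fps_to_fls: "sring (range (fps_to_fls :: 'o::comm_ring_1 fps \<Rightarrow> 'o fls))"
  unfolding sring_def
  by (auto simp flip: fps_to_fls_minus fls_times_fps_to_fls intro: range_eqI[of _ _ 1])

lemma hom_on_fls_nth_0: "hom_on (range (fps_to_fls :: 'o::comm_ring_1 fps \<Rightarrow> 'o fls)) (\<lambda>x. fls_nth x 0)"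
  unfolding hom_on_def by (auto simp flip: fls_times_fps_to_fls)

text \<open>
  With the unit vectors as initial values, the Wronskian has constant term \<open>1\<close>.
\<close>

lemma ex_fundamental_system:
  fixes B :: "nat \<Rightarrow> 'o::field_char_0 fps"
  shows "\<exists>Y. (\<forall>i<m. (der ^^ m) (Y i) = (\<Sum>j<m. fps_to_fls (B j) * (der ^^ j) (Y i))) \<and> wronskian m Y \<noteq> 0"
proof -
  have "\<forall>i. \<exists>y. (\<forall>j<m. (fps_deriv ^^ j) y $ 0 = (if j = i then 1 else 0))
      \<and> (fps_deriv ^^ m) y = (\<Sum>j<m. B j * (fps_deriv ^^ j) y)"
    by (intro allI ex_fps_ode_solution)
  from choice[OF this] obtain y where y_all:
    "\<forall>i. (\<forall>j<m. (fps_deriv ^^ j) (y i) $ 0 = (if j = i then 1 else 0))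
      \<and> (fps_deriv ^^ m) (y i) = (\<Sum>j<m. B j * (fps_deriv ^^ j) (y i))" ..
  have y0: "(fps_deriv ^^ j) (y i) $ 0 = (if j = i then 1 else 0)" if "j < m" for i j
    using y_all that by blast
  have y: "(fps_deriv ^^ m) (y i) = (\<Sum>j<m. B j * (fps_deriv ^^ j) (y i))" for i
    using y_all by blast
  define Y where "Y i = fps_to_fls (y i)" for i
  have "(der ^^ m) (Y i) = (\<Sum>j<m. fps_to_fls (B j) * (der ^^ j) (Y i))" for i
    by (simp add: Y_def der_pow_fps_to_fls y fps_to_fls_sum fls_times_fps_to_fls)
  moreover have "wronskian m Y \<noteq> 0"
  proof -
    have "fls_nth (wronskian m Y) 0 = Determinant.det (Matrix.mat m m (\<lambda>(j, i). fls_nth ((der ^^ j) (Y i)) 0))"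
      unfolding wronskian_def
      by (rule det_in_hom(2)[OF sring_range_fps_to_fls hom_on_fls_nth_0]) (simp add: Y_def der_pow_fps_to_fls)
    also have "Matrix.mat m m (\<lambda>(j, i). fls_nth ((der ^^ j) (Y i)) 0) = 1\<^sub>m m"
      by (rule eq_matI) (auto simp: Y_def der_pow_fps_to_fls y0)
    finally show ?thesis by auto
  qed
  ultimately show ?thesis by (intro exI[of _ Y]) blast
qed

section \<open>Algebraic independence\<close>

text \<open>
  Algebraic independence over \<open>A\<close>, in a form that involves only polynomials in one variable: every
  entry is transcendental over the ring generated by \<open>A\<close> and the earlier entries.
\<close>

primrec indep :: "'f::field set \<Rightarrow> 'f list \<Rightarrow> bool" where
  "indep A [] = True"
| "indep A (x # xs) = (\<not> alg_over A x \<and> indep (adjoin A x) xs)"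

lemma indep_snoc: "indep A (xs @ [x]) \<longleftrightarrow> indep A xs \<and> \<not> alg_over (adjoins A xs) x"
  by (induction xs arbitrary: A) auto

lemma indep_disjoint: "sring A \<Longrightarrow> indep A xs \<Longrightarrow> set xs \<inter> A = {}"
proof (induction xs arbitrary: A)
  case (Cons x xs)
  then have "set xs \<inter> adjoin A x = {}" using sring_adjoin by (metis indep.simps(2))
  moreover have "x \<notin> A" using Cons.prems alg_over_self by auto
  ultimately show ?case using subset_adjoin[OF Cons.prems(1), of x] by auto
qed simp

lemma indep_distinct: "sring A \<Longrightarrow> indep A xs \<Longrightarrow> distinct xs"
proof (induction xs arbitrary: A)
  case (Cons x xs)
  then have "x \<notin> set xs"
    using indep_disjoint[OF sring_adjoin[OF Cons.prems(1)], of x xs] in_adjoin[OF Cons.prems(1), of x] by auto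
  then show ?case using Cons sring_adjoin by auto
qed simp

text \<open>
  A homomorphism that is injective on \<open>A\<close> maps non-trivial relations over \<open>A\<close> to non-trivial ones, so independence of the
  images implies independence, and \<open>\<theta>\<close> stays injective on the ring generated by \<open>A\<close> and \<open>xs\<close>.  The second
  fact carries the induction; it is also what contradicts a specialization that kills an
  element algebraic over that ring.
\<close>

lemma indep_of_image:
  assumes S: "sring S" "hom_on S \<theta>"
    and "sring A" "A \<subseteq> S" "set xs \<subseteq> S" "\<And>x. x \<in> A \<Longrightarrow> \<theta> x = 0 \<Longrightarrow> x = 0" "indep (\<theta> ` A) (map \<theta> xs)"
  shows "indep A xs \<and> (\<forall>x\<in>adjoins A xs. \<theta> x = 0 \<longrightarrow> x = 0)"
  using assms(3-)
proof (induction xs arbitrary: A)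
  case Nil
  then show ?case by simp
next
  case (Cons x xs)
  have A: "hom_on A \<theta>" using hom_on_subset[OF S(2) Cons.prems(2)] .
  have x: "x \<in> S" using Cons.prems by simp
  have nz: "p = 0" if "p \<in> polys A" "map_poly \<theta> p = 0" for p
  proof (rule poly_eqI)
    fix i
    have "\<theta> (coeff p i) = 0" using arg_cong[OF that(2), of "\<lambda>p. coeff p i"]
      by (simp add: coeff_map_hom[OF Cons.prems(1) A])
    then show "coeff p i = coeff 0 i" using Cons.prems(4)[OF coeff_in[OF that(1)]] by simp
  qed
  have ev: "poly (map_poly \<theta> p) (\<theta> x) = \<theta> (poly p x)" if "p \<in> polys A" for p
    using poly_map_hom[OF S, of p x] that polys_mono[OF Cons.prems(2)] x by auto
  have zero: "p = 0" if p: "p \<in> polys A" "\<theta> (poly p x) = 0" for p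
  proof (rule nz[OF p(1)], rule ccontr)
    assume "map_poly \<theta> p \<noteq> 0"
    then have "alg_over (\<theta> ` A) (\<theta> x)"
      using map_hom_in[OF Cons.prems(1) A p(1)] ev[OF p(1)] p(2) unfolding alg_over_def by metis
    then show False using Cons.prems(5) by simp
  qed
  have "\<not> alg_over A x"
    using zero hom_on_0[OF S] by (auto simp: alg_over_def)
  moreover have "indep (adjoin A x) xs \<and> (\<forall>x\<in>adjoins (adjoin A x) xs. \<theta> x = 0 \<longrightarrow> x = 0)"
  proof (rule Cons.IH)
    show "sring (adjoin A x)" by (rule sring_adjoin[OF Cons.prems(1)])
    show "adjoin A x \<subseteq> S" by (rule adjoin_least[OF S(1) Cons.prems(2) x])
    show "set xs \<subseteq> S" using Cons.prems by simp
    show "indep (\<theta> ` adjoin A x) (map \<theta> xs)"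
      using Cons.prems by (simp add: image_adjoin[OF S Cons.prems(1,2) x])
    show "y = 0" if y: "y \<in> adjoin A x" "\<theta> y = 0" for y
    proof -
      obtain p where p: "p \<in> polys A" "y = poly p x" using y(1) unfolding adjoin_def by blast
      then have "p = 0" using zero y(2) by blast
      then show ?thesis using p by simp
    qed
  qed
  ultimately show ?case by simp
qed

section \<open>Algebraic constants\<close>

lemma der_poly_const:
  fixes c :: "'f::diff_field"
  assumes "der c = 0" shows "der (poly p c) = poly (map_poly der p) c"
proof (induction p)
  case (pCons a p)
  have "map_poly der (pCons a p) = pCons (der a) (map_poly der p)"
    by (rule poly_eqI) (simp add: coeff_map_poly coeff_pCons split: nat.splits)
  then show ?case using pCons assms by (simp add: der_add der_mult)
qed simp

text \<open>
  Differentiating the monic minimal polynomial of \<open>c\<close> coefficientwise gives a polynomial of smaller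
  degree that vanishes at \<open>c\<close>.  So the minimal polynomial has constant coefficients, and it splits off a
  linear factor because the constants are algebraically closed.
\<close>

lemma algebraic_constant:
  fixes K :: "'f::diff_field set"
  assumes K: "sfield K" "\<And>x. x \<in> K \<Longrightarrow> der x \<in> K"
    and closed: "\<And>p. p \<in> polys {x \<in> K. der x = 0} \<Longrightarrow> degree p > 0 \<Longrightarrow> \<exists>x\<in>K. der x = 0 \<and> poly p x = 0"
    and c: "der c = 0" "alg_over K c"
  shows "c \<in> K"
proof -
  have sK: "sring K" using K by (simp add: sfield_def)
  obtain q where q: "q \<in> polys K \<and> q \<noteq> 0 \<and> poly q c = 0 \<and>
    (\<forall>p. p \<in> polys K \<longrightarrow> p \<noteq> 0 \<longrightarrow> poly p c = 0 \<longrightarrow> degree q \<le> degree p)"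
    by (rule exE[OF minimal_poly[OF c(2)]])
  define r where "r = smult (inverse (lead_coeff q)) q"
  have r: "r \<in> polys K" "r \<noteq> 0" "poly r c = 0" "degree r = degree q" "lead_coeff r = 1"
    using q K(1) unfolding r_def by (auto simp: sfield_def intro!: polys_smult[OF sK] intro: coeff_in)
  have min: "p = 0" if "p \<in> polys K" "poly p c = 0" "degree p < degree r \<or> degree p = 0" for p
  proof (rule ccontr)
    assume "p \<noteq> 0"
    with q that have "degree q \<le> degree p" by blast
    with that r have "degree p = 0" by auto
    then obtain a where "p = [:a:]" by (rule degree_eq_zeroE)
    with that \<open>p \<noteq> 0\<close> show False by simp
  qed
  have degr: "degree r > 0" using min[of r] r by auto
  have "map_poly der r = 0"
  proof (rule min)
    show "map_poly der r \<in> polys K" using r(1) K(2) by (auto simp: polys_def coeff_map_poly)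
    show "poly (map_poly der r) c = 0" using der_poly_const[OF c(1), of r] r(3) by simp
    have "coeff (map_poly der r) (degree r) = 0" using r(5) by (simp add: coeff_map_poly)
    then show "degree (map_poly der r) < degree r \<or> degree (map_poly der r) = 0"
      using degree_map_poly_der[of r] by (metis degree_0 le_neq_implies_less leading_coeff_0_iff)
  qed
  then have "der (coeff r i) = 0" for i
    using arg_cong[of _ _ "\<lambda>p. coeff p i"] by (simp add: coeff_map_poly)
      (metis coeff_0 coeff_map_poly der_0)
  then have "r \<in> polys {x \<in> K. der x = 0}" using r(1) by (auto simp: polys_def)
  then obtain x where x: "x \<in> K" "poly r x = 0" using closed degr by blast
  have l: "[:- x, 1:] \<in> polys K" using x sK by (auto intro!: polys_pCons sring_minus sring_1)
  obtain N s t where s: "s \<in> polys K" "t \<in> polys K"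
    "smult (lead_coeff [:- x, 1:] ^ N) r = [:- x, 1:] * s + t" "t = 0 \<or> degree t < degree [:- x, 1:]"
    using poly_pseudo_division[OF sK l _ r(1)] by auto
  then have rs: "r = [:- x, 1:] * s + t" by simp
  have "t = 0"
  proof (rule ccontr)
    assume "t \<noteq> 0"
    then have "degree t = 0" using s(4) by simp
    then obtain a where "t = [:a:]" by (rule degree_eq_zeroE)
    moreover have "poly t x = 0" using arg_cong[OF rs, of "\<lambda>p. poly p x"] x by simp
    ultimately show False using \<open>t \<noteq> 0\<close> by simp
  qed
  then have r_eq: "r = [:- x, 1:] * s" using rs by simp
  then have "s \<noteq> 0" using r(2) by auto
  have "degree r = Suc (degree s)" unfolding r_eq using \<open>s \<noteq> 0\<close> by (subst degree_mult_eq) simp_all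
  then have "poly s c \<noteq> 0" using min[OF s(1)] \<open>s \<noteq> 0\<close> by auto
  moreover have "(c - x) * poly s c = 0" using r(3) by (simp add: r_eq algebra_simps)
  ultimately show ?thesis using x by simp
qed

section \<open>Fundamental systems without new constants\<close>

text \<open>
  The equation is \<open>y\<^sup>(\<^sup>m\<^sup>) = \<Sum> b j * y\<^sup>(\<^sup>j\<^sup>)\<close> over a differential field \<open>E\<close> with algebraically closed constants.
  In the rest of this section, \<open>A\<close> is the image of \<open>E\<close> under the Taylor embedding \<open>\<tau>\<close>.
\<close>

locale monic_equation =
  fixes E :: "'l::diff_field set" and m :: nat and b :: "nat \<Rightarrow> 'l"
  assumes E: "sfield E" and der_E: "x \<in> E \<Longrightarrow> der x \<in> E"
    and closed: "p \<in> polys {x \<in> E. der x = 0} \<Longrightarrow> degree p > 0 \<Longrightarrow> \<exists>x\<in>E. der x = 0 \<and> poly p x = 0"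
    and b: "j < m \<Longrightarrow> b j \<in> E" and m: "m > 0"
begin

abbreviation \<tau> :: "'l \<Rightarrow> 'l alg_closure fls" where
  "\<tau> \<equiv> taylor to_ac"

definition A :: "'l alg_closure fls set" where
  "A = \<tau> ` E"

lemma hom_to_ac: "hom_on UNIV (to_ac :: 'l \<Rightarrow> 'l alg_closure)"
  by (simp add: hom_on_def)

lemma sring_E: "sring E"
  using E by (simp add: sfield_def)

lemma sring_UNIV: "sring UNIV"
  by (simp add: sring_def)

lemma hom_\<tau>: "hom_on UNIV \<tau>"
  by (rule hom_on_taylor[OF sring_UNIV _ hom_to_ac]) simp

lemma hom_\<tau>_E: "hom_on E \<tau>"
  using hom_on_subset[OF hom_\<tau>] by simp

lemma \<tau>_eq_0: "\<tau> x = 0 \<Longrightarrow> x = 0"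
  using taylor_nth_0[of to_ac x] by simp

lemma \<tau>_mult: "\<tau> (x * y) = \<tau> x * \<tau> y" and \<tau>_1: "\<tau> 1 = 1" and \<tau>_0: "\<tau> 0 = 0"
  using hom_on_mult[OF sring_UNIV hom_\<tau>] hom_on_1[OF sring_UNIV hom_\<tau>] hom_on_0[OF sring_UNIV hom_\<tau>]
    by simp_all

lemma sfield_A: "sfield A"
  unfolding sfield_def
proof
  show "sring A" unfolding A_def by (rule sring_image[OF sring_E hom_\<tau>_E])
  show "\<forall>x\<in>A. inverse x \<in> A"
  proof
    fix x assume "x \<in> A"
    then obtain e where e: "e \<in> E" "x = \<tau> e" by (auto simp: A_def)
    have "inverse x = \<tau> (inverse e)"
    proof (cases "e = 0")
      case False
      then have "\<tau> e * \<tau> (inverse e) = 1" by (simp flip: \<tau>_mult add: \<tau>_1)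
      then show ?thesis using e by (metis inverse_unique)
    qed (simp add: e \<tau>_0)
    then show "inverse x \<in> A" using e E by (auto simp: A_def sfield_def)
  qed
qed

lemma sring_A: "sring A"
  using sfield_A by (simp add: sfield_def)

lemma der_A: "x \<in> A \<Longrightarrow> der x \<in> A"
  using der_E by (auto simp: A_def der_taylor)

lemma A_subset: "A \<subseteq> range fps_to_fls"
  by (auto simp: A_def taylor_def)

lemma constants_A: "{x \<in> A. der x = 0} = \<tau> ` {x \<in> E. der x = 0}"
  using \<tau>_eq_0 \<tau>_0 by (auto simp: A_def der_taylor)

lemma closed_A:
  assumes p: "p \<in> polys {x \<in> A. der x = 0}" "degree p > 0"
  shows "\<exists>x\<in>A. der x = 0 \<and> poly p x = 0"
proof -
  let ?C = "{x \<in> E. der x = 0}"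
  have C: "sring ?C"
    using sring_E by (auto simp: sring_def der_mult der_diff)
  have hom: "hom_on ?C \<tau>" using hom_on_subset[OF hom_\<tau>] by simp
  have "p \<in> polys (\<tau> ` ?C)" using p(1) by (simp only: constants_A)
  from polys_image[OF C hom this] obtain q where q: "q \<in> polys ?C" "p = map_poly \<tau> q" .
  have "degree q > 0" using p degree_map_hom_le[OF C hom, of q] q by simp
  then obtain x where x: "x \<in> E" "der x = 0" "poly q x = 0" using closed q by blast
  have "poly p (\<tau> x) = \<tau> (poly q x)" unfolding q(2) using poly_map_hom[OF C hom q(1), of x] x by simp
  then show ?thesis using x by (intro bexI[of _ "\<tau> x"]) (auto simp: A_def \<tau>_0 der_taylor)
qed

definition fundamental :: "(nat \<Rightarrow> 'l alg_closure fls) \<Rightarrow> bool" where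
  "fundamental Y \<longleftrightarrow> (\<forall>i<m. (der ^^ m) (Y i) = (\<Sum>j<m. \<tau> (b j) * (der ^^ j) (Y i))) \<and> wronskian m Y \<noteq> 0"

definition gens :: "(nat \<Rightarrow> 'l alg_closure fls) \<Rightarrow> 'l alg_closure fls list" where
  "gens Y = concat (map (\<lambda>i. map (\<lambda>j. (der ^^ j) (Y i)) [0..<m]) [0..<m])"

lemma set_gens: "set (gens Y) = {(der ^^ j) (Y i) | i j. i < m \<and> j < m}"
proof -
  have "set (gens Y) = (\<Union>i\<in>{..<m}. (\<lambda>j. (der ^^ j) (Y i)) ` {..<m})" by (auto simp: gens_def)
  then show ?thesis by blast
qed

lemma ex_fundamental: "\<exists>Y. fundamental Y"
  using ex_fundamental_system[of m "\<lambda>j. Abs_fps (\<lambda>n. to_ac ((der ^^ n) (b j)) / fact n)"]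
  unfolding fundamental_def taylor_def by blast

lemma der_closed:
  assumes Y: "fundamental Y" and S: "sring S" "A \<subseteq> S" "set (gens Y) \<subseteq> S" and x: "x \<in> set (gens Y)"
  shows "der x \<in> S"
proof -
  obtain i j where ij: "x = (der ^^ j) (Y i)" "i < m" "j < m" using x by (auto simp: set_gens)
  show ?thesis
  proof (cases "Suc j < m")
    case True
    then have "der x \<in> set (gens Y)" unfolding set_gens ij(1) using ij(2)
      by (intro CollectI exI[of _ i] exI[of _ "Suc j"]) simp
    then show ?thesis using S by blast
  next
    case False
    then have "Suc j = m" using ij by simp
    then have "der x = (der ^^ m) (Y i)" using ij(1) by (simp flip: \<open>Suc j = m\<close>)
    also have "\<dots> = (\<Sum>j<m. \<tau> (b j) * (der ^^ j) (Y i))" using Y ij by (simp add: fundamental_def)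
    also have "\<dots> \<in> S"
      using b ij(2) by (intro sring_sum sring_mult S(1) subsetD[OF S(2)] subsetD[OF S(3)]) (auto simp: A_def set_gens)
    finally show ?thesis .
  qed
qed

text \<open>
  The ring generated by \<open>E\<close>, a constant and the derivatives of order less than \<open>m\<close> of a fundamental system
  is closed under the derivation, because the equation expresses the derivatives of order \<open>m\<close>.
\<close>

lemma der_adjoins:
  assumes Y: "fundamental Y" and c: "der c = 0" and x: "x \<in> adjoins A (c # gens Y)"
  shows "der x \<in> adjoins A (c # gens Y)"
proof -
  define S where "S = adjoins A (c # gens Y)"
  have S: "sring S" "A \<subseteq> S" "set (c # gens Y) \<subseteq> S"
    unfolding S_def
    by (rule sring_adjoins[OF sring_A], rule subset_adjoins[OF sring_A], rule set_subset_adjoins[OF sring_A])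
  have "adjoins A (c # gens Y) \<subseteq> {x \<in> S. der x \<in> S}"
  proof (rule adjoins_least)
    show "sring {x \<in> S. der x \<in> S}"
      by (auto simp: sring_def der_mult der_diff
          intro: sring_0[OF S(1)] sring_1[OF S(1)] sring_add[OF S(1)] sring_diff[OF S(1)] sring_mult[OF S(1)])
    show "A \<subseteq> {x \<in> S. der x \<in> S}" using S(2) der_A by auto
    show "set (c # gens Y) \<subseteq> {x \<in> S. der x \<in> S}"
      using S(3) der_closed[OF Y S(1,2)] c sring_0[OF S(1)] by auto
  qed
  then show ?thesis using x by (auto simp: S_def)
qed

lemma der_pow_gens:
  assumes Y: "fundamental Y" and i: "i < m"
  shows "(der ^^ k) (Y i) \<in> adjoins A (gens Y)"
proof -
  have eq: "adjoins A (0 # gens Y) = adjoins A (gens Y)"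
  proof -
    have "adjoin A 0 = A"
      using adjoin_least[OF sring_A subset_refl sring_0[OF sring_A]] subset_adjoin[OF sring_A] by blast
    then show ?thesis by simp
  qed
  have "(der ^^ 0) (Y i) \<in> set (gens Y)" unfolding set_gens using i m by (intro CollectI exI[of _ i] exI[of _ 0]) simp
  then have "Y i \<in> adjoins A (gens Y)" using set_subset_adjoins[OF sring_A] by auto
  then show ?thesis
    using der_pow_in[of "adjoins A (gens Y)" "Y i" k] der_adjoins[OF Y, of 0] eq by auto
qed

definition solution_field :: "(nat \<Rightarrow> 'l alg_closure fls) \<Rightarrow> 'l alg_closure fls set" where
  "solution_field Y = generate_field type_ring (A \<union> {(der ^^ k) (Y i) | k i. i < m})"

lemma solution_field_least:
  assumes "fundamental Y" "sfield K" "adjoins A (gens Y) \<subseteq> K"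
  shows "solution_field Y \<subseteq> K"
proof -
  interpret R: field "type_ring :: 'l alg_closure fls ring" by (rule field_from_type_algebra)
  have "A \<union> {(der ^^ k) (Y i) | k i. i < m} \<subseteq> K"
    using assms(3) der_pow_gens[OF assms(1)] subset_adjoins[OF sring_A, of "gens Y"] by blast
  then show ?thesis unfolding solution_field_def
    using R.generate_field_min_subfield1[of _ K] assms(2) by (simp add: sfield_iff_subfield)
qed

text \<open>
  Evaluation at \<open>c \<mapsto> n\<close> and \<open>t = 0\<close> is a homomorphism \<open>E[c] \<rightarrow> \<Omega>\<close>, and for all but finitely many \<open>n\<close> it
  extends to the ring generated by the fundamental system, with the Wronskian not mapped to \<open>0\<close>.
  The Taylor map \<open>\<theta>\<close> of the extension is the identity on \<open>E\<close> and commutes with the derivation.  Natural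
  numbers are used as values because they are constants in every differential field.
\<close>

lemma specialization:
  assumes Y: "fundamental Y" and c: "der c = 0" "\<not> alg_over A c"
  shows "\<exists>\<theta> n. hom_on (adjoins A (c # gens Y)) \<theta> \<and> (\<forall>x\<in>A. \<theta> x = x) \<and>
    \<theta> (c - of_nat n) = 0 \<and> fundamental (\<lambda>i. \<theta> (Y i)) \<and> gens (\<lambda>i. \<theta> (Y i)) = map \<theta> (gens Y)"
proof -
  define S where "S = adjoins A (c # gens Y)"
  have S: "sring S" "A \<subseteq> S" "set (c # gens Y) \<subseteq> S"
    unfolding S_def
    by (rule sring_adjoins[OF sring_A], rule subset_adjoins[OF sring_A], rule set_subset_adjoins[OF sring_A])
  have der_S: "der x \<in> S" if "x \<in> S" for x using der_adjoins[OF Y c(1)] that by (simp add: S_def)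
  have entry: "(der ^^ j) (Y i) \<in> S" if "i < m" "j < m" for i j
    using S(3) that by (auto simp: set_gens)
  have Ac: "sring (adjoin A c)" by (rule sring_adjoin[OF sring_A])
  have W: "wronskian m Y \<in> adjoins (adjoin A c) (gens Y)" "wronskian m Y \<noteq> 0"
    "hom_on S \<theta> \<Longrightarrow> \<theta> (wronskian m Y) = Determinant.det (Matrix.mat m m (\<lambda>(j, i). \<theta> ((der ^^ j) (Y i))))"
    for \<theta> :: "_ \<Rightarrow> 'l alg_closure fls"
  proof -
    have "hom_on S (\<lambda>x. x)" by (simp add: hom_on_def)
    then have "wronskian m Y \<in> S" unfolding wronskian_def
      by (rule det_in_hom(1)[OF S(1)]) (rule entry)
    then show "wronskian m Y \<in> adjoins (adjoin A c) (gens Y)" by (simp add: S_def)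
    show "wronskian m Y \<noteq> 0" using Y by (simp add: fundamental_def)
    show "\<theta> (wronskian m Y) = Determinant.det (Matrix.mat m m (\<lambda>(j, i). \<theta> ((der ^^ j) (Y i))))" if "hom_on S \<theta>"
      unfolding wronskian_def by (rule det_in_hom(2)[OF S(1) that]) (rule entry)
  qed
  obtain f where f: "f \<in> adjoin A c" "f \<noteq> 0" and ext: "\<And>\<phi> :: _ \<Rightarrow> 'l alg_closure.
      hom_on (adjoin A c) \<phi> \<Longrightarrow> \<phi> f \<noteq> 0 \<Longrightarrow>
      \<exists>\<psi>. hom_on (adjoins (adjoin A c) (gens Y)) \<psi> \<and> (\<forall>x\<in>adjoin A c. \<psi> x = \<phi> x) \<and> \<psi> (wronskian m Y) \<noteq> 0"
    using hom_extension_adjoins[OF Ac W(1,2)] by blast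
  obtain p where p: "p \<in> polys A" "f = poly p c" using f(1) unfolding adjoin_def by blast
  from polys_image[OF sring_E hom_\<tau>_E p(1)[unfolded A_def]]
  obtain q where q: "q \<in> polys E" "p = map_poly \<tau> q" .
  have "q \<noteq> 0" using p q f(2) by auto
  then have "finite {x. poly q x = 0}" by (rule poly_roots_finite)
  then have "finite ((of_nat :: nat \<Rightarrow> 'l) -` {x. poly q x = 0})"
    by (rule finite_vimageI) (simp add: inj_on_def)
  from ex_new_if_finite[OF infinite_UNIV_nat this]
  obtain n :: nat where "n \<notin> of_nat -` {x. poly q x = 0}" ..
  then have n: "poly q (of_nat n) \<noteq> 0" by simp
  \<comment> \<open>Evaluation at \<open>t = 0\<close> turns the Taylor embedding of \<open>E\<close> into its embedding into \<open>\<Omega>\<close>.\<close>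
  define \<phi>0 :: "'l alg_closure fls \<Rightarrow> 'l alg_closure" where "\<phi>0 x = fls_nth x 0" for x
  have \<phi>0: "hom_on A \<phi>0"
    using hom_on_subset[OF hom_on_fls_nth_0 A_subset] by (simp add: \<phi>0_def[abs_def])
  have \<phi>0_\<tau>: "\<phi>0 (\<tau> e) = to_ac e" for e by (simp add: \<phi>0_def taylor_nth_0)
  have "poly (map_poly \<phi>0 p) (of_nat n) = 0" if "p \<in> polys A" "poly p c = 0" for p
    using c(2) that by (auto simp: alg_over_def)
  from hom_on_adjoin[OF sring_A \<phi>0 this] obtain \<phi> where
    \<phi>: "hom_on (adjoin A c) \<phi>" "\<And>x. x \<in> A \<Longrightarrow> \<phi> x = \<phi>0 x"
    "\<And>p. p \<in> polys A \<Longrightarrow> \<phi> (poly p c) = poly (map_poly \<phi>0 p) (of_nat n)" by metis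
  have "\<phi> f \<noteq> 0"
  proof -
    have "map_poly \<phi>0 p = map_poly to_ac q"
      unfolding q(2) by (rule poly_eqI) (simp add: coeff_map_poly \<phi>0_\<tau> \<tau>_0 hom_on_0[OF sring_A \<phi>0])
    then have "\<phi> f = poly (map_poly to_ac q) (to_ac (of_nat n))" by (simp add: p(2) \<phi>(3)[OF p(1)])
    also have "\<dots> = to_ac (poly q (of_nat n))"
      by (rule poly_map_hom[OF sring_UNIV hom_to_ac]) (simp_all add: polys_def)
    finally show ?thesis using n by simp
  qed
  then obtain \<psi> where \<psi>: "hom_on S \<psi>" "\<And>x. x \<in> adjoin A c \<Longrightarrow> \<psi> x = \<phi> x" "\<psi> (wronskian m Y) \<noteq> 0"
    using ext[OF \<phi>(1)] by (auto simp: S_def)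
  have \<psi>_A: "\<psi> (\<tau> e) = to_ac e" if "e \<in> E" for e
    using \<psi>(2)[of "\<tau> e"] \<phi>(2)[of "\<tau> e"] subset_adjoin[OF sring_A, of c] that \<phi>0_\<tau> by (auto simp: A_def)
  have "\<phi> c = of_nat n"
  proof -
    have "[:0, 1:] \<in> polys A" by (intro polys_pCons polys_0 sring_0 sring_1 sring_A)
    moreover have "map_poly \<phi>0 [:0, 1:] = [:0, 1:]"
      using hom_on_0[OF sring_A \<phi>0] hom_on_1[OF sring_A \<phi>0] by (simp add: map_poly_pCons)
    ultimately show ?thesis using \<phi>(3)[of "[:0, 1:]"] by simp
  qed
  then have \<psi>_c: "\<psi> c = of_nat n" using \<psi>(2) in_adjoin[OF sring_A] by simp
  define \<theta> where "\<theta> = taylor \<psi>"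
  have \<theta>: "hom_on S \<theta>" unfolding \<theta>_def by (rule hom_on_taylor[OF S(1) der_S \<psi>(1)])
  have \<theta>_\<tau>: "\<theta> (\<tau> e) = \<tau> e" if "e \<in> E" for e
    unfolding \<theta>_def taylor_def[of \<psi>] der_pow_taylor
    using \<psi>_A[OF der_pow_in[OF der_E that]] by (simp add: taylor_def)
  have \<theta>_der: "(der ^^ j) (\<theta> x) = \<theta> ((der ^^ j) x)" for j x by (simp add: \<theta>_def der_pow_taylor)
  show ?thesis
  proof (intro exI[of _ \<theta>] exI[of _ n] conjI ballI)
    show "hom_on (adjoins A (c # gens Y)) \<theta>" using \<theta> by (simp add: S_def)
    show "\<theta> x = x" if "x \<in> A" for x using that \<theta>_\<tau> by (auto simp: A_def)
    have "\<theta> c = fls_const (of_nat n)"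
      unfolding \<theta>_def using taylor_const[OF c(1), of \<psi>] hom_on_0[OF S(1) \<psi>(1)] \<psi>_c by simp
    then have "\<theta> c = of_nat n" by (simp add: fls_of_nat)
    moreover have "c \<in> S" using S(3) by simp
    ultimately show "\<theta> (c - of_nat n) = 0"
      using hom_on_diff[OF S(1) \<theta>] hom_on_of_nat[OF S(1) \<theta>] sring_of_nat[OF S(1)] by simp
    show "gens (\<lambda>i. \<theta> (Y i)) = map \<theta> (gens Y)"
      by (simp add: gens_def \<theta>_der map_concat comp_def)
    show "fundamental (\<lambda>i. \<theta> (Y i))"
      unfolding fundamental_def
    proof (intro conjI allI impI)
      fix i assume i: "i < m"
      have "(der ^^ m) (\<theta> (Y i)) = \<theta> (\<Sum>j<m. \<tau> (b j) * (der ^^ j) (Y i))"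
        using Y i by (simp add: \<theta>_der fundamental_def)
      also have "\<dots> = (\<Sum>j<m. \<theta> (\<tau> (b j) * (der ^^ j) (Y i)))"
        using S b i entry by (intro hom_on_sum[OF S(1) \<theta>] sring_mult[OF S(1)]) (auto simp: A_def)
      also have "\<dots> = (\<Sum>j<m. \<tau> (b j) * (der ^^ j) (\<theta> (Y i)))"
      proof (rule sum.cong)
        fix j assume "j \<in> {..<m}"
        then have "\<tau> (b j) \<in> S" "(der ^^ j) (Y i) \<in> S" "\<theta> (\<tau> (b j)) = \<tau> (b j)"
          using S(2) b i entry \<theta>_\<tau> by (auto simp: A_def)
        then show "\<theta> (\<tau> (b j) * (der ^^ j) (Y i)) = \<tau> (b j) * (der ^^ j) (\<theta> (Y i))"
          by (simp add: hom_on_mult[OF S(1) \<theta>] \<theta>_der)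
      qed simp
      finally show "(der ^^ m) (\<theta> (Y i)) = (\<Sum>j<m. \<tau> (b j) * (der ^^ j) (\<theta> (Y i)))" .
    next
      have "wronskian m (\<lambda>i. \<theta> (Y i)) = \<theta> (wronskian m Y)"
        unfolding W(3)[OF \<theta>] by (simp add: wronskian_def \<theta>_der)
      moreover have "fls_nth (\<theta> (wronskian m Y)) 0 \<noteq> 0"
        using \<psi>(3) by (simp add: \<theta>_def taylor_nth_0)
      ultimately show "wronskian m (\<lambda>i. \<theta> (Y i)) \<noteq> 0" by auto
    qed
  qed
qed

text \<open>
  The system \<open>Y\<close> is chosen with the least possible bound \<open>n\<close> on the length of independent lists of its
  derivatives.  A specialization along a new constant \<open>c\<close> produces a system that has an independent
  list of length \<open>n\<close> as well.  It lifts to an independent list \<open>xs\<close> for \<open>Y\<close>, which is of maximal length,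
  so \<open>c - k\<close> is algebraic over \<open>A[xs]\<close>.  The constant term of an equation of \<open>c - k\<close> is then killed by the
  specialization, against its injectivity on \<open>A[xs]\<close>.
\<close>

lemma ex_fundamental_without_new_constants:
  "\<exists>Y. fundamental Y \<and> (\<forall>c\<in>solution_field Y. der c = 0 \<longrightarrow> c \<in> A)"
proof -
  define bounded where "bounded n \<longleftrightarrow>
    (\<exists>Y. fundamental Y \<and> (\<forall>xs. set xs \<subseteq> set (gens Y) \<longrightarrow> indep A xs \<longrightarrow> length xs \<le> n))" for n
  have "\<exists>n. bounded n"
  proof -
    obtain Y where Y: "fundamental Y" using ex_fundamental by blast
    have "length xs \<le> card (set (gens Y))" if "set xs \<subseteq> set (gens Y)" "indep A xs" for xs
      using indep_distinct[OF sring_A that(2)] card_mono[OF _ that(1)] by (simp add: distinct_card)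
    then show ?thesis using Y unfolding bounded_def by blast
  qed
  define n where "n = (LEAST n. bounded n)"
  have "bounded n" unfolding n_def using \<open>\<exists>n. bounded n\<close> by (rule LeastI_ex)
  then obtain Y where Y: "fundamental Y"
    and bnd: "\<And>xs. set xs \<subseteq> set (gens Y) \<Longrightarrow> indep A xs \<Longrightarrow> length xs \<le> n" unfolding bounded_def by blast
  have "c \<in> A" if cL: "c \<in> solution_field Y" and c: "der c = 0" for c
  proof (rule ccontr)
    assume "c \<notin> A"
    then have nalg: "\<not> alg_over A c"
      using algebraic_constant[OF sfield_A der_A closed_A c] by blast
    obtain \<theta> k where \<theta>': "hom_on (adjoins A (c # gens Y)) \<theta> \<and> (\<forall>x\<in>A. \<theta> x = x) \<and>
      \<theta> (c - of_nat k) = 0 \<and> fundamental (\<lambda>i. \<theta> (Y i)) \<and> gens (\<lambda>i. \<theta> (Y i)) = map \<theta> (gens Y)"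
      using specialization[OF Y c nalg] by (elim exE)
    have \<theta>: "hom_on (adjoins A (c # gens Y)) \<theta>" "\<And>x. x \<in> A \<Longrightarrow> \<theta> x = x"
      "\<theta> (c - of_nat k) = 0" "fundamental (\<lambda>i. \<theta> (Y i))" "gens (\<lambda>i. \<theta> (Y i)) = map \<theta> (gens Y)"
      using \<theta>' by blast+
    define S where "S = adjoins A (c # gens Y)"
    have S: "sring S" "A \<subseteq> S" "set (c # gens Y) \<subseteq> S" "hom_on S \<theta>"
      unfolding S_def
      by (rule sring_adjoins[OF sring_A], rule subset_adjoins[OF sring_A], rule set_subset_adjoins[OF sring_A], rule \<theta>(1))
    obtain xs' where xs': "set xs' \<subseteq> set (map \<theta> (gens Y))" "indep A xs'" "length xs' \<ge> n"
    proof (cases n)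
      case 0
      then show ?thesis using that[of "[]"] by simp
    next
      case (Suc n')
      then have "\<not> bounded n'" using not_less_Least[of n' bounded] by (simp add: n_def)
      then show ?thesis using that \<theta>(4,5) Suc unfolding bounded_def by (metis not_less_eq_eq)
    qed
    have "xs' \<in> lists (\<theta> ` set (gens Y))" using xs'(1) by auto
    then obtain xs where xs: "set xs \<subseteq> set (gens Y)" "xs' = map \<theta> xs"
      unfolding lists_image by auto
    have im: "\<theta> ` A = A" using \<theta>(2) by force
    have "indep A xs \<and> (\<forall>x\<in>adjoins A xs. \<theta> x = 0 \<longrightarrow> x = 0)"
      by (rule indep_of_image[OF S(1,4) sring_A S(2)]) (use xs xs' S(3) im \<theta>(2) in auto)
    then have ind: "indep A xs" and inj: "\<And>x. x \<in> adjoins A xs \<Longrightarrow> \<theta> x = 0 \<Longrightarrow> x = 0" by auto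
    have len: "length xs \<ge> n" using xs xs' by simp
    have "alg_over (adjoins A xs) g" if "g \<in> set (gens Y)" for g
    proof (rule ccontr)
      assume "\<not> alg_over (adjoins A xs) g"
      then have "indep A (xs @ [g])" using ind by (simp add: indep_snoc)
      then show False using bnd[of "xs @ [g]"] xs that len by simp
    qed
    then have gensK: "set (gens Y) \<subseteq> {x. alg_over (adjoins A xs) x}" by blast
    let ?B = "adjoins A xs"
    let ?K = "{x. alg_over ?B x}"
    have B: "sring ?B" by (rule sring_adjoins[OF sring_A])
    have K: "sfield ?K" by (rule sfield_alg_over[OF B])
    then have sK: "sring ?K" by (simp add: sfield_def)
    have "A \<subseteq> ?K" using subset_adjoins[OF sring_A] alg_over_self[OF B] by blast
    then have "adjoins A (gens Y) \<subseteq> ?K" using adjoins_least[OF sK] gensK by blast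
    then have "solution_field Y \<subseteq> ?K" by (rule solution_field_least[OF Y K])
    then have "c - of_nat k \<in> ?K" using cL by (intro sring_diff[OF sK] sring_of_nat[OF sK]) auto
    moreover have "c - of_nat k \<noteq> 0" using \<open>c \<notin> A\<close> sring_of_nat[OF sring_A, of k] by auto
    ultimately obtain w where w: "w \<in> polys ?B" "poly w (c - of_nat k) = 0" "coeff w 0 \<noteq> 0"
      using alg_over_coeff_0[of ?B] by blast
    have BS: "?B \<subseteq> S" using adjoins_least[OF S(1,2)] xs S(3) by auto
    have dS: "c - of_nat k \<in> S" using S(3) by (intro sring_diff[OF S(1)] sring_of_nat[OF S(1)]) simp
    have "poly (map_poly \<theta> w) (\<theta> (c - of_nat k)) = \<theta> (poly w (c - of_nat k))"
      by (rule poly_map_hom[OF S(1,4)]) (use w polys_mono[OF BS] dS in auto)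
    then have "\<theta> (coeff w 0) = 0"
      by (simp add: \<theta>(3) w(2) hom_on_0[OF S(1,4)] poly_0_coeff_0 coeff_map_hom[OF S(1,4)])
    then show False using inj[OF coeff_in[OF w(1)]] w(3) by blast
  qed
  then show ?thesis using Y by blast
qed

end

section \<open>Cardinality of solution fields\<close>

text \<open>
  At most as many elements as \<open>'l\<close>; surjections are easier to combine here than injections.
\<close>

definition covered :: "'l itself \<Rightarrow> 'f set \<Rightarrow> bool" where
  "covered _ A \<longleftrightarrow> (\<exists>g :: 'l \<Rightarrow> 'f. A \<subseteq> range g)"

lemma ex_surj_pair:
  assumes "infinite (UNIV :: 'l set)"
  shows "\<exists>h :: 'l \<Rightarrow> 'l \<times> 'l. surj h"
proof -
  have "\<exists>f. bij_betw f ((UNIV :: 'l set) \<times> (UNIV :: 'l set)) (UNIV :: 'l set)"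
    unfolding card_of_ordIso by (rule card_of_Times_same_infinite[OF assms])
  then obtain f :: "'l \<times> 'l \<Rightarrow> 'l" where "bij f" by auto
  then show ?thesis by (intro exI[of _ "inv_into UNIV f"]) (simp add: bij_is_inj inj_imp_surj_inv)
qed

lemma covered_image2:
  assumes "infinite (UNIV :: 'l set)" "covered TYPE('l) A" "covered TYPE('l) B"
  shows "covered TYPE('l) ((\<lambda>(x, y). f x y) ` (A \<times> B))"
proof -
  obtain g g' :: "'l \<Rightarrow> _" where g: "A \<subseteq> range g" and g': "B \<subseteq> range g'" using assms by (auto simp: covered_def)
  obtain h :: "'l \<Rightarrow> 'l \<times> 'l" where h: "surj h" using ex_surj_pair[OF assms(1)] by blast
  have "f x y \<in> range (\<lambda>z. f (g (fst (h z))) (g' (snd (h z))))" if xy: "x \<in> A" "y \<in> B" for x y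
  proof -
    obtain u v where "x = g u" "y = g' v" using xy g g' by blast
    moreover obtain z where "h z = (u, v)" using h by (metis surjD)
    ultimately show ?thesis by (intro range_eqI[of _ _ z]) simp
  qed
  then show ?thesis unfolding covered_def by (intro exI[of _ "\<lambda>z. f (g (fst (h z))) (g' (snd (h z)))"]) auto
qed

lemma covered_UN_nat:
  assumes inf: "infinite (UNIV :: 'l set)" and D: "\<And>n::nat. covered TYPE('l) (D n)"
  shows "covered TYPE('l) (\<Union>n. D n)"
proof -
  obtain q :: "nat \<Rightarrow> 'l" where q: "inj q" using inf infinite_countable_subset by blast
  obtain g :: "nat \<Rightarrow> 'l \<Rightarrow> _" where g: "\<And>n. D n \<subseteq> range (g n)" using D unfolding covered_def by metis
  obtain h :: "'l \<Rightarrow> 'l \<times> 'l" where h: "surj h" using ex_surj_pair[OF inf] by blast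
  have "x \<in> range (\<lambda>z. g (inv_into UNIV q (fst (h z))) (snd (h z)))" if x: "x \<in> D n" for x n
  proof -
    obtain v where "x = g n v" using x g by blast
    moreover obtain z where "h z = (q n, v)" using h by (metis surjD)
    ultimately show ?thesis using q by (intro range_eqI[of _ _ z]) simp
  qed
  then show ?thesis unfolding covered_def by (intro exI[of _ "\<lambda>z. g (inv_into UNIV q (fst (h z))) (snd (h z))"]) auto
qed

lemma covered_subset: "covered t B \<Longrightarrow> A \<subseteq> B \<Longrightarrow> covered t A"
  unfolding covered_def by blast

text \<open>
  The sets \<open>D n\<close> contain the values at \<open>b\<close> of the polynomials with at most \<open>n\<close> coefficients.
\<close>

lemma covered_adjoin:
  assumes inf: "infinite (UNIV :: 'l set)" and A: "covered TYPE('l) A"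
  shows "covered TYPE('l) (adjoin A b)"
proof -
  define D where "D = rec_nat {0} (\<lambda>_ D. (\<lambda>(a, x). a + b * x) ` (A \<times> D))"
  have D: "covered TYPE('l) (D n)" for n
  proof (induction n)
    case 0
    show ?case unfolding covered_def D_def by (intro exI[of _ "\<lambda>_. 0"]) simp
  next
    case (Suc n)
    then show ?case using covered_image2[OF inf A Suc] by (simp add: D_def)
  qed
  have "p \<in> polys A \<Longrightarrow> \<exists>n. poly p b \<in> D n" for p
  proof (induction p)
    case 0
    have "poly 0 b \<in> D 0" by (simp add: D_def)
    then show ?case ..
  next
    case (pCons a p)
    then have a: "a \<in> A" "p \<in> polys A"
      by (auto simp: polys_def coeff_pCons split: nat.splits dest: spec[of _ "Suc _"] spec[of _ 0])
    then obtain n where "poly p b \<in> D n" using pCons by blast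
    with a(1) have "poly (pCons a p) b \<in> D (Suc n)" unfolding D_def by (auto intro!: image_eqI)
    then show ?case ..
  qed
  then have "adjoin A b \<subseteq> (\<Union>n. D n)" by (auto simp: adjoin_def)
  then show ?thesis by (rule covered_subset[OF covered_UN_nat[OF inf D]])
qed

lemma covered_adjoins:
  assumes inf: "infinite (UNIV :: 'l set)"
  shows "covered TYPE('l) A \<Longrightarrow> covered TYPE('l) (adjoins A bs)"
  by (induction bs arbitrary: A) (simp_all add: covered_adjoin[OF inf])

lemma covered_fracs:
  assumes inf: "infinite (UNIV :: 'l set)" and A: "covered TYPE('l) A"
  shows "covered TYPE('l) (fracs A)"
proof -
  have "fracs A \<subseteq> (\<lambda>(x, y). x / y) ` (A \<times> A)" by (auto simp: fracs_def)
  then show ?thesis by (rule covered_subset[OF covered_image2[OF inf A A]])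
qed

section \<open>Transporting a differential field to a subset of another type\<close>

text \<open>
  A copy of the differential field \<open>L\<close> on the set \<open>\<sigma> ` L\<close>, with operations that have nothing to do with
  those of the type \<open>'l\<close>.  The map \<open>g\<close> inverts \<open>\<sigma>\<close> on \<open>L\<close>.
\<close>

locale transport =
  fixes L :: "'f::diff_field set" and \<sigma> :: "'f \<Rightarrow> 'l" and g :: "'l \<Rightarrow> 'f"
  assumes L: "sfield L" and der_L: "x \<in> L \<Longrightarrow> der x \<in> L" and g: "x \<in> L \<Longrightarrow> g (\<sigma> x) = x"
begin

definition R :: "'l ring" where
  "R = \<lparr>carrier = \<sigma> ` L, monoid.mult = (\<lambda>x y. \<sigma> (g x * g y)), one = \<sigma> 1,
    ring.zero = \<sigma> 0, add = (\<lambda>x y. \<sigma> (g x + g y))\<rparr>"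

definition \<delta> :: "'l \<Rightarrow> 'l" where
  "\<delta> x = \<sigma> (der (g x))"

lemma sring_L: "sring L"
  using L by (simp add: sfield_def)

lemmas in_L = sring_0[OF sring_L] sring_1[OF sring_L] sring_add[OF sring_L] sring_mult[OF sring_L] sring_minus[OF sring_L]

lemma \<sigma>_inj: "x \<in> L \<Longrightarrow> y \<in> L \<Longrightarrow> \<sigma> x = \<sigma> y \<longleftrightarrow> x = y"
  using g by metis

lemma R_carrier [simp]: "carrier R = \<sigma> ` L" and R_one [simp]: "\<one>\<^bsub>R\<^esub> = \<sigma> 1" and R_zero [simp]: "\<zero>\<^bsub>R\<^esub> = \<sigma> 0"
  by (simp_all add: R_def)

lemma R_mult: "x \<in> L \<Longrightarrow> y \<in> L \<Longrightarrow> \<sigma> x \<otimes>\<^bsub>R\<^esub> \<sigma> y = \<sigma> (x * y)"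
  and R_add: "x \<in> L \<Longrightarrow> y \<in> L \<Longrightarrow> \<sigma> x \<oplus>\<^bsub>R\<^esub> \<sigma> y = \<sigma> (x + y)"
  and \<delta>_\<sigma>: "x \<in> L \<Longrightarrow> \<delta> (\<sigma> x) = \<sigma> (der x)"
  by (simp_all add: R_def \<delta>_def g)

lemma \<delta>_pow: "x \<in> L \<Longrightarrow> (\<delta> ^^ n) (\<sigma> x) = \<sigma> ((der ^^ n) x)"
  by (induction n) (simp_all add: \<delta>_\<sigma> der_pow_in[OF der_L])

lemma field_R: "field R"
proof -
  interpret T: field "type_ring :: 'f ring" by (rule field_from_type_algebra)
  have "subfield L type_ring" using L by (simp add: sfield_iff_subfield)
  then have "field (restrict_field L)" using T.subfield_iff(2) by (simp add: restrict_field_def)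
  then interpret F: field "restrict_field L" .
  have "\<sigma> \<in> ring_iso (restrict_field L) R"
    by (auto simp: ring_iso_def Ring.ring_hom_def bij_betw_def inj_on_def restrict_field_def R_mult R_add \<sigma>_inj)
  from F.ring_iso_imp_img_field[OF this] show ?thesis by (simp add: R_def restrict_field_def)
qed

sublocale R: field R
  by (rule field_R)

lemma R_a_inv: "x \<in> L \<Longrightarrow> \<ominus>\<^bsub>R\<^esub> \<sigma> x = \<sigma> (- x)"
  by (rule R.minus_equality) (auto simp: R_add in_L)

lemma R_m_inv: "x \<in> L \<Longrightarrow> x \<noteq> 0 \<Longrightarrow> inv\<^bsub>R\<^esub> \<sigma> x = \<sigma> (inverse x)"
  using L by (intro R.comm_inv_char) (auto simp: R_mult in_L sfield_def)

lemma diff_field_R: "diff_field_on R \<delta>"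
  by (auto simp: diff_field_on_def field_R R_add R_mult \<delta>_\<sigma> der_L in_L der_add der_mult)

lemma R_finsum:
  assumes "finite S" "\<And>i. i \<in> S \<Longrightarrow> h i \<in> L" "\<And>i. i \<in> S \<Longrightarrow> F i = \<sigma> (h i)"
  shows "(\<Oplus>\<^bsub>R\<^esub>i\<in>S. F i) = \<sigma> (\<Sum>i\<in>S. h i)"
  using assms
proof (induction S rule: finite_induct)
  case empty
  then show ?case by simp
next
  case (insert i S)
  have "(\<Oplus>\<^bsub>R\<^esub>i\<in>insert i S. F i) = F i \<oplus>\<^bsub>R\<^esub> (\<Oplus>\<^bsub>R\<^esub>i\<in>S. F i)"
    using insert by (intro R.finsum_insert) auto
  then show ?case using insert by (simp add: R_add sring_sum[OF sring_L])
qed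

text \<open>
  Scalars missing at the end of \<open>Ks\<close> count as \<open>0\<close>.
\<close>

lemma R_combine:
  assumes "set us \<subseteq> L" "set Ks \<subseteq> L"
  shows "R.combine (map \<sigma> Ks) (map \<sigma> us) = \<sigma> (\<Sum>i<length us. (if i < length Ks then Ks ! i else 0) * us ! i)"
  using assms
proof (induction us arbitrary: Ks)
  case Nil
  then show ?case by simp
next
  case (Cons u us)
  show ?case
  proof (cases Ks)
    case Nil
    then show ?thesis by simp
  next
    case (Cons k Ks')
    have "(\<Sum>i<length us. (if i < length Ks' then Ks' ! i else 0) * us ! i) \<in> L"
      using Cons.prems Cons
      by (intro sring_sum[OF sring_L] in_L) (auto intro: in_L)
    then show ?thesis
      using Cons.IH[of Ks'] Cons.prems Cons
      by (simp add: R_mult R_add in_L sum.lessThan_Suc_shift del: sum.lessThan_Suc cong: if_cong)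
  qed
qed

lemma generate_field_transport:
  assumes H: "H \<subseteq> L"
  shows "generate_field R (\<sigma> ` H) = \<sigma> ` generate_field type_ring H"
proof -
  interpret T: field "type_ring :: 'f ring" by (rule field_from_type_algebra)
  have GL: "generate_field type_ring H \<subseteq> L"
    using T.generate_field_min_subfield1[of H L] H L by (simp add: sfield_iff_subfield)
  show ?thesis
  proof
    show "generate_field R (\<sigma> ` H) \<subseteq> \<sigma> ` generate_field type_ring H"
    proof
      fix y assume "y \<in> generate_field R (\<sigma> ` H)"
      then show "y \<in> \<sigma> ` generate_field type_ring H"
      proof (induction rule: generate_field.induct)
        case one
        have "(1::'f) \<in> generate_field type_ring H" using generate_field.one[of type_ring H] by simp
        then show ?case by simp
      next
        case (incl h)
        then show ?case by (auto intro: generate_field.incl)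
      next
        case (a_inv h)
        then obtain x where *: "h = \<sigma> x" "x \<in> generate_field type_ring H" by blast
        then have "x \<in> L" using GL by auto
        then show ?case using * generate_field.a_inv[of x type_ring H] by (simp add: R_a_inv)
      next
        case (m_inv h)
        then obtain x where x: "h = \<sigma> x" "x \<in> generate_field type_ring H" by blast
        with m_inv have "x \<noteq> 0" by auto
        moreover have "x \<in> L" using x GL by auto
        ultimately show ?case using x generate_field.m_inv[of x type_ring H] by (simp add: R_m_inv)
      next
        case (eng_add h1 h2)
        then obtain x y where *: "h1 = \<sigma> x" "x \<in> generate_field type_ring H" "h2 = \<sigma> y" "y \<in> generate_field type_ring H" by blast
        then have "x \<in> L" "y \<in> L" using GL by auto
        then show ?case using * generate_field.eng_add[of x type_ring H y] by (simp add: R_add)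
      next
        case (eng_mult h1 h2)
        then obtain x y where *: "h1 = \<sigma> x" "x \<in> generate_field type_ring H" "h2 = \<sigma> y" "y \<in> generate_field type_ring H" by blast
        then have "x \<in> L" "y \<in> L" using GL by auto
        then show ?case using * generate_field.eng_mult[of x type_ring H y] by (simp add: R_mult)
      qed
    qed
    have "x \<in> generate_field type_ring H \<Longrightarrow> x \<in> L \<and> \<sigma> x \<in> generate_field R (\<sigma> ` H)" for x
    proof (induction rule: generate_field.induct)
      case one
      then show ?case using generate_field.one[of R "\<sigma> ` H"] in_L by simp
    next
      case (incl h)
      then show ?case using H by (auto intro: generate_field.incl)
    next
      case (a_inv h)
      then show ?case using generate_field.a_inv[of "\<sigma> h" R "\<sigma> ` H"] by (simp add: R_a_inv in_L)
    next
      case (m_inv h)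
      then have h: "h \<in> L" "h \<noteq> 0" "\<sigma> h \<in> generate_field R (\<sigma> ` H)" by auto
      then have "\<sigma> h \<noteq> \<sigma> 0" using \<sigma>_inj in_L by blast
      then show ?case using generate_field.m_inv[of "\<sigma> h" R "\<sigma> ` H"] h L by (simp add: R_m_inv sfield_def)
    next
      case (eng_add h1 h2)
      then show ?case using generate_field.eng_add[of "\<sigma> h1" R "\<sigma> ` H" "\<sigma> h2"] by (simp add: R_add in_L)
    next
      case (eng_mult h1 h2)
      then show ?case using generate_field.eng_mult[of "\<sigma> h1" R "\<sigma> ` H" "\<sigma> h2"] by (simp add: R_mult in_L)
    qed
    then show "\<sigma> ` generate_field type_ring H \<subseteq> generate_field R (\<sigma> ` H)" by blast
  qed
qed

lemma subfield_transport:
  assumes K: "sfield K" "K \<subseteq> L"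
  shows "subfield (\<sigma> ` K) R"
proof (rule R.subfieldI')
  have sK: "sring K" using K by (simp add: sfield_def)
  show "subring (\<sigma> ` K) R"
  proof (rule R.subringI)
    show "\<sigma> ` K \<subseteq> carrier R" using K by auto
    show "\<one>\<^bsub>R\<^esub> \<in> \<sigma> ` K" using sring_1[OF sK] by simp
  next
    fix h assume "h \<in> \<sigma> ` K"
    then show "\<ominus>\<^bsub>R\<^esub> h \<in> \<sigma> ` K" using K(2) sring_minus[OF sK] by (auto simp: R_a_inv subset_iff)
  next
    fix h1 h2 assume "h1 \<in> \<sigma> ` K" "h2 \<in> \<sigma> ` K"
    then obtain x y where *: "h1 = \<sigma> x" "x \<in> K" "h2 = \<sigma> y" "y \<in> K" by blast
    then have "x \<in> L" "y \<in> L" using K(2) by auto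
    then show "h1 \<otimes>\<^bsub>R\<^esub> h2 \<in> \<sigma> ` K" "h1 \<oplus>\<^bsub>R\<^esub> h2 \<in> \<sigma> ` K"
      using * sring_mult[OF sK, of x y] sring_add[OF sK, of x y] by (simp_all add: R_mult R_add)
  qed
next
  fix k assume "k \<in> \<sigma> ` K - {\<zero>\<^bsub>R\<^esub>}"
  then obtain x where x: "k = \<sigma> x" "x \<in> K" "x \<noteq> 0" by auto
  then have "x \<in> L" "inverse x \<in> K" using K by (auto simp: sfield_def)
  then show "inv\<^bsub>R\<^esub> k \<in> \<sigma> ` K" using x by (simp add: R_m_inv)
qed

end

section \<open>The linear closure contains solutions\<close>

lemma der_inverse:
  fixes x :: "'f::diff_field"
  assumes "x \<noteq> 0" shows "der (inverse x) = - (der x * inverse x * inverse x)"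
proof -
  have "der x * inverse x + x * der (inverse x) = 0"
    using der_mult[of x "inverse x"] assms by simp
  then have "x * der (inverse x) = - (der x * inverse x)" by (simp add: eq_neg_iff_add_eq_0 add.commute)
  moreover have "der (inverse x) = inverse x * (x * der (inverse x))" using assms by simp
  ultimately show ?thesis by simp
qed

context monic_equation
begin

lemma gens_subset: "A \<union> {(der ^^ k) (Y i) | k i. i < m} \<subseteq> solution_field Y"
  unfolding solution_field_def by (auto intro: generate_field.incl)

lemma sfield_solution_field: "sfield (solution_field Y)"
proof -
  interpret T: field "type_ring :: 'l alg_closure fls ring" by (rule field_from_type_algebra)
  show ?thesis unfolding sfield_iff_subfield solution_field_def
    by (rule T.generate_field_is_subfield) simp
qed

lemma der_solution_field:
  assumes "x \<in> solution_field Y" shows "der x \<in> solution_field Y"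
proof -
  interpret T: field "type_ring :: 'l alg_closure fls ring" by (rule field_from_type_algebra)
  let ?L = "solution_field Y"
  have sL: "sring ?L" using sfield_solution_field by (simp add: sfield_def)
  have inv: "inverse x \<in> ?L" if "x \<in> ?L" for x using that sfield_solution_field by (auto simp: sfield_def)
  let ?K = "{x \<in> ?L. der x \<in> ?L}"
  have "sfield ?K"
    unfolding sfield_def
  proof
    show "sring ?K"
      by (auto simp: sring_def der_mult der_diff
          intro: sring_0[OF sL] sring_1[OF sL] sring_add[OF sL] sring_diff[OF sL] sring_mult[OF sL])
    show "\<forall>x\<in>?K. inverse x \<in> ?K"
    proof
      fix x assume x: "x \<in> ?K"
      show "inverse x \<in> ?K"
      proof (cases "x = 0")
        case False
        then show ?thesis using x inv
          by (auto simp: der_inverse intro!: sring_minus[OF sL] sring_mult[OF sL])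
      qed (use x in simp)
    qed
  qed
  moreover have "A \<union> {(der ^^ k) (Y i) | k i. i < m} \<subseteq> ?K"
  proof
    fix x assume x: "x \<in> A \<union> {(der ^^ k) (Y i) | k i. i < m}"
    then have "der x \<in> A \<union> {(der ^^ k) (Y i) | k i. i < m}"
    proof
      assume "x \<in> {(der ^^ k) (Y i) | k i. i < m}"
      then obtain k i where "x = (der ^^ k) (Y i)" "i < m" by blast
      then have "der x = (der ^^ Suc k) (Y i)" "i < m" by simp_all
      then show ?thesis by blast
    qed (simp add: der_A)
    then show "x \<in> ?K" using x gens_subset[of Y] by blast
  qed
  ultimately have "generate_field type_ring (A \<union> {(der ^^ k) (Y i) | k i. i < m}) \<subseteq> ?K"
    using T.generate_field_min_subfield1[of _ ?K] by (simp add: sfield_iff_subfield)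
  then show ?thesis using assms unfolding solution_field_def by blast
qed

lemma covered_solution_field:
  assumes "fundamental Y" shows "covered TYPE('l) (solution_field Y)"
proof -
  have inf: "infinite (UNIV :: 'l set)" by (rule infinite_UNIV_char_0)
  have "covered TYPE('l) A" unfolding covered_def A_def by blast
  then have "covered TYPE('l) (fracs (adjoins A (gens Y)))"
    by (intro covered_fracs[OF inf] covered_adjoins[OF inf])
  moreover have "solution_field Y \<subseteq> fracs (adjoins A (gens Y))"
    by (intro solution_field_least assms sfield_fracs subset_fracs sring_adjoins[OF sring_A])
  ultimately show ?thesis by (rule covered_subset)
qed

text \<open>
  The copy of the solution field of a fundamental system without new constants is a Picard-Vessiot
  extension of \<open>E\<close>.  Its embedding into \<open>M\<close> maps the first member of the system to the required \<open>y\<close>.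
\<close>

lemma solution_of_pv_complete:
  assumes M: "pv_complete E M"
  shows "\<exists>y. y \<noteq> 0 \<and> (der ^^ m) y = (\<Sum>j<m. b j * (der ^^ j) y)"
proof -
  obtain Y where Y: "fundamental Y" and noconst: "\<And>c. c \<in> solution_field Y \<Longrightarrow> der c = 0 \<Longrightarrow> c \<in> A"
    using ex_fundamental_without_new_constants by blast
  define L where "L = solution_field Y"
  obtain g :: "'l \<Rightarrow> 'l alg_closure fls" where g: "L \<subseteq> range g"
    using covered_solution_field[OF Y] by (auto simp: covered_def L_def)
  define \<sigma> where "\<sigma> = inv_into UNIV g"
  have g_\<sigma>: "g (\<sigma> x) = x" if "x \<in> L" for x unfolding \<sigma>_def using that g by (intro f_inv_into_f) blast
  interpret t: transport L \<sigma> g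
    using sfield_solution_field der_solution_field g_\<sigma> by unfold_locales (simp_all add: L_def)
  have AL: "A \<subseteq> L" and YL: "\<And>i k. i < m \<Longrightarrow> (der ^^ k) (Y i) \<in> L"
    using gens_subset[of Y] by (auto simp: L_def)
  then have \<tau>L: "\<tau> x \<in> L" if "x \<in> E" for x using that by (auto simp: A_def)
  define j where "j x = \<sigma> (\<tau> x)" for x
  \<comment> \<open>The coefficients of the operator that corresponds to the monic equation.\<close>
  define a where "a i = (if i = m then 1 else - b i)" for i
  have aE: "a i \<in> E" if "i \<le> m" for i
    using b[of i] that sring_1[OF sring_E] sring_minus[OF sring_E] by (auto simp: a_def)
  have eqn: "(\<Sum>i\<le>m. \<tau> (a i) * (der ^^ i) (Y k)) = 0" if "k < m" for k
  proof -
    have "(\<Sum>i\<le>m. \<tau> (a i) * (der ^^ i) (Y k)) = (\<Sum>i<m. \<tau> (a i) * (der ^^ i) (Y k)) + (der ^^ m) (Y k)"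
      by (simp add: lessThan_Suc_atMost[symmetric] a_def \<tau>_1)
    also have "(\<Sum>i<m. \<tau> (a i) * (der ^^ i) (Y k)) = (\<Sum>i<m. - (\<tau> (b i) * (der ^^ i) (Y k)))"
      by (rule sum.cong) (simp_all add: a_def hom_on_minus[OF sring_UNIV hom_\<tau>])
    finally show ?thesis using Y that by (simp add: fundamental_def sum_negf)
  qed
  let ?EE = "restrict_field E"
  interpret T: field "type_ring :: 'l ring" by (rule field_from_type_algebra)
  have dE: "diff_field_on ?EE der"
    using E T.subfield_iff(2)[of E] der_E
    by (auto simp: diff_field_on_def restrict_field_def der_add der_mult sfield_iff_subfield)
  have j_hom: "j \<in> diff_hom ?EE der t.R t.\<delta>"
    using \<tau>L sring_E hom_on_add[OF sring_UNIV hom_\<tau>]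
    by (auto simp: diff_hom_def Ring.ring_hom_def restrict_field_def j_def t.R_mult t.R_add \<tau>_mult \<tau>_1 t.\<delta>_\<sigma> der_taylor)
  have const_L: "{x \<in> L. der x = 0} = \<tau> ` {x \<in> E. der x = 0}"
    using noconst AL constants_A by (auto simp: L_def)
  have const_E: "constants_on ?EE der = {x \<in> E. der x = 0}"
    by (auto simp: constants_on_def restrict_field_def)
  have const_R: "constants_on t.R t.\<delta> = j ` constants_on ?EE der"
  proof -
    have "constants_on t.R t.\<delta> = \<sigma> ` {x \<in> L. der x = 0}"
      by (auto simp: constants_on_def t.\<delta>_\<sigma> t.\<sigma>_inj t.der_L t.in_L)
    also have "\<dots> = j ` {x \<in> E. der x = 0}" by (simp add: const_L image_image j_def)
    finally show ?thesis by (simp add: const_E)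
  qed
  define ys where "ys = map \<sigma> (map Y [0..<m])"
  have ys: "set ys \<subseteq> carrier t.R" using YL[of _ 0] by (auto simp: ys_def)
  have indep: "t.R.independent (j ` constants_on ?EE der) ys"
  proof (rule t.R.trivial_combine_imp_independent)
    have "sfield {x \<in> L. der x = 0}"
      using t.L t.sring_L by (auto simp: sfield_def sring_def der_mult der_diff) (metis der_inverse minus_zero mult_zero_left inverse_zero der_0)
    then have "subfield (\<sigma> ` {x \<in> L. der x = 0}) t.R" by (rule t.subfield_transport) auto
    then show "subfield (j ` constants_on ?EE der) t.R" by (simp add: const_L const_E image_image j_def)
    show "set ys \<subseteq> carrier t.R" by (rule ys)
  next
    fix Ks assume Ks: "set Ks \<subseteq> j ` constants_on ?EE der" "t.R.combine Ks ys = \<zero>\<^bsub>t.R\<^esub>"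
    have "Ks \<in> lists (\<sigma> ` {x \<in> L. der x = 0})" using Ks(1) by (auto simp: const_L const_E image_image j_def)
    then obtain ks where ks: "set ks \<subseteq> {x \<in> L. der x = 0}" "Ks = map \<sigma> ks" unfolding lists_image by auto
    define c where "c i = (if i < length ks then ks ! i else 0)" for i
    have "c i \<in> {x \<in> L. der x = 0}" for i
    proof (cases "i < length ks")
      case True
      then show ?thesis using subsetD[OF ks(1) nth_mem[OF True]] by (simp add: c_def)
    qed (simp add: c_def t.in_L)
    then have c: "c i \<in> L" "der (c i) = 0" for i by blast+
    have "t.R.combine Ks ys = \<sigma> (\<Sum>i<length (map Y [0..<m]). (if i < length ks then ks ! i else 0) * map Y [0..<m] ! i)"
      unfolding ks(2) ys_def by (rule t.R_combine) (use ks(1) YL[of _ 0] in auto)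
    also have "\<dots> = \<sigma> (\<Sum>i<m. c i * Y i)" by (simp add: c_def)
    finally have "\<sigma> (\<Sum>i<m. c i * Y i) = \<sigma> 0" using Ks(2) by simp
    moreover have "(\<Sum>i<m. c i * Y i) \<in> L"
      using YL[of _ 0] c by (intro sring_sum[OF t.sring_L] t.in_L) auto
    ultimately have "(\<Sum>i<m. c i * Y i) = 0" using t.\<sigma>_inj t.in_L by blast
    then have c0: "c i = 0" if "i < m" for i
      using wronskian_independent[of m Y c i] Y c that by (simp add: fundamental_def)
    have "k = \<sigma> 0" if k: "k \<in> set (take (length ys) Ks)" for k
    proof -
      obtain i where i: "i < length (take (length ys) Ks)" "k = take (length ys) Ks ! i"
        using k by (metis in_set_conv_nth)
      then have "i < m" "i < length ks" "k = \<sigma> (ks ! i)" by (simp_all add: ys_def ks(2))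
      then show ?thesis using c0[of i] by (simp add: c_def)
    qed
    then show "set (take (length ys) Ks) \<subseteq> {\<zero>\<^bsub>t.R\<^esub>}" by auto
  qed
  have gen: "carrier t.R = generate_field t.R (j ` carrier ?EE \<union> {(t.\<delta> ^^ k) y | k y. y \<in> set ys})"
  proof -
    have "{(t.\<delta> ^^ k) y | k y. y \<in> set ys} = \<sigma> ` {(der ^^ k) (Y i) | k i. i < m}"
    proof
      show "{(t.\<delta> ^^ k) y | k y. y \<in> set ys} \<subseteq> \<sigma> ` {(der ^^ k) (Y i) | k i. i < m}"
      proof
        fix x assume "x \<in> {(t.\<delta> ^^ k) y | k y. y \<in> set ys}"
        then obtain k i where "x = (t.\<delta> ^^ k) (\<sigma> (Y i))" "i < m" by (auto simp: ys_def)
        then have "x = \<sigma> ((der ^^ k) (Y i))" "i < m" using t.\<delta>_pow[of "Y i" k] YL[of i 0] by auto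
        then show "x \<in> \<sigma> ` {(der ^^ k) (Y i) | k i. i < m}" by blast
      qed
      show "\<sigma> ` {(der ^^ k) (Y i) | k i. i < m} \<subseteq> {(t.\<delta> ^^ k) y | k y. y \<in> set ys}"
      proof
        fix x assume "x \<in> \<sigma> ` {(der ^^ k) (Y i) | k i. i < m}"
        then obtain k i where "x = \<sigma> ((der ^^ k) (Y i))" "i < m" by blast
        then have "x = (t.\<delta> ^^ k) (\<sigma> (Y i))" "\<sigma> (Y i) \<in> set ys" using t.\<delta>_pow[of "Y i" k] YL[of i 0] by (auto simp: ys_def)
        then show "x \<in> {(t.\<delta> ^^ k) y | k y. y \<in> set ys}" by blast
      qed
    qed
    moreover have "j ` carrier ?EE = \<sigma> ` A" by (simp add: restrict_field_def A_def image_image j_def)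
    ultimately have "generate_field t.R (j ` carrier ?EE \<union> {(t.\<delta> ^^ k) y | k y. y \<in> set ys})
        = generate_field t.R (\<sigma> ` (A \<union> {(der ^^ k) (Y i) | k i. i < m}))"
      by (simp add: image_Un)
    also have "\<dots> = \<sigma> ` generate_field type_ring (A \<union> {(der ^^ k) (Y i) | k i. i < m})"
      by (rule t.generate_field_transport) (use gens_subset[of Y] in \<open>simp add: L_def\<close>)
    finally show ?thesis unfolding solution_field_def[symmetric] L_def[symmetric] t.R_carrier by (rule sym)
  qed
  have sol: "(\<Oplus>\<^bsub>t.R\<^esub>i\<in>{..m}. j (a i) \<otimes>\<^bsub>t.R\<^esub> (t.\<delta> ^^ i) y) = \<zero>\<^bsub>t.R\<^esub>" if y: "y \<in> set ys" for y
  proof -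
    obtain k where k: "k < m" "y = \<sigma> (Y k)" using y by (auto simp: ys_def)
    have "(\<Oplus>\<^bsub>t.R\<^esub>i\<in>{..m}. j (a i) \<otimes>\<^bsub>t.R\<^esub> (t.\<delta> ^^ i) y) = \<sigma> (\<Sum>i\<in>{..m}. \<tau> (a i) * (der ^^ i) (Y k))"
    proof (rule t.R_finsum)
      fix i assume "i \<in> {..m}"
      then have "\<tau> (a i) \<in> L" "(der ^^ i) (Y k) \<in> L" "Y k \<in> L" using \<tau>L aE YL k(1) YL[of k 0] by auto
      then show "\<tau> (a i) * (der ^^ i) (Y k) \<in> L" "j (a i) \<otimes>\<^bsub>t.R\<^esub> (t.\<delta> ^^ i) y = \<sigma> (\<tau> (a i) * (der ^^ i) (Y k))"
        by (simp_all add: k(2) j_def t.\<delta>_pow t.R_mult t.in_L)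
    qed simp
    then show ?thesis by (simp add: eqn[OF k(1)])
  qed
  have "picard_vessiot_wrt ?EE der j t.R t.\<delta> m a"
    unfolding picard_vessiot_wrt_def
  proof (intro conjI dE t.diff_field_R j_hom const_R exI[of _ ys])
    show "\<forall>i\<le>m. a i \<in> carrier ?EE" using aE by (simp add: restrict_field_def)
    show "a m \<noteq> \<zero>\<^bsub>?EE\<^esub>" by (simp add: a_def restrict_field_def)
    show "length ys = m" by (simp add: ys_def)
    show "set ys \<subseteq> carrier t.R" by (rule ys)
    show "\<forall>y\<in>set ys. (\<Oplus>\<^bsub>t.R\<^esub>i\<in>{..m}. j (a i) \<otimes>\<^bsub>t.R\<^esub> (t.\<delta> ^^ i) y) = \<zero>\<^bsub>t.R\<^esub>" using sol by blast
    show "ring.independent t.R (j ` constants_on ?EE der) ys" by (rule indep)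
    show "carrier t.R = generate_field t.R (j ` carrier ?EE \<union> {(t.\<delta> ^^ k) y | k y. y \<in> set ys})" by (rule gen)
  qed
  then have "picard_vessiot ?EE der j t.R t.\<delta>" unfolding picard_vessiot_def by blast
  then obtain \<phi> where \<phi>: "\<phi> \<in> diff_hom t.R t.\<delta> (restrict_field M) der" "\<And>x. x \<in> E \<Longrightarrow> \<phi> (j x) = x"
    using M unfolding pv_complete_def by blast
  define h where "h x = \<phi> (\<sigma> x)" for x
  have h_add: "h (x + y) = h x + h y" and h_mult: "h (x * y) = h x * h y" if "x \<in> L" "y \<in> L" for x y
    using \<phi>(1) that unfolding h_def diff_hom_def
    by (auto simp: Ring.ring_hom_def restrict_field_def t.R_add[symmetric] t.R_mult[symmetric])
  have h_1: "h 1 = 1"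
    using \<phi>(1) by (simp add: h_def diff_hom_def Ring.ring_hom_def restrict_field_def)
  have h: "hom_on L h" using h_add h_mult h_1 by (simp add: hom_on_def)
  have h_der: "h (der x) = der (h x)" if "x \<in> L" for x
    using \<phi>(1) that by (auto simp: h_def diff_hom_def t.\<delta>_\<sigma>[symmetric])
  have h_pow: "h ((der ^^ k) x) = (der ^^ k) (h x)" if "x \<in> L" for x k
    using that by (induction k) (simp_all add: h_der der_pow_in[OF t.der_L])
  have h_\<tau>: "h (\<tau> x) = x" if "x \<in> E" for x using \<phi>(2)[OF that] by (simp add: h_def j_def)
  have Y0: "Y 0 \<in> L" using YL[of 0 0] m by simp
  have "Y 0 \<noteq> 0"
  proof
    assume Y00: "Y 0 = 0"
    have "(\<Sum>i<m. (if i = 0 then 1 else 0) * Y i) = 0"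
      by (rule sum.neutral) (simp add: Y00)
    then have "(if (0::nat) = 0 then 1 else (0::'l alg_closure fls)) = 0"
      using Y m by (intro wronskian_independent[of m Y "\<lambda>i. if i = 0 then 1 else 0" 0]) (auto simp: fundamental_def)
    then show False by simp
  qed
  then have "h (Y 0) * h (inverse (Y 0)) = 1"
    using h_mult[OF Y0, of "inverse (Y 0)"] t.L Y0 h_1 by (simp add: sfield_def)
  then have "h (Y 0) \<noteq> 0" by auto
  moreover have "(der ^^ m) (h (Y 0)) = (\<Sum>j<m. b j * (der ^^ j) (h (Y 0)))"
  proof -
    have in_L: "\<tau> (b i) \<in> L" "(der ^^ i) (Y 0) \<in> L" if "i < m" for i
      using \<tau>L[OF b[OF that]] YL[of 0 i] m by auto
    have "(der ^^ m) (h (Y 0)) = h (\<Sum>j<m. \<tau> (b j) * (der ^^ j) (Y 0))"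
      using Y m by (simp add: h_pow[OF Y0, symmetric] fundamental_def)
    also have "\<dots> = (\<Sum>j<m. h (\<tau> (b j) * (der ^^ j) (Y 0)))"
      using in_L by (intro hom_on_sum[OF t.sring_L h] t.in_L) auto
    also have "\<dots> = (\<Sum>j<m. b j * (der ^^ j) (h (Y 0)))"
      using in_L by (intro sum.cong) (auto simp: h_mult h_\<tau> b h_pow[OF Y0])
    finally show ?thesis .
  qed
  ultimately show ?thesis by blast
qed

end

text \<open>
  An operator of order \<open>m\<close> over \<open>'k\<close> becomes a monic equation over \<open>E\<close> after division by its leading
  coefficient.
\<close>

lemma linear_closure_solvable:
  fixes \<iota> :: "'k::diff_field \<Rightarrow> 'l::diff_field"
  assumes "linear_closure \<iota>"
  shows "solvable_in \<iota>"
  unfolding solvable_in_def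
proof (intro allI impI)
  fix P :: "'k diffop" assume P: "op_order P \<ge> 1"
  obtain E M where base: "sfield E" "\<And>x. x \<in> E \<Longrightarrow> der x \<in> E" "range \<iota> \<subseteq> E"
    "\<And>p. p \<in> polys {x \<in> E. der x = 0} \<Longrightarrow> degree p > 0 \<Longrightarrow> \<exists>x\<in>E. der x = 0 \<and> poly p x = 0"
    "pv_complete E M" using linear_closure_base[OF assms] by blast
  interpret diff_extension \<iota> using assms by unfold_locales (simp add: linear_closure_def)
  define m where "m = op_order P"
  define p where "p i = \<iota> (coeff (symb P) i)" for i
  define b where "b j = - (p j / p m)" for j
  have "P \<noteq> 0" using P by (auto simp: op_order_def)
  then have pm: "p m \<noteq> 0" by (simp add: p_def m_def op_order_def \<iota>_eq_0_iff)
  have bE: "b j \<in> E" for j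
  proof -
    have "p i \<in> E" for i using base(3) by (auto simp: p_def)
    then have "p j * inverse (p m) \<in> E" using base(1) by (auto simp: sfield_def intro: sring_mult)
    then show ?thesis using base(1) by (auto simp: sfield_def b_def divide_inverse intro: sring_minus)
  qed
  interpret monic_equation E m b
    using base(1,2,4) bE P by unfold_locales (auto simp: m_def)
  obtain y where y: "y \<noteq> 0" "(der ^^ m) y = (\<Sum>j<m. b j * (der ^^ j) y)"
    using solution_of_pv_complete[OF base(5)] by blast
  have "op_apply \<iota> P y = (\<Sum>j<m. p j * (der ^^ j) y) + p m * (der ^^ m) y"
    by (simp add: op_apply_def p_def m_def lessThan_Suc_atMost[symmetric])
  also have "p m * (der ^^ m) y = - (\<Sum>j<m. p j * (der ^^ j) y)"
    using pm by (simp add: y(2) b_def sum_distrib_left sum_negf)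
  finally show "\<exists>y. y \<noteq> 0 \<and> op_apply \<iota> P y = 0" using y(1) by auto
qed

theorem theorem7p1:
  fixes A B :: "'k::diff_field diffop^'n::{finite,linorder}^'n::{finite,linorder}"
    and \<iota> :: "'k \<Rightarrow> 'l::diff_field"
  assumes "dieudonne_det B \<noteq> 0"
    and "mat_adj A ** B + mat_adj B ** A = 0"
    and "linear_closure \<iota>"
    and "minimal_fraction \<iota> A B"
  shows "maximal_isotropic A B \<and>
    (\<forall>G H. mat_apply id (mat_adj A) H + mat_apply id (mat_adj B) G = 0 \<longrightarrow>
       (\<exists>F. G = mat_apply id A F \<and> H = mat_apply id B F))"
proof -
  interpret diff_extension \<iota> using assms(3) by unfold_locales (simp add: linear_closure_def)
  obtain C D where "C ** A + D ** B = mat 1"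
    by (rule bezout_of_minimal_fraction[OF linear_closure_solvable[OF assms(3)] assms(4)])
  note sol = isotropic_coprime_solution[OF assms(2) this]
  then have "maximal_isotropic A B"
    using assms(2) unfolding maximal_isotropic_def frac_subspace_def by blast
  then show ?thesis using sol by blast
qed

end
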